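(* Let $n\ge 3$ and let $M$ be a cusped nonelementary hyperbolic $n$-manifold. Suppose that $M$ has a cusp whose cross-section is a flat $(n-1)$-manifold $\mathbb{R}^{n-1}/\Gamma_c$ with $\Gamma_c\cong\mathbb{Z}^{n-1}$. Then $M$ contains infinitely many simple closed geodesics.
   Context: A hyperbolic $n$-manifold is a complete Riemannian $n$-manifold of constant curvature $-1$, i.e. $M=\mathbb{H}^n/\Gamma$ with $\Gamma\cong\pi_1(M)$ a discrete torsion-free subgroup of $\mathrm{Isom}(\mathbb{H}^n)$. No orientability or finite-volume assumption is made. $M$ is nonelementary if $\Gamma$ is a nonelementary group. A cusp of $M$ is an end with a neighbourhood (a horocusp) of the form $\mathcal{H}/\Gamma_{\mathcal H}$, embedded in $M$, where $\mathcal{H}\subset\mathbb{H}^n$ is a horoball and $\Gamma_{\mathcal H}\subset\Gamma$ is the nontrivial subgroup of elements stabilizing $\mathcal{H}$. The horosphere $\partial\mathcal{H}$ with its induced metric is a Euclidean space $\mathbb{R}^{n-1}$, on which $\Gamma_{\mathcal H}$ acts as a discrete group $\Gamma_c$ of Euclidean isometries acting freely; the cusp is thus represented by the flat manifold $\mathbb{R}^{n-1}/\Gamma_c$. $M$ is cusped if it has at least one cusp. A closed geodesic is simple if it has no self-intersections. *)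

theory Defs
  imports "HOL-Analysis.Analysis" "HOL-Algebra.Bij" "HOL-Algebra.Product_Groups"
begin

text \<open>Hyperbolic space of dimension \<open>n = DIM('a \<times> real)\<close>: the upper half-space model.\<close>

definition hspace :: "('a::euclidean_space \<times> real) set"
  where "hspace = {p. snd p > 0}"

definition hdist :: "'a::euclidean_space \<times> real \<Rightarrow> 'a \<times> real \<Rightarrow> real"
  where "hdist p q = arcosh (1 + (dist p q)\<^sup>2 / (2 * snd p * snd q))"

definition isom_group :: "('a::euclidean_space \<times> real \<Rightarrow> 'a \<times> real) monoid"
  where "isom_group = (BijGroup hspace)
    \<lparr>carrier := {f \<in> Bij hspace. \<forall>p\<in>hspace. \<forall>q\<in>hspace. hdist (f p) (f q) = hdist p q}\<rparr>"

text \<open>The topology on the isometry group is that of pointwise convergence, which for isometries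
  is the compact-open topology. The hyperbolic metric induces the Euclidean topology on
  the half-space, so \<open>top_of_set\<close> is the right topology on the factors.\<close>

definition discrete_isoms :: "('a::euclidean_space \<times> real \<Rightarrow> 'a \<times> real) set \<Rightarrow> bool"
  where "discrete_isoms \<Gamma> \<longleftrightarrow>
    subtopology (product_topology (\<lambda>_. top_of_set hspace) hspace) \<Gamma> = discrete_topology \<Gamma>"

definition torsion_free_isoms :: "('a::euclidean_space \<times> real \<Rightarrow> 'a \<times> real) set \<Rightarrow> bool"
  where "torsion_free_isoms \<Gamma> \<longleftrightarrow>
    (\<forall>g\<in>\<Gamma>. g \<noteq> \<one>\<^bsub>isom_group\<^esub> \<longrightarrow>
       (\<forall>k::nat. k > 0 \<longrightarrow> g [^]\<^bsub>isom_group\<^esub> k \<noteq> \<one>\<^bsub>isom_group\<^esub>))"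

text \<open>A hyperbolic manifold is given by its group \<open>\<Gamma>\<close>; its points are the \<open>\<Gamma>\<close>-orbits.\<close>

definition hyperbolic_manifold :: "('a::euclidean_space \<times> real \<Rightarrow> 'a \<times> real) set \<Rightarrow> bool"
  where "hyperbolic_manifold \<Gamma> \<longleftrightarrow>
    subgroup \<Gamma> isom_group \<and> discrete_isoms \<Gamma> \<and> torsion_free_isoms \<Gamma>"

definition orb :: "('a::euclidean_space \<times> real \<Rightarrow> 'a \<times> real) set \<Rightarrow> 'a \<times> real \<Rightarrow> ('a \<times> real) set"
  where "orb \<Gamma> p = (\<lambda>g. g p) ` \<Gamma>"

definition quot_space :: "('a::euclidean_space \<times> real \<Rightarrow> 'a \<times> real) set \<Rightarrow> ('a \<times> real) set set"
  where "quot_space \<Gamma> = orb \<Gamma> ` hspace"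

definition quot_dist :: "('a::euclidean_space \<times> real) set \<Rightarrow> ('a \<times> real) set \<Rightarrow> real"
  where "quot_dist A B = Inf {hdist p q |p q. p \<in> A \<and> q \<in> B}"

text \<open>Points of the sphere at infinity are classes of asymptotic geodesic rays. Values of a ray
  at negative parameters are irrelevant.\<close>

definition geodesic_ray :: "(real \<Rightarrow> 'a::euclidean_space \<times> real) \<Rightarrow> bool"
  where "geodesic_ray \<rho> \<longleftrightarrow> (\<forall>t\<ge>0. \<rho> t \<in> hspace) \<and>
    (\<forall>s\<ge>0. \<forall>t\<ge>0. hdist (\<rho> s) (\<rho> t) = \<bar>s - t\<bar>)"

definition ideal_point ::
    "(real \<Rightarrow> 'a::euclidean_space \<times> real) \<Rightarrow> (real \<Rightarrow> 'a \<times> real) set"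
  where "ideal_point \<rho> = {\<sigma>. geodesic_ray \<sigma> \<and> (\<exists>C. \<forall>t\<ge>0. hdist (\<rho> t) (\<sigma> t) \<le> C)}"

text \<open>A group is elementary if it has a finite orbit in the union of hyperbolic space and its
  sphere at infinity.\<close>

definition elementary :: "('a::euclidean_space \<times> real \<Rightarrow> 'a \<times> real) set \<Rightarrow> bool"
  where "elementary \<Gamma> \<longleftrightarrow>
    (\<exists>p\<in>hspace. finite (orb \<Gamma> p)) \<or>
    (\<exists>\<rho>. geodesic_ray \<rho> \<and> finite ((\<lambda>g. ideal_point (g \<circ> \<rho>)) ` \<Gamma>))"

text \<open>Open horoballs: centred at \<open>\<infinity>\<close>, or at the boundary point \<open>(a, 0)\<close>, where they
  are Euclidean balls tangent to the boundary hyperplane.\<close>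

definition horoball :: "('a::euclidean_space \<times> real) set \<Rightarrow> bool"
  where "horoball B \<longleftrightarrow> (\<exists>c>0. B = {p. snd p > c}) \<or> (\<exists>a r. r > 0 \<and> B = ball (a, r) r)"

text \<open>The intersection discards the point of tangency.\<close>

definition horosphere :: "('a::euclidean_space \<times> real) set \<Rightarrow> ('a \<times> real) set"
  where "horosphere B = frontier B \<inter> hspace"

definition horoball_stabilizer ::
    "('a::euclidean_space \<times> real \<Rightarrow> 'a \<times> real) set \<Rightarrow> ('a \<times> real) set \<Rightarrow> ('a \<times> real \<Rightarrow> 'a \<times> real) set"
  where "horoball_stabilizer \<Gamma> B = {g \<in> \<Gamma>. g ` B = B}"

text \<open>The last conjunct says that the natural map from \<open>B\<close> modulo its stabilizer to the manifold
  is injective; being a local homeomorphism, it is then an embedding.\<close>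

definition horocusp ::
    "('a::euclidean_space \<times> real \<Rightarrow> 'a \<times> real) set \<Rightarrow> ('a \<times> real) set \<Rightarrow> bool"
  where "horocusp \<Gamma> B \<longleftrightarrow> horoball B \<and>
    horoball_stabilizer \<Gamma> B \<noteq> {\<one>\<^bsub>isom_group\<^esub>} \<and>
    (\<forall>p\<in>B. \<forall>q\<in>B. orb \<Gamma> p = orb \<Gamma> q \<longrightarrow>
       orb (horoball_stabilizer \<Gamma> B) p = orb (horoball_stabilizer \<Gamma> B) q)"

definition cusped :: "('a::euclidean_space \<times> real \<Rightarrow> 'a \<times> real) set \<Rightarrow> bool"
  where "cusped \<Gamma> \<longleftrightarrow> (\<exists>B. horocusp \<Gamma> B)"

definition cusp_group ::
    "('a::euclidean_space \<times> real \<Rightarrow> 'a \<times> real) set \<Rightarrow> ('a \<times> real) set \<Rightarrow> ('a \<times> real \<Rightarrow> 'a \<times> real) monoid"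
  where "cusp_group \<Gamma> B = (BijGroup (horosphere B))
    \<lparr>carrier := (\<lambda>g. restrict g (horosphere B)) ` horoball_stabilizer \<Gamma> B\<rparr>"

text \<open>Closed geodesics of length \<open>L\<close> are parametrized by arc length. A simple closed geodesic is
  identified with its image, so that reparametrizations are not counted separately.\<close>

definition closed_geodesic ::
    "('a::euclidean_space \<times> real \<Rightarrow> 'a \<times> real) set \<Rightarrow> real \<Rightarrow> (real \<Rightarrow> ('a \<times> real) set) \<Rightarrow> bool"
  where "closed_geodesic \<Gamma> L c \<longleftrightarrow> L > 0 \<and> (\<forall>t. c t \<in> quot_space \<Gamma>) \<and> (\<forall>t. c (t + L) = c t) \<and>
    (\<forall>t. \<exists>e>0. \<forall>s\<in>{t-e<..<t+e}. \<forall>u\<in>{t-e<..<t+e}. quot_dist (c s) (c u) = \<bar>s - u\<bar>)"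

definition simple_closed_geodesics ::
    "('a::euclidean_space \<times> real \<Rightarrow> 'a \<times> real) set \<Rightarrow> ('a \<times> real) set set set"
  where "simple_closed_geodesics \<Gamma> = {range c |c. \<exists>L. closed_geodesic \<Gamma> L c \<and> inj_on c {0..<L}}"

end

theory Submission
  imports Defs
begin

text \<open>Move the given cusp to \<open>\<infinity>\<close> in the upper half-space. Its stabilizer is isomorphic to \<open>\<int>\<^sup>d\<close> and acts
  discretely on the horospheres, which are copies of \<open>\<real>\<^sup>d\<close>; by a special case of Bieberbach's theorem it is a lattice
  of translations (\<open>free_abelian_isometries_are_translations\<close>, \<open>cusp_lattice\<close>). An element \<open>g\<close> of the group
  that does not fix \<open>\<infinity>\<close>, and there are such elements because the group is nonelementary, is an inversion in a
  hemisphere (its isometric sphere) followed by a horizontal Euclidean isometry. The lattice is cocompact and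
  the cusp is embedded, so some \<open>g\<close> has an isometric sphere of largest radius \<open>r\<close>
  (\<open>largest_isometric_sphere\<close>); then two points of one orbit that are both higher than \<open>r\<close> differ by a
  lattice translation.

  Let \<open>a\<close> and \<open>b\<close> be the centres of the isometric spheres of \<open>g\<close> and of its inverse. For a long lattice vector
  \<open>v\<close> consider the composition \<open>\<gamma>\<close> of \<open>g\<close> with the translation by \<open>v\<close>. It is loxodromic, with an axis that is
  nearly the semicircle from \<open>a\<close> to \<open>b + v\<close>. Modulo \<open>\<gamma>\<close> the axis reduces to the part above the two
  hemispheres over \<open>a\<close> and \<open>b + v\<close>, and nearly all of this part is higher than \<open>r\<close>; what remains is close to
  the top \<open>P\<close> of the first hemisphere or to \<open>\<gamma> P\<close>. A self-intersection of the projected axis close to the orbit of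
  \<open>P\<close> is impossible, because near \<open>P\<close> the projection to the quotient is injective. One higher up would come from
  a lattice translation along the direction of the axis that is shorter than the vector between its
  ends (\<open>simple_axisI\<close>).

  It remains to choose \<open>v\<close> such that there is no such translation. Here freeness of the action enters:
  \<open>b - a\<close> is not a lattice vector, because otherwise a lattice translate of \<open>g\<close> would fix \<open>P\<close>
  (\<open>displacement_not_lattice\<close>). So some coordinate of \<open>b - a\<close> in a basis of the lattice is not an integer. Since
  \<open>d \<ge> 2\<close>, there are arbitrarily long \<open>v\<close> for which this coordinate of \<open>b - a + v\<close> lies strictly
  between \<open>0\<close> and \<open>1\<close> (\<open>displacement_sequence\<close>), and for long \<open>v\<close> the same holds for the vector between the
  ends of the axis. A proper fraction of that vector then has a coordinate that is not an integer, or is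
  zero.

  The closed geodesics obtained in this way rise arbitrarily high into the cusp, while each of them
  has bounded height, so there are infinitely many (\<open>infinite_simple_closed_geodesics\<close>).\<close>

section \<open>Distance in the upper half-space\<close>

text \<open>The hyperbolic cosine of \<open>hdist\<close>, a rational function of the coordinates.\<close>

definition hcosh :: "'a::euclidean_space \<times> real \<Rightarrow> 'a \<times> real \<Rightarrow> real"
  where "hcosh p q = 1 + (dist p q)\<^sup>2 / (2 * snd p * snd q)"

lemma in_hspace [simp]: "p \<in> hspace \<longleftrightarrow> snd p > 0"
  by (simp add: hspace_def)

lemma hcosh_ge_1: "p \<in> hspace \<Longrightarrow> q \<in> hspace \<Longrightarrow> hcosh p q \<ge> 1"
  by (simp add: hcosh_def)

lemma hdist_eq: "hdist p q = arcosh (hcosh p q)"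
  by (simp add: hdist_def hcosh_def)

lemma cosh_hdist: "p \<in> hspace \<Longrightarrow> q \<in> hspace \<Longrightarrow> cosh (hdist p q) = hcosh p q"
  using hcosh_ge_1[of p q] by (simp add: hdist_eq)

lemma hdist_nonneg: "p \<in> hspace \<Longrightarrow> q \<in> hspace \<Longrightarrow> hdist p q \<ge> 0"
  using hcosh_ge_1[of p q] by (simp add: hdist_eq)

lemma hcosh_commute: "hcosh p q = hcosh q p"
  by (simp add: hcosh_def dist_commute mult_ac)

lemma hdist_commute: "hdist p q = hdist q p"
  by (simp add: hdist_eq hcosh_commute)

lemma hcosh_refl [simp]: "hcosh p p = 1"
  by (simp add: hcosh_def)

lemma hdist_refl [simp]: "hdist p p = 0"
  by (simp add: hdist_eq)

lemma hdist_eq_0_iff: "p \<in> hspace \<Longrightarrow> q \<in> hspace \<Longrightarrow> hdist p q = 0 \<longleftrightarrow> p = q"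
  using hcosh_ge_1[of p q] by (simp add: hdist_eq) (simp add: hcosh_def)

lemma hdist_le_iff:
  assumes "p \<in> hspace" "q \<in> hspace" "R \<ge> 0"
  shows "hdist p q \<le> R \<longleftrightarrow> hcosh p q \<le> cosh R"
  using cosh_real_nonneg_le_iff[of "hdist p q" R] hdist_nonneg[of p q] cosh_hdist[of p q] assms by auto

lemma hdist_cosh_eq:
  assumes "p \<in> hspace" "q \<in> hspace" "hcosh p q = cosh R"
  shows "hdist p q = \<bar>R\<bar>"
proof -
  have "hcosh p q = cosh \<bar>R\<bar>" using assms by (simp add: abs_if)
  then show ?thesis by (metis abs_ge_zero arcosh_cosh_real hdist_eq)
qed

lemma dist_prod_sq: "(dist p q)\<^sup>2 = (norm (fst p - fst q))\<^sup>2 + (snd p - snd q)\<^sup>2"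
  for p q :: "'a::euclidean_space \<times> real"
  by (cases p; cases q) (simp add: dist_prod_def dist_norm power2_eq_square[symmetric] power2_abs)

text \<open>Coordinates on the hyperboloid, centred at the point \<open>o'\<close>: in these the hyperbolic law of
  cosines is a Euclidean inner product, and the triangle inequality is Cauchy-Schwarz.\<close>

definition hyperboloid :: "'a::euclidean_space \<times> real \<Rightarrow> 'a \<times> real \<Rightarrow> 'a \<times> real"
  where "hyperboloid o' p = (let x = fst p - fst o'; t = snd p; u = snd o' in
     ((1 / t) *\<^sub>R x, ((norm x)\<^sup>2 + t\<^sup>2 - u\<^sup>2) / (2 * t * u)))"

lemma hcosh_eq: "p \<in> hspace \<Longrightarrow> q \<in> hspace \<Longrightarrow>
  hcosh p q = ((norm (fst p - fst q))\<^sup>2 + (snd p)\<^sup>2 + (snd q)\<^sup>2) / (2 * snd p * snd q)"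
  unfolding hcosh_def dist_prod_sq by (simp add: field_simps power2_eq_square)

lemma hyperboloid_inner:
  assumes "p \<in> hspace" "q \<in> hspace" "o' \<in> hspace"
  shows "hcosh p q = hcosh p o' * hcosh o' q - hyperboloid o' p \<bullet> hyperboloid o' q"
proof -
  define x z where "x = fst p - fst o'" and "z = fst q - fst o'"
  have e: "fst p - fst q = x - z" "fst p - fst o' = x" "norm (fst o' - fst q) = norm z"
    by (auto simp: x_def z_def norm_minus_commute)
  have n: "(norm (x - z))\<^sup>2 = (norm x)\<^sup>2 + (norm z)\<^sup>2 - 2 * (x \<bullet> z)"
    by (simp add: power2_norm_eq_inner inner_diff algebra_simps inner_commute)
  have pos: "snd p > 0" "snd q > 0" "snd o' > 0" using assms by auto
  show ?thesis
    using pos unfolding hcosh_eq[OF assms(1,2)] hcosh_eq[OF assms(1,3)] hcosh_eq[OF assms(3,2)]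
      hyperboloid_def Let_def e x_def[symmetric] z_def[symmetric] n
    by (simp add: field_simps power2_eq_square)
qed

lemma hyperboloid_norm:
  assumes "p \<in> hspace" "o' \<in> hspace"
  shows "norm (hyperboloid o' p) = sinh (hdist p o')"
proof -
  have "(norm (hyperboloid o' p))\<^sup>2 = (hcosh p o')\<^sup>2 - 1"
    using hyperboloid_inner[OF assms(1,1,2)]
    by (simp add: power2_norm_eq_inner hcosh_commute[of o' p] power2_eq_square[of "hcosh p o'"])
  also have "\<dots> = (sinh (hdist p o'))\<^sup>2"
    using cosh_hdist[OF assms] cosh_square_eq[of "hdist p o'"] by simp
  finally show ?thesis
    using hdist_nonneg[OF assms] by (simp add: power2_eq_iff_nonneg)
qed

lemma hdist_triangle:
  assumes "p \<in> hspace" "q \<in> hspace" "o' \<in> hspace"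
  shows "hdist p q \<le> hdist p o' + hdist o' q"
proof -
  have "- (hyperboloid o' p \<bullet> hyperboloid o' q) \<le> sinh (hdist p o') * sinh (hdist o' q)"
    using norm_cauchy_schwarz[of "- hyperboloid o' p" "hyperboloid o' q"]
      hyperboloid_norm[OF assms(1,3)] hyperboloid_norm[OF assms(2,3)]
    by (simp add: hdist_commute[of q o'])
  then have "hcosh p q \<le> cosh (hdist p o' + hdist o' q)"
    using hyperboloid_inner[OF assms] assms by (simp add: cosh_add cosh_hdist)
  then show ?thesis
    using hdist_le_iff[OF assms(1,2), of "hdist p o' + hdist o' q"]
      hdist_nonneg[OF assms(1,3)] hdist_nonneg[OF assms(3,2)] by simp
qed

text \<open>The logarithm of the height is a Busemann function, hence 1-Lipschitz: among points of two given
  heights, those on a common vertical line are closest.\<close>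

lemma snd_le_exp_hdist:
  assumes "p \<in> hspace" "q \<in> hspace"
  shows "snd p \<le> snd q * exp (hdist p q)"
proof -
  have pos: "snd p > 0" "snd q > 0" using assms by auto
  have "cosh (ln (snd p / snd q)) = (snd p / snd q + snd q / snd p) / 2"
    using pos by (simp add: cosh_def exp_minus field_simps)
  also have "\<dots> = ((snd p)\<^sup>2 + (snd q)\<^sup>2) / (2 * snd p * snd q)"
    using pos by (simp add: field_simps power2_eq_square)
  also have "\<dots> \<le> hcosh p q"
    unfolding hcosh_eq[OF assms] using pos by (intro divide_right_mono) auto
  also have "\<dots> = cosh (hdist p q)" using cosh_hdist[OF assms] by simp
  finally have "cosh \<bar>ln (snd p / snd q)\<bar> \<le> cosh (hdist p q)"
    by (simp add: abs_if)
  then have "\<bar>ln (snd p / snd q)\<bar> \<le> hdist p q"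
    using hdist_nonneg[OF assms] by (subst (asm) cosh_real_nonneg_le_iff) auto
  then have "snd p / snd q \<le> exp (hdist p q)"
    using pos by (metis abs_le_D1 divide_pos_pos exp_le_cancel_iff exp_ln)
  then show ?thesis using pos by (simp add: field_simps)
qed

text \<open>On a ball the heights are bounded away from \<open>0\<close> and \<open>\<infinity>\<close>, and then the hyperbolic distance
  controls the Euclidean one.\<close>

lemma hball_subset_compact:
  assumes "p \<in> hspace"
  shows "\<exists>K. compact K \<and> K \<subseteq> hspace \<and> {q \<in> hspace. hdist p q \<le> R} \<subseteq> K"
proof -
  define u where "u = snd p"
  have u: "u > 0" using assms by (simp add: u_def)
  define D where "D = sqrt (2 * u * (u * exp R) * cosh R)"
  let ?K = "cball (fst p) D \<times> {u * exp (-R)..u * exp R}"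
  have "{q \<in> hspace. hdist p q \<le> R} \<subseteq> ?K"
  proof
    fix q assume "q \<in> {q \<in> hspace. hdist p q \<le> R}"
    then have q: "q \<in> hspace" "hdist p q \<le> R" by auto
    have sq: "snd q > 0" using q by simp
    have R0: "R \<ge> 0" using hdist_nonneg[OF assms q(1)] q by linarith
    have "exp (hdist p q) \<le> exp R" using q by simp
    then have "snd q * exp (hdist p q) \<le> snd q * exp R" "u * exp (hdist p q) \<le> u * exp R"
      using u sq by auto
    then have up: "u \<le> snd q * exp R" "snd q \<le> u * exp R"
      using snd_le_exp_hdist[OF assms q(1)] snd_le_exp_hdist[OF q(1) assms]
      unfolding u_def hdist_commute[of q p] by linarith+
    have "hcosh p q \<le> cosh R" using hdist_le_iff[OF assms q(1) R0] q by simp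
    then have "(dist p q)\<^sup>2 / (2 * u * snd q) \<le> cosh R" by (simp add: hcosh_def u_def)
    then have "(dist p q)\<^sup>2 \<le> (2 * u * snd q) * cosh R"
      using u sq by (simp add: divide_le_eq mult.commute)
    also have "\<dots> \<le> (2 * u * (u * exp R)) * cosh R"
      using up u by (intro mult_right_mono mult_left_mono) auto
    finally have "dist p q \<le> D" unfolding D_def by (simp add: real_le_rsqrt)
    moreover have "dist (fst p) (fst q) \<le> dist p q" by (simp add: dist_fst_le)
    ultimately have "dist (fst p) (fst q) \<le> D" by linarith
    then show "q \<in> ?K" using up by (cases q) (auto simp: exp_minus field_simps)
  qed
  moreover have "?K \<subseteq> hspace"
    using mult_pos_pos[OF u exp_gt_zero[of "- R"]] by (auto simp del: exp_gt_zero)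
  moreover have "compact ?K" by (intro compact_Times) auto
  ultimately show ?thesis by blast
qed

lemma tendsto_hdist_0:
  assumes "f \<longlonglongrightarrow> p" "\<And>n. f n \<in> hspace" "p \<in> hspace"
  shows "(\<lambda>n. hdist (f n) p) \<longlonglongrightarrow> 0"
proof -
  have "(\<lambda>n. hcosh (f n) p) \<longlonglongrightarrow> hcosh p p"
    unfolding hcosh_def using assms(3) by (intro tendsto_intros assms(1)) auto
  then have "(\<lambda>n. arcosh (hcosh (f n) p)) \<longlonglongrightarrow> arcosh (hcosh p p)"
    by (intro tendsto_arcosh_strong) (auto intro!: always_eventually hcosh_ge_1 assms(2,3) simp del: in_hspace)
  then show ?thesis by (simp add: hdist_eq)
qed

section \<open>Isometries and isometric spheres\<close>

definition hisom :: "('a::euclidean_space \<times> real \<Rightarrow> 'a \<times> real) \<Rightarrow> bool"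
  where "hisom g \<longleftrightarrow> (\<forall>p\<in>hspace. g p \<in> hspace) \<and>
    (\<forall>p\<in>hspace. \<forall>q\<in>hspace. hdist (g p) (g q) = hdist p q)"

lemma hisom_pos: "hisom g \<Longrightarrow> snd p > 0 \<Longrightarrow> snd (g p) > 0"
  by (auto simp: hisom_def)

lemma hisom_hdist: "hisom g \<Longrightarrow> p \<in> hspace \<Longrightarrow> q \<in> hspace \<Longrightarrow> hdist (g p) (g q) = hdist p q"
  by (auto simp: hisom_def)

lemma hisom_hcosh: "hisom g \<Longrightarrow> p \<in> hspace \<Longrightarrow> q \<in> hspace \<Longrightarrow> hcosh (g p) (g q) = hcosh p q"
  by (metis cosh_hdist hisom_def)

lemma hisomI:
  assumes "\<And>p. snd p > 0 \<Longrightarrow> snd (g p) > 0"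
    and "\<And>p q. snd p > 0 \<Longrightarrow> snd q > 0 \<Longrightarrow> hcosh (g p) (g q) = hcosh p q"
  shows "hisom g"
  using assms by (auto simp: hisom_def hdist_eq)

lemma hisom_comp: "hisom f \<Longrightarrow> hisom g \<Longrightarrow> hisom (f \<circ> g)"
  by (auto simp: hisom_def)

lemma hisom_dist:
  assumes "hisom g" "p \<in> hspace" "q \<in> hspace"
  shows "(dist (g p) (g q))\<^sup>2 = (dist p q)\<^sup>2 * (snd (g p) / snd p) * (snd (g q) / snd q)"
proof -
  have "(dist (g p) (g q))\<^sup>2 / (2 * snd (g p) * snd (g q)) = (dist p q)\<^sup>2 / (2 * snd p * snd q)"
    using hisom_hcosh[OF assms] by (simp add: hcosh_def)
  then show ?thesis using assms hisom_pos[OF assms(1), of p] hisom_pos[OF assms(1), of q]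
    by (simp add: field_simps)
qed

definition inversion :: "'b::euclidean_space \<Rightarrow> real \<Rightarrow> 'b \<Rightarrow> 'b"
  where "inversion c r p = c + (r\<^sup>2 / (dist p c)\<^sup>2) *\<^sub>R (p - c)"

lemma dist_inversion_center:
  assumes "p \<noteq> c"
  shows "dist (inversion c r p) c = r\<^sup>2 / dist p c"
  using assms by (simp add: inversion_def dist_norm power2_eq_square)

lemma inversion_neq_center: "p \<noteq> c \<Longrightarrow> r > 0 \<Longrightarrow> inversion c r p \<noteq> c"
  by (simp add: inversion_def)

lemma inversion_involutive:
  assumes "p \<noteq> c" "r > 0"
  shows "inversion c r (inversion c r p) = p"
proof -
  have "r\<^sup>2 / (dist (inversion c r p) c)\<^sup>2 * (r\<^sup>2 / (dist p c)\<^sup>2) = 1"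
    using assms by (simp add: dist_inversion_center field_simps power2_eq_square)
  then show ?thesis
    unfolding inversion_def[of c r "inversion c r p"] by (simp add: inversion_def)
qed

lemma dist_inversion:
  assumes "p \<noteq> c" "q \<noteq> c"
  shows "dist (inversion c r p) (inversion c r q) = r\<^sup>2 * dist p q / (dist p c * dist q c)"
proof -
  define u v where "u = p - c" and "v = q - c"
  have [simp]: "u \<noteq> 0" "v \<noteq> 0" using assms by (auto simp: u_def v_def)
  have uv: "dist p q = norm (u - v)" "dist p c = norm u" "dist q c = norm v"
    by (auto simp: u_def v_def dist_norm)
  have i: "u \<bullet> u = (norm u)\<^sup>2" "v \<bullet> v = (norm v)\<^sup>2" by (auto simp: power2_norm_eq_inner)
  have e: "(norm (u - v))\<^sup>2 = (norm u)\<^sup>2 + (norm v)\<^sup>2 - 2 * (u \<bullet> v)"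
    by (simp add: power2_norm_eq_inner inner_diff inner_commute)
  have "(dist (inversion c r p) (inversion c r q))\<^sup>2 =
      (norm ((r\<^sup>2 / (norm u)\<^sup>2) *\<^sub>R u - (r\<^sup>2 / (norm v)\<^sup>2) *\<^sub>R v))\<^sup>2"
    by (simp add: inversion_def uv dist_norm) (simp add: u_def v_def)
  also have "\<dots> = (r\<^sup>2 / (norm u)\<^sup>2)\<^sup>2 * (norm u)\<^sup>2 + (r\<^sup>2 / (norm v)\<^sup>2)\<^sup>2 * (norm v)\<^sup>2
      - 2 * (r\<^sup>2 / (norm u)\<^sup>2) * (r\<^sup>2 / (norm v)\<^sup>2) * (u \<bullet> v)"
    unfolding i[symmetric] power2_norm_eq_inner[of "_ - _"]
    by (simp add: inner_diff inner_commute[of v u] power2_eq_square algebra_simps)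
  also have "\<dots> = (r\<^sup>2 * norm (u - v) / (norm u * norm v))\<^sup>2"
    unfolding power_mult_distrib power_divide e by (simp add: field_simps power2_eq_square)
  finally show ?thesis unfolding uv by (simp add: power2_eq_iff_nonneg)
qed

lemma snd_inversion: "snd (inversion (a, 0) r p) = r\<^sup>2 * snd p / (dist p (a, 0))\<^sup>2"
  for a :: "'a::euclidean_space"
  by (simp add: inversion_def)

lemma hspace_neq: "snd p > 0 \<Longrightarrow> p \<noteq> (a, 0)"
  for p :: "'a::euclidean_space \<times> real"
  by auto

lemma snd_inversion_pos: "r > 0 \<Longrightarrow> snd p > 0 \<Longrightarrow> snd (inversion (a, 0) r p) > 0"
  for p :: "'a::euclidean_space \<times> real"
  unfolding snd_inversion using hspace_neq[of p a] by (intro divide_pos_pos mult_pos_pos) auto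

lemma hisom_inversion:
  fixes a :: "'a::euclidean_space"
  assumes "r > 0"
  shows "hisom (inversion (a, 0) r)"
proof (rule hisomI)
  fix p q :: "'a \<times> real"
  assume p: "snd p > 0" and q: "snd q > 0"
  have "dist p (a, 0) > 0" "dist q (a, 0) > 0" using hspace_neq[OF p] hspace_neq[OF q] by auto
  then show "hcosh (inversion (a, 0) r p) (inversion (a, 0) r q) = hcosh p q"
    unfolding hcosh_def dist_inversion[OF hspace_neq[OF p] hspace_neq[OF q]] snd_inversion
    using assms p q by (simp add: field_simps power2_eq_square)
qed (use assms snd_inversion_pos in auto)

text \<open>The distance to a point far up a vertical line measures the height:
  \<open>1 / snd (g p)\<close> is the limit of \<open>2 * hcosh (g p) (0, s) / s\<close> as \<open>s\<close> tends to \<open>\<infinity>\<close>. Here \<open>(0, s)\<close>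
  is the image of a point that runs off to the ideal point sent to \<open>\<infinity>\<close> by \<open>g\<close>, and \<open>g\<close> cancels
  from the distance. Multiplied by \<open>snd p\<close>, this is a multiple of \<open>|x|\<^sup>2 + t\<^sup>2\<close> plus an affine function
  of \<open>x\<close>, where \<open>p = (x, t)\<close>; so is the limit. The limit is constant if the ideal point is \<open>\<infinity>\<close>,
  and otherwise a multiple of the squared distance to that point.\<close>

lemma isometry_height_dichotomy:
  fixes g :: "'a::euclidean_space \<times> real \<Rightarrow> 'a \<times> real"
  assumes g: "hisom g" and surj: "\<And>q. q \<in> hspace \<Longrightarrow> \<exists>p\<in>hspace. g p = q"
  shows "(\<exists>c>0. \<forall>p\<in>hspace. snd (g p) = c * snd p) \<or>
         (\<exists>a r. r > 0 \<and> (\<forall>p\<in>hspace. snd (g p) = r\<^sup>2 * snd p / (dist p (a, 0))\<^sup>2))"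
proof -
  define s where "s n = real (Suc n)" for n
  have s: "s n > 0" for n by (simp add: s_def)
  have s_lim: "(\<lambda>n. 1 / s n) \<longlonglongrightarrow> 0"
    unfolding s_def using LIMSEQ_inverse_real_of_nat by (simp add: inverse_eq_divide)
  have "\<exists>p\<in>hspace. g p = (0, s n)" for n using surj[of "(0, s n)"] s[of n] by auto
  then obtain q where q: "\<And>n. q n \<in> hspace" and gq: "\<And>n. g (q n) = (0, s n)" by metis
  define y \<tau> where "y n = fst (q n)" and "\<tau> n = snd (q n)" for n
  have \<tau>: "\<tau> n > 0" for n using q[of n] by (simp add: \<tau>_def)
  define K where "K n = 1 / (\<tau> n * s n)" for n
  define F where "F n p = K n * ((norm (fst p - y n))\<^sup>2 + (snd p)\<^sup>2 + (\<tau> n)\<^sup>2)" for n p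
  define W where "W p = snd p / snd (g p)" for p
  have F_lim: "(\<lambda>n. F n p) \<longlonglongrightarrow> W p" if p: "snd p > 0" for p
  proof -
    have gp: "snd (g p) > 0" using hisom_pos[OF g p] .
    have A: "hcosh p (q n) = hcosh (g p) (0, s n)" for n
      using hisom_hcosh[OF g, of p "q n"] p q[of n] gq[of n] by simp
    have B: "hcosh p (q n) = F n p * s n / (2 * snd p)" for n
    proof -
      have "K n * N * s n / (2 * snd p) = N / (2 * snd p * \<tau> n)" for N
        using \<tau>[of n] s[of n] by (simp add: K_def)
      then show ?thesis using hcosh_eq[of p "q n"] p q[of n] by (simp add: F_def \<tau>_def y_def)
    qed
    have C: "hcosh (g p) (0, s n) =
        ((norm (fst (g p)))\<^sup>2 + (snd (g p))\<^sup>2 + (s n)\<^sup>2) / (2 * snd (g p) * s n)" for n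
      using hcosh_eq[of "g p" "(0, s n)"] gp s[of n] by simp
    have F_s: "F n p * s n / (2 * snd p) =
        ((norm (fst (g p)))\<^sup>2 + (snd (g p))\<^sup>2 + (s n)\<^sup>2) / (2 * snd (g p) * s n)" for n
      using A[of n] unfolding B C .
    have "F n p = W p * (((norm (fst (g p)))\<^sup>2 + (snd (g p))\<^sup>2) * (1 / s n)\<^sup>2 + 1)" for n
    proof -
      define N where "N = (norm (fst (g p)))\<^sup>2 + (snd (g p))\<^sup>2"
      have "F n p = (F n p * s n / (2 * snd p)) * (2 * snd p / s n)"
        using p s[of n] by simp
      also have "\<dots> = (N + (s n)\<^sup>2) / (2 * snd (g p) * s n) * (2 * snd p / s n)"
        unfolding F_s N_def ..
      also have "\<dots> = W p * (N * (1 / s n)\<^sup>2 + 1)"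
      proof -
        have "(N + (s n)\<^sup>2) / (s n)\<^sup>2 = N * (1 / s n)\<^sup>2 + 1"
          using s[of n] by (simp add: add_divide_distrib power_divide)
        moreover have "(N + (s n)\<^sup>2) / (2 * snd (g p) * s n) * (2 * snd p / s n) =
            snd p / snd (g p) * ((N + (s n)\<^sup>2) / (s n)\<^sup>2)"
        proof -
          have "X / (2 * G * S) * (2 * P / S) = P / G * (X / S\<^sup>2)" for X G S P :: real
            by (simp add: power2_eq_square mult_ac)
          then show ?thesis .
        qed
        ultimately show ?thesis unfolding W_def by metis
      qed
      finally show ?thesis by (simp add: N_def)
    qed
    moreover have "(\<lambda>n. W p * (((norm (fst (g p)))\<^sup>2 + (snd (g p))\<^sup>2) * (1 / s n)\<^sup>2 + 1))
        \<longlonglongrightarrow> W p * (((norm (fst (g p)))\<^sup>2 + (snd (g p))\<^sup>2) * 0\<^sup>2 + 1)"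
      by (intro tendsto_intros s_lim)
    ultimately show ?thesis by simp
  qed
  define Z where "Z n = K n * ((norm (y n))\<^sup>2 + (\<tau> n)\<^sup>2)" for n
  have F_eq: "F n (x, t) = K n * ((norm x)\<^sup>2 + t\<^sup>2) - 2 * (x \<bullet> (K n *\<^sub>R y n)) + Z n" for n x t
    unfolding F_def Z_def
    by (simp add: power2_norm_eq_inner inner_diff inner_commute algebra_simps)
  define k where "k = (W (0, 2) - W (0, 1)) / 3"
  have "(\<lambda>n. (F n (0, 2) - F n (0, 1)) / 3) \<longlonglongrightarrow> k"
    unfolding k_def by (intro tendsto_intros F_lim) auto
  then have K_lim: "K \<longlonglongrightarrow> k" by (simp add: F_eq)
  define m where "m = W (0, 1) - k"
  have "(\<lambda>n. F n (0, 1) - K n) \<longlonglongrightarrow> m"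
    unfolding m_def by (intro tendsto_intros F_lim K_lim) auto
  then have Z_lim: "Z \<longlonglongrightarrow> m" by (simp add: F_eq)
  define L where "L x = (k * ((norm x)\<^sup>2 + 1) + m - W (x, 1)) / 2" for x
  have L_lim: "(\<lambda>n. x \<bullet> (K n *\<^sub>R y n)) \<longlonglongrightarrow> L x" for x
  proof -
    have "(\<lambda>n. (K n * ((norm x)\<^sup>2 + 1) + Z n - F n (x, 1)) / 2) \<longlonglongrightarrow> L x"
      unfolding L_def by (intro tendsto_intros K_lim Z_lim F_lim) auto
    then show ?thesis by (simp add: F_eq)
  qed
  define Y where "Y = (\<Sum>b\<in>Basis. L b *\<^sub>R b)"
  have "(\<lambda>n. \<Sum>b\<in>Basis. (b \<bullet> (K n *\<^sub>R y n)) *\<^sub>R b) \<longlonglongrightarrow> Y"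
    unfolding Y_def by (intro tendsto_intros L_lim)
  then have Y_lim: "(\<lambda>n. K n *\<^sub>R y n) \<longlonglongrightarrow> Y"
    by (simp only: inner_commute[of _ "K _ *\<^sub>R y _"] euclidean_representation)
  have W_eq: "W (x, t) = k * ((norm x)\<^sup>2 + t\<^sup>2) - 2 * (x \<bullet> Y) + m" if "t > 0" for x t
  proof (rule LIMSEQ_unique[OF F_lim])
    show "(\<lambda>n. F n (x, t)) \<longlonglongrightarrow> k * ((norm x)\<^sup>2 + t\<^sup>2) - 2 * (x \<bullet> Y) + m"
      unfolding F_eq by (intro tendsto_intros K_lim Z_lim Y_lim)
  qed (use that in simp)
  \<comment> \<open>The discriminant of the limiting polynomial vanishes, as it is a limit of \<open>- (\<tau> n * K n)\<^sup>2 = - (1 / s n)\<^sup>2\<close>.\<close>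
  have disc: "k * m = (norm Y)\<^sup>2"
  proof (rule LIMSEQ_unique)
    show "(\<lambda>n. K n * Z n) \<longlonglongrightarrow> k * m" by (intro tendsto_intros K_lim Z_lim)
    have "K n * Z n = (norm (K n *\<^sub>R y n))\<^sup>2 + (1 / s n)\<^sup>2" for n
    proof -
      have "1 / s n = K n * \<tau> n" using \<tau>[of n] by (simp add: K_def)
      moreover have "(norm (K n *\<^sub>R y n))\<^sup>2 = K n * (K n * (norm (y n))\<^sup>2)"
        by (simp add: power_mult_distrib power2_eq_square)
      ultimately show ?thesis
        by (simp only: Z_def power_mult_distrib) (simp only: distrib_left power2_eq_square mult.assoc)
    qed
    moreover have "(\<lambda>n. (norm (K n *\<^sub>R y n))\<^sup>2 + (1 / s n)\<^sup>2) \<longlonglongrightarrow> (norm Y)\<^sup>2 + 0\<^sup>2"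
      by (intro tendsto_intros Y_lim s_lim)
    ultimately show "(\<lambda>n. K n * Z n) \<longlonglongrightarrow> (norm Y)\<^sup>2" by simp
  qed
  have "k \<ge> 0"
    by (rule LIMSEQ_le_const[OF K_lim]) (use s \<tau> in \<open>auto simp: K_def less_imp_le\<close>)
  have Wpos: "W p > 0" if "snd p > 0" for p using hisom_pos[OF g that] that by (simp add: W_def)
  have gW: "snd (g p) = snd p / W p" if "snd p > 0" for p
    using hisom_pos[OF g that] that by (simp add: W_def)
  show ?thesis
  proof (cases "k = 0")
    case True
    then have "Y = 0" using disc by simp
    have W: "W p = m" if "snd p > 0" for p
      using W_eq[of "snd p" "fst p"] that \<open>Y = 0\<close> True by simp
    moreover have "m > 0" using Wpos[of "(0,1)"] W[of "(0,1)"] by simp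
    ultimately have "\<forall>p\<in>hspace. snd (g p) = (1 / m) * snd p" "1 / m > 0" using gW by auto
    then show ?thesis by blast
  next
    case False
    then have k: "k > 0" using \<open>k \<ge> 0\<close> by simp
    define a where "a = (1 / k) *\<^sub>R Y"
    have Y: "Y = k *\<^sub>R a" using k by (simp add: a_def)
    have "k * m = k * (k * (norm a)\<^sup>2)"
      unfolding disc Y using k by (simp add: power2_eq_square)
    then have m: "m = k * (norm a)\<^sup>2" using k by simp
    have Wk: "W p = k * (dist p (a, 0))\<^sup>2" if "snd p > 0" for p
    proof -
      have "W p = k * ((norm (fst p))\<^sup>2 + (snd p)\<^sup>2) - 2 * (fst p \<bullet> (k *\<^sub>R a)) + k * (norm a)\<^sup>2"
        using W_eq[of "snd p" "fst p"] that unfolding Y m by simp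
      also have "\<dots> = k * ((norm (fst p - a))\<^sup>2 + (snd p)\<^sup>2)"
        unfolding power2_norm_eq_inner by (simp add: inner_diff inner_commute algebra_simps)
      finally show ?thesis by (simp add: dist_prod_sq)
    qed
    have "snd (g p) = (1 / sqrt k)\<^sup>2 * snd p / (dist p (a, 0))\<^sup>2" if "p \<in> hspace" for p
    proof -
      have "(1 / sqrt k)\<^sup>2 = 1 / k" using k by (simp add: power_divide)
      then show ?thesis using gW[of p] Wk[of p] that by simp
    qed
    then have "\<forall>p\<in>hspace. snd (g p) = (1 / sqrt k)\<^sup>2 * snd p / (dist p (a, 0))\<^sup>2" by blast
    moreover have "1 / sqrt k > 0" using k by simp
    ultimately show ?thesis by blast
  qed
qed

definition horizontal :: "('a \<Rightarrow> 'a) \<Rightarrow> 'a::euclidean_space \<times> real \<Rightarrow> 'a \<times> real"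
  where "horizontal A p = (A (fst p), snd p)"

lemma snd_horizontal [simp]: "snd (horizontal A p) = snd p"
  by (simp add: horizontal_def)

lemma fst_horizontal [simp]: "fst (horizontal A p) = A (fst p)"
  by (simp add: horizontal_def)

lemma dist_horizontal:
  assumes "\<And>x y. dist (A x) (A y) = dist x y"
  shows "dist (horizontal A p) (horizontal A q) = dist p q"
  using assms by (simp add: horizontal_def dist_prod_def)

text \<open>Between points of fixed heights the hyperbolic distance is a function of the Euclidean one, so
  such an isometry is Euclidean; and the distance between two points of a vertical line is the
  difference of their heights, so it maps vertical lines to vertical lines.\<close>

lemma height_preserving_isometry:
  fixes g :: "'a::euclidean_space \<times> real \<Rightarrow> 'a \<times> real"
  assumes g: "hisom g" and ht: "\<And>p. p \<in> hspace \<Longrightarrow> snd (g p) = snd p"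
  shows "\<exists>A. (\<forall>x y. dist (A x) (A y) = dist x y) \<and> (\<forall>p\<in>hspace. g p = horizontal A p)"
proof (intro exI conjI allI ballI)
  define A where "A x = fst (g (x, 1))" for x
  have d: "dist (g p) (g q) = dist p q" if "p \<in> hspace" "q \<in> hspace" for p q
  proof -
    have "(dist (g p) (g q))\<^sup>2 = (dist p q)\<^sup>2"
      using hisom_dist[OF g that] ht[OF that(1)] ht[OF that(2)] that by simp
    then show ?thesis by simp
  qed
  have sq: "(norm (fst (g p) - fst (g q)))\<^sup>2 = (norm (fst p - fst q))\<^sup>2"
    if "p \<in> hspace" "q \<in> hspace" for p q
    using dist_prod_sq[of p q] dist_prod_sq[of "g p" "g q"]
    unfolding d[OF that] ht[OF that(1)] ht[OF that(2)] by linarith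
  show "dist (A x) (A y) = dist x y" for x y
    using sq[of "(x, 1)" "(y, 1)"] by (simp add: A_def dist_norm power2_eq_iff_nonneg)
  show "g p = horizontal A p" if "p \<in> hspace" for p
  proof -
    have "(norm (fst (g p) - fst (g (fst p, 1))))\<^sup>2 = 0"
      using sq[OF that, of "(fst p, 1)"] by simp
    then show ?thesis using ht[OF that] by (simp add: prod_eq_iff A_def)
  qed
qed

text \<open>Undoing the inversion in the isometric sphere leaves an isometry that preserves heights.\<close>

lemma isometric_sphere_normal_form:
  fixes g :: "'a::euclidean_space \<times> real \<Rightarrow> 'a \<times> real"
  assumes g: "hisom g" and "r > 0"
    and ht: "\<And>p. p \<in> hspace \<Longrightarrow> snd (g p) = r\<^sup>2 * snd p / (dist p (a, 0))\<^sup>2"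
  shows "\<exists>A. (\<forall>x y. dist (A x) (A y) = dist x y) \<and>
    (\<forall>p\<in>hspace. g p = horizontal A (inversion (a, 0) r p))"
proof -
  let ?i = "inversion (a, 0) r"
  have i: "?i p \<in> hspace" "?i (?i p) = p" if "p \<in> hspace" for p
    using that snd_inversion_pos[OF \<open>r > 0\<close>, of p a]
      inversion_involutive[OF hspace_neq[of p a] \<open>r > 0\<close>] by simp_all
  have "snd (g (?i p)) = snd p" if "p \<in> hspace" for p
    using ht[OF i(1)[OF that]] snd_inversion[of a r "?i p"] unfolding i(2)[OF that] by metis
  then obtain A where "\<forall>x y. dist (A x) (A y) = dist x y" "\<forall>p\<in>hspace. (g \<circ> ?i) p = horizontal A p"
    using height_preserving_isometry[OF hisom_comp[OF g hisom_inversion[OF \<open>r > 0\<close>, of a]]]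
    unfolding comp_apply by metis
  then show ?thesis by (metis i comp_apply)
qed

section \<open>Geodesics with two finite ends\<close>

text \<open>The unit-speed geodesic along the semicircle from \<open>(\<xi>, 0)\<close> to \<open>(\<eta>, 0)\<close>, with its top at
  parameter \<open>0\<close>.\<close>

definition geod :: "'a::euclidean_space \<Rightarrow> 'a \<Rightarrow> real \<Rightarrow> 'a \<times> real"
  where "geod \<xi> \<eta> s =
    ((1/2) *\<^sub>R (\<xi> + \<eta>) + (tanh s / 2) *\<^sub>R (\<eta> - \<xi>), dist \<xi> \<eta> / (2 * cosh s))"

lemma inverse_cosh_sq: "1 / (cosh s)\<^sup>2 = 1 - (tanh s)\<^sup>2" for s :: real
proof -
  have "(cosh s)\<^sup>2 > 0" by simp
  then show ?thesis using cosh_square_eq[of s]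
    by (simp add: tanh_def power_divide field_simps)
qed

lemma snd_geod: "snd (geod \<xi> \<eta> s) = dist \<xi> \<eta> / (2 * cosh s)"
  by (simp add: geod_def)

lemma snd_geod_sq: "(snd (geod \<xi> \<eta> s))\<^sup>2 = (dist \<xi> \<eta>)\<^sup>2 / 4 * (1 - (tanh s)\<^sup>2)"
  unfolding snd_geod inverse_cosh_sq[symmetric] by (simp add: power_divide power_mult_distrib)

lemma geod_in_hspace: "\<xi> \<noteq> \<eta> \<Longrightarrow> snd (geod \<xi> \<eta> s) > 0"
  by (simp add: snd_geod)

lemma fst_geod_diff: "fst (geod \<xi> \<eta> s) - fst (geod \<xi> \<eta> u) = ((tanh s - tanh u) / 2) *\<^sub>R (\<eta> - \<xi>)"
  by (simp add: geod_def algebra_simps diff_divide_distrib)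

lemma hdist_geod:
  assumes "\<xi> \<noteq> \<eta>"
  shows "hdist (geod \<xi> \<eta> s) (geod \<xi> \<eta> u) = \<bar>s - u\<bar>"
proof (rule hdist_cosh_eq)
  let ?p = "geod \<xi> \<eta> s" and ?q = "geod \<xi> \<eta> u"
  define M where "M = (dist \<xi> \<eta>)\<^sup>2 / 4"
  have M: "M > 0" using assms by (simp add: M_def)
  show p: "?p \<in> hspace" and q: "?q \<in> hspace" using geod_in_hspace[OF assms] by auto
  have "(norm (fst ?p - fst ?q))\<^sup>2 = M * (tanh s - tanh u)\<^sup>2"
    unfolding fst_geod_diff M_def by (simp add: power_mult_distrib power_divide dist_norm norm_minus_commute)
  then have "(norm (fst ?p - fst ?q))\<^sup>2 + (snd ?p)\<^sup>2 + (snd ?q)\<^sup>2 = 2 * M * (1 - tanh s * tanh u)"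
    unfolding snd_geod_sq M_def[symmetric] by (simp add: algebra_simps power2_eq_square)
  moreover have "2 * snd ?p * snd ?q = 2 * M / (cosh s * cosh u)"
    by (simp add: snd_geod M_def power2_eq_square)
  ultimately have "hcosh ?p ?q = (1 - tanh s * tanh u) * (cosh s * cosh u)"
    using hcosh_eq[OF p q] M by simp
  also have "\<dots> = cosh (s - u)"
    by (simp add: cosh_diff tanh_def left_diff_distrib)
  finally show "hcosh ?p ?q = cosh (s - u)" .
qed

lemma dist_geod_ends:
  "(dist (geod \<xi> \<eta> s) (\<xi>, 0))\<^sup>2 = (dist \<xi> \<eta>)\<^sup>2 / 2 * (1 + tanh s)"
  "(dist (geod \<xi> \<eta> s) (\<eta>, 0))\<^sup>2 = (dist \<xi> \<eta>)\<^sup>2 / 2 * (1 - tanh s)"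
proof -
  define d t where "d = \<eta> - \<xi>" and "t = tanh s"
  have "fst (geod \<xi> \<eta> s) - \<xi> = ((1 + t) / 2) *\<^sub>R d" "fst (geod \<xi> \<eta> s) - \<eta> = ((t - 1) / 2) *\<^sub>R d"
  proof -
    have h: "\<xi> = (1/2) *\<^sub>R \<xi> + (1/2) *\<^sub>R \<xi>" for \<xi> :: 'a by (simp flip: scaleR_add_left)
    show "fst (geod \<xi> \<eta> s) - \<xi> = ((1 + t) / 2) *\<^sub>R d"
      by (subst (3) h) (simp add: geod_def d_def t_def algebra_simps add_divide_distrib)
    show "fst (geod \<xi> \<eta> s) - \<eta> = ((t - 1) / 2) *\<^sub>R d"
      by (subst (3) h) (simp add: geod_def d_def t_def algebra_simps diff_divide_distrib)
  qed
  then have "(norm (fst (geod \<xi> \<eta> s) - \<xi>))\<^sup>2 = (dist \<xi> \<eta>)\<^sup>2 / 4 * (1 + t)\<^sup>2"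
    "(norm (fst (geod \<xi> \<eta> s) - \<eta>))\<^sup>2 = (dist \<xi> \<eta>)\<^sup>2 / 4 * (t - 1)\<^sup>2"
    by (simp_all add: power_mult_distrib power_divide d_def dist_norm norm_minus_commute)
  note n = this
  have "M / 4 * (1 + t)\<^sup>2 + M / 4 * (1 - t\<^sup>2) = M / 2 * (1 + t)"
    "M / 4 * (t - 1)\<^sup>2 + M / 4 * (1 - t\<^sup>2) = M / 2 * (1 - t)" for M :: real
    by (simp_all add: field_simps power2_eq_square)
  then show "(dist (geod \<xi> \<eta> s) (\<xi>, 0))\<^sup>2 = (dist \<xi> \<eta>)\<^sup>2 / 2 * (1 + tanh s)"
    "(dist (geod \<xi> \<eta> s) (\<eta>, 0))\<^sup>2 = (dist \<xi> \<eta>)\<^sup>2 / 2 * (1 - tanh s)"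
    unfolding dist_prod_sq fst_conv snd_conv diff_0_right snd_geod_sq n t_def[symmetric] by blast+
qed

lemma tanh_ratio: "(1 + tanh s) / (1 - tanh s) = (exp s)\<^sup>2" for s :: real
proof -
  have e: "exp s > 0" by simp
  have t: "tanh s = ((exp s)\<^sup>2 - 1) / ((exp s)\<^sup>2 + 1)"
    using tanh_ln_real[OF e] by simp
  have "(exp s)\<^sup>2 + 1 > 0" by (simp add: add_pos_pos)
  then have "1 + tanh s = 2 * (exp s)\<^sup>2 / ((exp s)\<^sup>2 + 1)" "1 - tanh s = 2 / ((exp s)\<^sup>2 + 1)"
    unfolding t by (simp_all add: field_simps)
  then show ?thesis using \<open>(exp s)\<^sup>2 + 1 > 0\<close> by simp
qed

lemma dist_geod_ratio:
  assumes "\<xi> \<noteq> \<eta>"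
  shows "dist (geod \<xi> \<eta> s) (\<xi>, 0) / dist (geod \<xi> \<eta> s) (\<eta>, 0) = exp s"
proof -
  have "(dist (geod \<xi> \<eta> s) (\<xi>, 0) / dist (geod \<xi> \<eta> s) (\<eta>, 0))\<^sup>2 = (exp s)\<^sup>2"
    unfolding power_divide dist_geod_ends tanh_ratio[symmetric] using assms by simp
  then show ?thesis by (simp add: power2_eq_iff_nonneg)
qed

lemma geod_height_times_length:
  assumes "\<xi> \<noteq> \<eta>"
  shows "snd (geod \<xi> \<eta> s) * dist \<xi> \<eta> = dist (geod \<xi> \<eta> s) (\<xi>, 0) * dist (geod \<xi> \<eta> s) (\<eta>, 0)"
proof -
  have "(snd (geod \<xi> \<eta> s) * dist \<xi> \<eta>)\<^sup>2 = (dist (geod \<xi> \<eta> s) (\<xi>, 0) * dist (geod \<xi> \<eta> s) (\<eta>, 0))\<^sup>2"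
    unfolding power_mult_distrib snd_geod_sq dist_geod_ends by (simp add: algebra_simps power2_eq_square)
  then show ?thesis using geod_in_hspace[OF assms, of s]
    by (subst (asm) power2_eq_iff_nonneg) auto
qed

text \<open>The ratio of the right-hand to the left-hand side is the hyperbolic cosine of the distance from
  \<open>p\<close> to the geodesic. The difference of their squares is a square plus a Cauchy-Schwarz defect, so
  equality makes both vanish. This description of the geodesic is convenient because both sides
  change by the same factor under an inversion.\<close>

lemma geod_characterization:
  fixes \<xi> \<eta> :: "'a::euclidean_space"
  assumes p: "snd p > 0" and "\<xi> \<noteq> \<eta>"
    and eq: "snd p * dist \<xi> \<eta> = dist p (\<xi>, 0) * dist p (\<eta>, 0)"
  shows "p = geod \<xi> \<eta> (ln (dist p (\<xi>, 0) / dist p (\<eta>, 0)))"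
proof -
  define e y t where "e = (1/2) *\<^sub>R (\<eta> - \<xi>)" and "y = fst p - (1/2) *\<^sub>R (\<xi> + \<eta>)" and "t = snd p"
  define u w \<rho> where "u = y \<bullet> y" and "w = y \<bullet> e" and "\<rho> = e \<bullet> e"
  have \<rho>: "\<rho> > 0" using \<open>\<xi> \<noteq> \<eta>\<close> by (simp add: \<rho>_def e_def)
  have t: "t > 0" using p by (simp add: t_def)
  have half: "(1/2) *\<^sub>R x + (1/2) *\<^sub>R x = x" for x :: 'a by (simp flip: scaleR_add_left)
  have y1: "fst p - \<xi> = y + e" and y2: "fst p - \<eta> = y - e"
    using half[of \<xi>] half[of \<eta>] by (simp_all add: y_def e_def algebra_simps)
  have "dist p (\<xi>, 0) ^ 2 = u + 2 * w + \<rho> + t\<^sup>2"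
    unfolding dist_prod_sq fst_conv y1 power2_norm_eq_inner u_def w_def \<rho>_def t_def
    by (simp add: inner_add inner_commute)
  moreover have "dist p (\<eta>, 0) ^ 2 = u - 2 * w + \<rho> + t\<^sup>2"
    unfolding dist_prod_sq fst_conv y2 power2_norm_eq_inner u_def w_def \<rho>_def t_def
    by (simp add: inner_diff inner_commute)
  moreover have len: "(dist \<xi> \<eta>)\<^sup>2 = 4 * \<rho>"
    by (simp add: \<rho>_def e_def dist_norm norm_minus_commute power2_norm_eq_inner[symmetric] power_divide)
  ultimately have "t\<^sup>2 * (4 * \<rho>) = (u + 2 * w + \<rho> + t\<^sup>2) * (u - 2 * w + \<rho> + t\<^sup>2)"
    using eq t_def by (metis power_mult_distrib)
  then have sum0: "(u + t\<^sup>2 - \<rho>)\<^sup>2 + 4 * (u * \<rho> - w\<^sup>2) = 0"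
    by (simp add: algebra_simps power2_eq_square)
  have cs: "w\<^sup>2 \<le> u * \<rho>" unfolding u_def w_def \<rho>_def by (rule Cauchy_Schwarz_ineq)
  then have w2: "w\<^sup>2 = u * \<rho>" and "(u + t\<^sup>2 - \<rho>)\<^sup>2 = 0"
    using sum0 zero_le_power2[of "u + t\<^sup>2 - \<rho>"] by argo+
  then have u: "u = \<rho> - t\<^sup>2" by simp
  define \<kappa> where "\<kappa> = w / \<rho>"
  have "(norm (y - \<kappa> *\<^sub>R e))\<^sup>2 = u - 2 * \<kappa> * w + \<kappa>\<^sup>2 * \<rho>"
    unfolding power2_norm_eq_inner u_def w_def \<rho>_def
    by (simp add: inner_diff inner_commute power2_eq_square)
  also have "\<dots> = 0" using \<rho> w2 by (simp add: \<kappa>_def power2_eq_square field_simps)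
  finally have y: "y = \<kappa> *\<^sub>R e" by simp
  have "\<kappa>\<^sup>2 = 1 - t\<^sup>2 / \<rho>"
    using w2 u \<rho> by (simp add: \<kappa>_def power_divide power2_eq_square field_simps)
  then have t2: "t\<^sup>2 = \<rho> * (1 - \<kappa>\<^sup>2)" using \<rho> by (simp add: field_simps)
  then have "1 - \<kappa>\<^sup>2 > 0" using t \<rho> by (metis zero_less_mult_pos zero_less_power)
  then have \<kappa>: "\<bar>\<kappa>\<bar> < 1" by (simp add: abs_square_less_1)
  define s where "s = ln (sqrt ((1 + \<kappa>) / (1 - \<kappa>)))"
  have k: "(1 + \<kappa>) / (1 - \<kappa>) > 0" using \<kappa> by (simp add: abs_less_iff)
  have "tanh s = ((1 + \<kappa>) / (1 - \<kappa>) - 1) / ((1 + \<kappa>) / (1 - \<kappa>) + 1)"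
    unfolding s_def using k by (subst tanh_ln_real) (simp_all only: real_sqrt_gt_0_iff real_sqrt_pow2 less_imp_le)
  also have "\<dots> = \<kappa>" using \<kappa> by (simp add: divide_simps)
  finally have s: "tanh s = \<kappa>" .
  have "p = geod \<xi> \<eta> s"
  proof (rule prod_eqI)
    have "fst p = (1/2) *\<^sub>R (\<xi> + \<eta>) + \<kappa> *\<^sub>R e" using y by (simp add: y_def diff_eq_eq add.commute)
    then show "fst p = fst (geod \<xi> \<eta> s)" by (simp add: geod_def s e_def)
    have "(snd p)\<^sup>2 = (snd (geod \<xi> \<eta> s))\<^sup>2"
      unfolding snd_geod_sq len s using t2 t_def by simp
    then show "snd p = snd (geod \<xi> \<eta> s)"
      using p geod_in_hspace[OF \<open>\<xi> \<noteq> \<eta>\<close>, of s] by (subst (asm) power2_eq_iff_nonneg) auto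
  qed
  then show ?thesis using dist_geod_ratio[OF \<open>\<xi> \<noteq> \<eta>\<close>, of s] by simp
qed

lemma geod_eqD:
  assumes "\<xi> \<noteq> \<eta>" "geod \<xi> \<eta> s = geod \<xi> \<eta> u"
  shows "s = u"
  using hdist_geod[OF assms(1), of s u] assms(2) by simp

text \<open>The parameter \<open>ln y\<close> singles out a point that is close to \<open>(\<xi>, r)\<close> when the ends are far apart.\<close>

lemma geod_near_end:
  fixes \<xi> \<eta> :: "'a::euclidean_space"
  assumes "\<xi> \<noteq> \<eta>" "r > 0"
  defines "y \<equiv> r / dist \<xi> \<eta>"
  shows "snd (geod \<xi> \<eta> (ln y)) = r / (1 + y\<^sup>2)"
    and "dist (fst (geod \<xi> \<eta> (ln y))) \<xi> = r * y / (1 + y\<^sup>2)"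
proof -
  have M: "dist \<xi> \<eta> > 0" using assms by simp
  have y: "y > 0" unfolding y_def using M assms by simp
  have y1: "1 + y\<^sup>2 > 0" by (simp add: add_pos_nonneg)
  have My: "dist \<xi> \<eta> * y = r" unfolding y_def using M by simp
  have c: "cosh (ln y) = (1 + y\<^sup>2) / (2 * y)"
    using y by (simp add: cosh_def exp_minus field_simps power2_eq_square)
  have "snd (geod \<xi> \<eta> (ln y)) = dist \<xi> \<eta> * y / (1 + y\<^sup>2)"
    unfolding snd_geod c using y1 by (simp add: divide_simps)
  then show "snd (geod \<xi> \<eta> (ln y)) = r / (1 + y\<^sup>2)" unfolding My .
  have half: "(1/2) *\<^sub>R x + (1/2) *\<^sub>R x = x" for x :: 'a by (simp flip: scaleR_add_left)
  have "fst (geod \<xi> \<eta> (ln y)) - \<xi> = ((1 + tanh (ln y)) / 2) *\<^sub>R (\<eta> - \<xi>)"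
    using half[of \<xi>] by (simp add: geod_def algebra_simps add_divide_distrib)
  moreover have "(1 + tanh (ln y)) / 2 = y\<^sup>2 / (1 + y\<^sup>2)"
    using y y1 by (simp add: tanh_ln_real add.commute[of "y\<^sup>2"] divide_simps)
  ultimately have "dist (fst (geod \<xi> \<eta> (ln y))) \<xi> = y\<^sup>2 / (1 + y\<^sup>2) * dist \<xi> \<eta>"
    using y1 by (simp add: dist_norm norm_minus_commute)
  also have "\<dots> = (dist \<xi> \<eta> * y) * y / (1 + y\<^sup>2)" by (simp add: power2_eq_square)
  finally show "dist (fst (geod \<xi> \<eta> (ln y))) \<xi> = r * y / (1 + y\<^sup>2)" unfolding My .
qed

section \<open>Free abelian groups of Euclidean isometries\<close>

text \<open>Pigeonhole: rounding coordinates in an orthonormal basis of \<open>V\<close> separates the points, and a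
  box of side \<open>N\<close> in \<open>\<int>\<^sup>d\<close> has more points than a ball of radius \<open>C N\<close> in \<open>V\<close> has
  rounded values.\<close>

lemma separated_points_in_subspace:
  fixes V :: "'a::euclidean_space set" and p :: "(nat \<Rightarrow> int) \<Rightarrow> 'a"
  assumes V: "subspace V" "dim V < d" and eps: "\<epsilon> > 0" and "C \<ge> 0"
    and pV: "\<And>m. p m \<in> V"
    and bound: "\<And>N m. m \<in> PiE {..<d} (\<lambda>_. {0..int N}) \<Longrightarrow> norm (p m) \<le> C * real N"
    and sep: "\<And>m m'. m \<in> extensional {..<d} \<Longrightarrow> m' \<in> extensional {..<d} \<Longrightarrow> m \<noteq> m' \<Longrightarrow> dist (p m) (p m') \<ge> \<epsilon>"
  shows False
proof -
  obtain B where B: "B \<subseteq> V" "pairwise orthogonal B" "\<And>x. x \<in> B \<Longrightarrow> norm x = 1"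
      "independent B" "card B = dim V" "span B = V"
    using orthonormal_basis_subspace[OF V(1)] by metis
  have fB: "finite B" using B(4) independent_imp_finite by blast
  define k where "k = card B"
  define \<eta> where "\<eta> = \<epsilon> / (2 * (real k + 1))"
  have \<eta>: "\<eta> > 0" using eps by (simp add: \<eta>_def)
  define q where "q x = (\<lambda>b\<in>B. \<lfloor>(x \<bullet> b) / \<eta>\<rfloor>)" for x
  have q_close: "dist x x' < \<epsilon>" if "x \<in> V" "x' \<in> V" "q x = q x'" for x x'
  proof -
    have c: "\<bar>(x - x') \<bullet> b\<bar> \<le> \<eta>" if "b \<in> B" for b
    proof -
      have "\<lfloor>(x \<bullet> b) / \<eta>\<rfloor> = \<lfloor>(x' \<bullet> b) / \<eta>\<rfloor>"
        using fun_cong[OF \<open>q x = q x'\<close>, of b] that by (simp add: q_def)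
      then have "\<bar>(x \<bullet> b) / \<eta> - (x' \<bullet> b) / \<eta>\<bar> \<le> 1" by linarith
      then show ?thesis using \<eta> by (simp add: inner_diff_left diff_divide_distrib[symmetric] divide_le_eq)
    qed
    have "x - x' \<in> span B" using that B(6) V(1) by (simp add: subspace_diff)
    then have "x - x' = (\<Sum>b\<in>B. ((x - x') \<bullet> b) *\<^sub>R b)"
      using orthonormal_basis_expand[OF B(2) B(3) _ fB] by metis
    then have "norm (x - x') \<le> (\<Sum>b\<in>B. norm (((x - x') \<bullet> b) *\<^sub>R b))"
      by (metis norm_sum)
    also have "\<dots> \<le> (\<Sum>b\<in>B. \<eta>)" using c B(3) by (intro sum_mono) simp
    also have "\<dots> = real k * \<eta>" by (simp add: k_def)
    also have "\<dots> \<le> (real k + 1) * \<eta>" using \<eta> by simp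
    also have "\<dots> = \<epsilon> / 2" by (simp add: \<eta>_def divide_simps)
    finally show ?thesis using eps by (simp add: dist_norm)
  qed
  define a where "a = nat \<lceil>C / \<eta>\<rceil>"
  have a: "C / \<eta> \<le> real a" unfolding a_def by linarith
  define A where "A = 2 * a + 3"
  define N where "N = A ^ k"
  have Npos: "N \<ge> 1" by (simp add: N_def A_def)
  let ?box = "PiE {..<d} (\<lambda>_. {0..int N})"
  let ?K = "int (a * N) + 1"
  have "inj_on (\<lambda>m. q (p m)) ?box"
  proof (rule inj_onI, rule ccontr)
    fix m m' assume m: "m \<in> ?box" "m' \<in> ?box" "q (p m) = q (p m')" "m \<noteq> m'"
    then have "dist (p m) (p m') \<ge> \<epsilon>" by (intro sep) (auto simp: PiE_def)
    then show False using q_close[OF pV pV m(3)] by simp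
  qed
  moreover have "(\<lambda>m. q (p m)) ` ?box \<subseteq> PiE B (\<lambda>_. {- ?K..?K - 1})"
  proof (rule image_subsetI)
    fix m assume m: "m \<in> ?box"
    have "- ?K \<le> \<lfloor>(p m \<bullet> b) / \<eta>\<rfloor> \<and> \<lfloor>(p m \<bullet> b) / \<eta>\<rfloor> \<le> ?K - 1" if "b \<in> B" for b
    proof -
      have "\<bar>p m \<bullet> b\<bar> \<le> C * real N"
        using Cauchy_Schwarz_ineq2[of "p m" b] B(3)[OF that] bound[OF m] by simp
      then have "\<bar>(p m \<bullet> b) / \<eta>\<bar> \<le> C / \<eta> * real N" using \<eta> by (simp add: divide_right_mono)
      also have "\<dots> \<le> real a * real N" using a by (intro mult_right_mono) auto
      finally have "\<bar>(p m \<bullet> b) / \<eta>\<bar> \<le> of_int (int (a * N))" by simp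
      then show ?thesis by linarith
    qed
    then show "q (p m) \<in> PiE B (\<lambda>_. {- ?K..?K - 1})" by (simp add: q_def)
  qed
  ultimately have "card ?box \<le> card (PiE B (\<lambda>_. {- ?K..?K - 1}))"
    using fB by (intro card_inj_on_le) (auto intro!: finite_PiE)
  also have "\<dots> = (2 * (a * N) + 2) ^ k"
  proof -
    have "card {- ?K..?K - 1} = 2 * (a * N) + 2" unfolding card_atLeastAtMost_int by linarith
    then show ?thesis using fB by (simp only: card_PiE k_def prod_constant)
  qed
  also have "card ?box = (N + 1) ^ d" by (simp add: card_PiE nat_add_distrib)
  finally have 1: "(N + 1) ^ d \<le> (2 * (a * N) + 2) ^ k" .
  have "(N + 1) ^ Suc k \<le> (N + 1) ^ d"
    using V(2) B(5) by (intro power_increasing) (auto simp: k_def)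
  also note 1
  also have "(2 * (a * N) + 2) ^ k \<le> (A * (N + 1)) ^ k"
    by (intro power_mono) (auto simp: A_def algebra_simps)
  also have "\<dots> = N * (N + 1) ^ k" by (simp only: power_mult_distrib) (simp add: N_def)
  finally have "(N + 1) * (N + 1) ^ k \<le> N * (N + 1) ^ k" by simp
  then show False by simp
qed

lemma additive_int_scaleR:
  fixes h :: "int \<Rightarrow> 'a::real_vector"
  assumes "\<And>a b. h (a + b) = h a + h b"
  shows "h z = of_int z *\<^sub>R h 1"
proof (induction z rule: int_induct[where k = 0])
  case base
  show ?case using assms[of 0 0] by simp
next
  case (step1 i)
  then show ?case using assms[of i 1] by (simp add: algebra_simps)
next
  case (step2 i)
  then show ?case using assms[of "i - 1" 1] by (simp add: algebra_simps)
qed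

text \<open>A special case of Bieberbach's theorem: a free discrete action of \<open>\<int>\<^sup>d\<close> on \<open>\<real>\<^sup>d\<close> by
  isometries is by translations. If some element \<open>f\<close> had a nontrivial linear part \<open>L\<close>, the points
  that \<open>f\<close> moves least would form a proper affine subspace (a coset of \<open>ker (L - 1)\<close>). Everything
  commutes with \<open>f\<close> and thus preserves this subspace, which is too small to contain
  an orbit of \<open>\<int>\<^sup>d\<close>. The same count shows that the translation vectors span.\<close>

theorem free_abelian_isometries_are_translations:
  fixes T :: "(nat \<Rightarrow> int) \<Rightarrow> 'a::euclidean_space \<Rightarrow> 'a"
  assumes iso: "\<And>m x y. dist (T m x) (T m y) = dist x y"
    and add: "\<And>m m' x. T (\<lambda>i. m i + m' i) x = T m (T m' x)"
    and eq: "\<And>m m'. (\<And>i. i < DIM('a) \<Longrightarrow> m i = m' i) \<Longrightarrow> T m = T m'"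
    and disc: "\<And>x. \<exists>\<epsilon>>0. \<forall>m. (\<exists>i<DIM('a). m i \<noteq> 0) \<longrightarrow> \<epsilon> \<le> dist (T m x) x"
  shows "\<exists>f. inj_on f {..<DIM('a)} \<and> independent (f ` {..<DIM('a)}) \<and>
    (\<forall>m x. T m x = x + (\<Sum>i<DIM('a). of_int (m i) *\<^sub>R f i))"
proof -
  define d where "d = DIM('a)"
  define e where "e i = (\<lambda>j. if j = i then 1 else 0 :: int)" for i :: nat
  have T0: "T (\<lambda>_. 0) x = x" for x
    using add[of "\<lambda>_. 0" "\<lambda>_. 0" x] iso[of "\<lambda>_. 0" "T (\<lambda>_. 0) x" x] by simp
  have comm: "T m (T m' x) = T m' (T m x)" for m m' x
    unfolding add[symmetric] by (simp add: add.commute)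
  have split: "(\<lambda>j. if j < Suc k then m j else 0) =
      (\<lambda>i. (if i < k then m i else 0) + (if i = k then m k else 0))" for k and m :: "nat \<Rightarrow> int"
    by (auto simp: less_Suc_eq)
  have growth: "dist (T m x) x \<le> (\<Sum>i<d. dist (T (e i) x) x) * real N"
    if m: "m \<in> PiE {..<d} (\<lambda>_. {0..int N})" for m N x
  proof -
    define D where "D m = dist (T m x) x" for m
    have D_add: "D (\<lambda>i. m i + m' i) \<le> D m + D m'" for m m'
    proof -
      have "dist (T m (T m' x)) x \<le> dist (T m (T m' x)) (T m x) + dist (T m x) x"
        by (rule dist_triangle)
      then show ?thesis by (simp add: D_def add iso)
    qed
    have D_single: "D (\<lambda>j. if j = i then int n else 0) \<le> real n * D (e i)" for i n
    proof (induction n)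
      case 0
      have "(\<lambda>j. if j = i then int 0 else 0) = (\<lambda>_. 0)" by auto
      then show ?case by (simp add: D_def T0)
    next
      case (Suc n)
      have "(\<lambda>j. if j = i then int (Suc n) else 0) = (\<lambda>j. (if j = i then int n else 0) + e i j)"
        by (auto simp: e_def)
      then have "D (\<lambda>j. if j = i then int (Suc n) else 0) \<le> D (\<lambda>j. if j = i then int n else 0) + D (e i)"
        using D_add[of "\<lambda>j. if j = i then int n else 0" "e i"] by (simp only:)
      moreover have "real (Suc n) * D (e i) = real n * D (e i) + D (e i)" by (simp add: algebra_simps)
      ultimately show ?case using Suc by linarith
    qed
    have sum: "D (\<lambda>j. if j < k then m j else 0) \<le> (\<Sum>i<k. D (e i)) * real N" if "k \<le> d" for k
      using that
    proof (induction k)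
      case 0
      then show ?case by (simp add: D_def T0)
    next
      case (Suc k)
      have "m k \<in> {0..int N}" using PiE_mem[OF m, of k] Suc.prems by simp
      then have mk: "m k = int (nat (m k))" "nat (m k) \<le> N" by auto
      have "D (\<lambda>j. if j = k then m k else 0) \<le> real (nat (m k)) * D (e k)"
        using D_single[of k "nat (m k)"] unfolding mk(1)[symmetric] .
      also have "\<dots> \<le> real N * D (e k)" using mk(2) by (intro mult_right_mono) (auto simp: D_def)
      finally have "D (\<lambda>j. if j < Suc k then m j else 0) \<le>
          D (\<lambda>j. if j < k then m j else 0) + real N * D (e k)"
        using D_add[of "\<lambda>j. if j < k then m j else 0" "\<lambda>j. if j = k then m k else 0"]
        unfolding split[of k m] by linarith
      also have "\<dots> \<le> (\<Sum>i<k. D (e i)) * real N + real N * D (e k)"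
        using Suc.IH Suc.prems by simp
      also have "\<dots> = (\<Sum>i<Suc k. D (e i)) * real N" by (simp add: algebra_simps)
      finally show ?case .
    qed
    have "T (\<lambda>j. if j < d then m j else 0) = T m" by (rule eq) (simp add: d_def)
    then have "D m = D (\<lambda>j. if j < d then m j else 0)" by (simp only: D_def)
    then show ?thesis using sum[of d] by (simp only: D_def order_refl)
  qed
  have small_orbit: "\<not> dim V < d" if V: "subspace V" and orbit: "\<And>m. T m x - x \<in> V" for V x
  proof
    assume "dim V < d"
    obtain \<epsilon> where \<epsilon>: "\<epsilon> > 0" "\<And>m. (\<exists>i<d. m i \<noteq> 0) \<Longrightarrow> \<epsilon> \<le> dist (T m x) x"
      using disc[of x] unfolding d_def by blast
    have "\<epsilon> \<le> dist (T m x - x) (T m' x - x)"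
      if "m \<in> extensional {..<d}" "m' \<in> extensional {..<d}" "m \<noteq> m'" for m m'
    proof -
      have "\<exists>i<d. m i \<noteq> m' i" using that extensionalityI[of m "{..<d}" m'] by blast
      then have "\<exists>i<d. m i - m' i \<noteq> 0" by simp
      then have "\<epsilon> \<le> dist (T (\<lambda>i. m i - m' i) x) x" using \<epsilon>(2)[of "\<lambda>i. m i - m' i"] by blast
      also have "\<dots> = dist (T m' (T (\<lambda>i. m i - m' i) x)) (T m' x)" by (simp add: iso)
      also have "\<dots> = dist (T m x) (T m' x)" unfolding add[symmetric] by simp
      finally show ?thesis by (simp add: dist_norm)
    qed
    then show False
      by (intro separated_points_in_subspace[OF V \<open>dim V < d\<close> \<epsilon>(1) _ orbit, of "\<Sum>i<d. dist (T (e i) x) x"])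
        (simp_all only: sum_nonneg zero_le_dist dist_norm[symmetric], rule growth)
  qed
  have translation: "T m0 x = x + T m0 0" for m0 x
  proof -
    define f where "f = T m0"
    define L where "L x = f x - f 0" for x
    have "orthogonal_transformation L"
      unfolding orthogonal_transformation_isometry L_def f_def
      using iso by (simp add: dist_norm)
    then have L: "linear L" by (simp add: orthogonal_transformation_def)
    then have L1: "linear (\<lambda>x. L x - x)" by (intro linear_compose_sub linear_ident)
    define U where "U = range (\<lambda>x. L x - x)"
    have U: "subspace U" unfolding U_def by (rule linear_subspace_image[OF L1 subspace_UNIV])
    have cU: "closed U" "U \<noteq> {}" "convex U"
      using closed_subspace[OF U] subspace_imp_convex[OF U] by (auto simp: U_def)
    define z where "z = closest_point U (- f 0)"
    have "z \<in> U" unfolding z_def by (rule closest_point_in_set[OF cU(1,2)])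
    then obtain x0 where x0: "L x0 - x0 = z" by (auto simp: U_def)
    define V where "V = {x. L x - x = 0}"
    have V: "subspace V" unfolding V_def by (rule linear_subspace_kernel[OF L1])
    have displacement: "dist (f x) x = dist (- f 0) (L x - x)" for x
    proof -
      have "- f 0 - (L x - x) = - (f x - x)" by (simp add: L_def)
      then show ?thesis unfolding dist_norm by (simp only: norm_minus_cancel)
    qed
    have "T m x0 - x0 \<in> V" for m
    proof -
      have "dist (f (T m x0)) (T m x0) = dist (f x0) x0"
        unfolding f_def comm[of m0 m] iso ..
      then have same: "dist (- f 0) (L (T m x0) - T m x0) = dist (- f 0) z"
        unfolding displacement x0 .
      have "L (T m x0) - T m x0 = closest_point U (- f 0)"
      proof (rule closest_point_unique[OF cU(3,1)])
        show "L (T m x0) - T m x0 \<in> U" by (simp add: U_def)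
        show "\<forall>u\<in>U. dist (- f 0) (L (T m x0) - T m x0) \<le> dist (- f 0) u"
          unfolding same z_def using closest_point_le[OF cU(1)] by blast
      qed
      then have "L (T m x0) - T m x0 = L x0 - x0" by (simp add: x0 z_def)
      then show ?thesis unfolding V_def by (simp add: linear_diff[OF L] algebra_simps)
    qed
    then have "\<not> dim V < d" by (rule small_orbit[OF V])
    then have "V = UNIV"
      using dim_eq_full[of V] V dim_subset_UNIV[of V] unfolding d_def
      by (metis le_neq_implies_less span_eq_iff)
    then have "L x = x" by (auto simp: V_def)
    then show ?thesis by (simp add: L_def f_def algebra_simps)
  qed
  define \<tau> where "\<tau> m = T m 0" for m
  have \<tau>_add: "\<tau> (\<lambda>i. m i + m' i) = \<tau> m + \<tau> m'" for m m'
    unfolding \<tau>_def add using translation[of m "T m' 0"] by simp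
  define f where "f i = \<tau> (e i)" for i
  have \<tau>_single: "\<tau> (\<lambda>j. if j = i then z else 0) = of_int z *\<^sub>R f i" for i z
  proof -
    have "\<tau> (\<lambda>j. if j = i then a + b else 0) = \<tau> (\<lambda>j. if j = i then a else 0) + \<tau> (\<lambda>j. if j = i then b else 0)"
      for a b
      unfolding \<tau>_add[symmetric] by (rule arg_cong[of _ _ \<tau>]) auto
    then show ?thesis
      using additive_int_scaleR[of "\<lambda>z. \<tau> (\<lambda>j. if j = i then z else 0)" z]
      by (simp add: f_def e_def)
  qed
  have "\<tau> (\<lambda>j. if j < k then m j else 0) = (\<Sum>i<k. of_int (m i) *\<^sub>R f i)" for k m
  proof (induction k)
    case 0
    then show ?case by (simp add: \<tau>_def T0)
  next
    case (Suc k)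
    then show ?case unfolding split[of k m] \<tau>_add \<tau>_single by simp
  qed
  moreover have "T (\<lambda>j. if j < d then m j else 0) = T m" for m by (rule eq) (simp add: d_def)
  then have "\<tau> (\<lambda>j. if j < d then m j else 0) = \<tau> m" for m by (simp only: \<tau>_def)
  ultimately have \<tau>: "\<tau> m = (\<Sum>i<d. of_int (m i) *\<^sub>R f i)" for m by metis
  have "\<tau> m \<in> span (f ` {..<d})" for m
    unfolding \<tau> by (intro span_sum span_scale span_base) auto
  then have "\<not> dim (span (f ` {..<d})) < d"
    by (intro small_orbit[of _ 0]) (simp_all add: \<tau>_def)
  moreover have "dim (f ` {..<d}) \<le> card (f ` {..<d})" by (intro dim_le_card') auto
  moreover have "card (f ` {..<d}) \<le> d" using card_image_le[of "{..<d}" f] by simp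
  moreover have "dim (f ` {..<d}) \<le> d" unfolding d_def by (rule dim_subset_UNIV)
  ultimately have card: "card (f ` {..<d}) = d" and dim: "dim (f ` {..<d}) = d" by simp_all
  have "inj_on f {..<d}" using card by (intro eq_card_imp_inj_on) auto
  moreover have "independent (f ` {..<d})"
    using card dim by (intro card_le_dim_spanning[of _ "span (f ` {..<d})"]) (auto simp: span_superset)
  moreover have "T m x = x + (\<Sum>i<d. of_int (m i) *\<^sub>R f i)" for m x
    using translation[of m x] \<tau>[of m] by (simp add: \<tau>_def)
  ultimately show ?thesis unfolding d_def by blast
qed

section \<open>Axes of compositions with inversions\<close>

lemma inversion_boundary: "inversion (a, 0) r (x, 0) = (inversion a r x, 0)"
  for x :: "'a::euclidean_space"
  by (simp add: inversion_def dist_Pair_Pair)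

lemma isometry_surj:
  fixes A :: "'a::euclidean_space \<Rightarrow> 'a"
  assumes "\<And>x y. dist (A x) (A y) = dist x y"
  shows "\<exists>x. A x = y"
proof -
  have "orthogonal_transformation (\<lambda>x. A x - A 0)"
    unfolding orthogonal_transformation_isometry using assms by (simp add: dist_norm)
  then have "surj (\<lambda>x. A x - A 0)" by (rule orthogonal_transformation_surj)
  then obtain x where "y - A 0 = A x - A 0" using surjD[of "\<lambda>x. A x - A 0" "y - A 0"] by blast
  then have "A x = y" by simp
  then show ?thesis ..
qed

lemma continuous_on_inversion:
  assumes "a \<notin> S" shows "continuous_on S (inversion a r)"
  unfolding inversion_def using assms by (intro continuous_intros) auto

lemma continuous_on_isometry:
  assumes "\<And>x y. dist (A x) (A y) = dist x y"
  shows "continuous_on S A"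
  by (rule lipschitz_on_continuous_on[of 1]) (simp add: lipschitz_on_def assms)

text \<open>The map \<open>A \<circ> inversion a r\<close> sends the outside of the sphere of radius \<open>r\<close> about \<open>a\<close> into the ball
  of radius \<open>r\<close> about \<open>A a\<close>, and its inverse does the same with \<open>a\<close> and \<open>A a\<close> exchanged. If the two
  balls are far apart, each of the maps sends one of them into itself, so that Brouwer's
  theorem applies.\<close>

lemma isometric_sphere_fixed_points:
  fixes A :: "'a::euclidean_space \<Rightarrow> 'a"
  assumes A: "\<And>x y. dist (A x) (A y) = dist x y" and r: "r > 0" and D: "dist a (A a) > 2 * r"
  defines "\<epsilon> \<equiv> r\<^sup>2 / (dist a (A a) - r)"
  obtains \<xi> \<eta> where "\<xi> \<noteq> a" "\<eta> \<noteq> a" "A (inversion a r \<xi>) = \<xi>" "A (inversion a r \<eta>) = \<eta>"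
    "dist \<xi> a \<le> \<epsilon>" "dist \<eta> (A a) \<le> \<epsilon>"
proof -
  have D': "dist a (A a) - r > r" using D by simp
  have "r * r \<le> r * (dist a (A a) - r)" using D' r by (intro mult_left_mono) auto
  then have eps: "\<epsilon> \<le> r" unfolding \<epsilon>_def using D' r by (simp add: divide_le_eq power2_eq_square)
  have contA: "continuous_on S A" for S
    using A by (rule continuous_on_isometry)
  have i: "dist (inversion a r x) a \<le> \<epsilon>" if "dist x a \<ge> dist a (A a) - r" for x
  proof -
    have "x \<noteq> a" using that D' r by auto
    then have "dist (inversion a r x) a = r\<^sup>2 / dist x a" by (rule dist_inversion_center)
    also have "\<dots> \<le> \<epsilon>" unfolding \<epsilon>_def using that D' r by (intro divide_left_mono mult_pos_pos) auto
    finally show ?thesis .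
  qed
  have far: "dist x a \<ge> dist a (A a) - r" if "x \<in> cball (A a) r" for x
    using that dist_triangle[of a "A a" x] by (simp add: dist_commute)
  have cont: "continuous_on (cball (A a) r) (A \<circ> inversion a r)"
  proof (intro continuous_on_compose continuous_on_inversion contA)
    show "a \<notin> cball (A a) r" using D r by (simp add: dist_commute)
  qed
  have maps: "(A \<circ> inversion a r) \<in> cball (A a) r \<rightarrow> cball (A a) r"
  proof
    fix x assume "x \<in> cball (A a) r"
    then have "dist (inversion a r x) a \<le> r" using i[OF far] eps by fastforce
    then show "(A \<circ> inversion a r) x \<in> cball (A a) r" by (simp add: A dist_commute)
  qed
  obtain \<eta> where \<eta>: "\<eta> \<in> cball (A a) r" "A (inversion a r \<eta>) = \<eta>"
    using brouwer_ball[OF r cont maps] unfolding comp_apply by blast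
  have \<eta>1: "\<eta> \<noteq> a" using far[OF \<eta>(1)] D' r by auto
  have \<eta>2: "dist \<eta> (A a) \<le> \<epsilon>" using i[OF far[OF \<eta>(1)]] A \<eta>(2) by metis
  obtain C where C: "\<And>y. A (C y) = y" using isometry_surj[of A] A by metis
  have Cd: "dist (C x) (C y) = dist x y" for x y using A[of "C x" "C y"] C by simp
  have contC: "continuous_on S C" for S
    using Cd by (rule continuous_on_isometry)
  have farC: "dist (C y) a \<ge> dist a (A a) - r" if "y \<in> cball a r" for y
  proof -
    have "dist (C y) a = dist y (A a)" using A[of "C y" a] C by simp
    then show ?thesis using that dist_triangle[of a "A a" y] by (simp add: dist_commute)
  qed
  have "a \<notin> C ` cball a r" using farC D' r by fastforce
  then have contC': "continuous_on (cball a r) (inversion a r \<circ> C)"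
    by (intro continuous_on_compose continuous_on_inversion contC)
  have mapsC: "(inversion a r \<circ> C) \<in> cball a r \<rightarrow> cball a r"
  proof
    fix x assume "x \<in> cball a r"
    then have "dist (inversion a r (C x)) a \<le> r" using i[OF farC] eps by fastforce
    then show "(inversion a r \<circ> C) x \<in> cball a r" by (simp add: dist_commute)
  qed
  obtain \<xi> where \<xi>: "\<xi> \<in> cball a r" "inversion a r (C \<xi>) = \<xi>"
    using brouwer_ball[OF r contC' mapsC] unfolding comp_apply by blast
  have Ca: "C \<xi> \<noteq> a" using farC[OF \<xi>(1)] D' r by auto
  have \<xi>1: "\<xi> \<noteq> a" using inversion_neq_center[OF Ca r] \<xi>(2) by simp
  have "A (inversion a r \<xi>) = \<xi>" using inversion_involutive[OF Ca r] \<xi>(2) C by metis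
  moreover have "dist \<xi> a \<le> \<epsilon>" using i[OF farC[OF \<xi>(1)]] \<xi>(2) by simp
  ultimately show thesis using that \<xi>1 \<eta>1 \<eta>(2) \<eta>2 by blast
qed

text \<open>Under an inversion the distance of two points is multiplied by a factor for each of them, and
  the height of a point by the square of its factor. In the equation that characterizes the geodesic these factors
  cancel. The ratio of the distances to the two ends, which is the exponential of the parameter,
  is multiplied by a constant.\<close>

lemma fixed_ends_translate_geodesic:
  fixes A :: "'a::euclidean_space \<Rightarrow> 'a"
  assumes A: "\<And>x y. dist (A x) (A y) = dist x y" and r: "r > 0"
    and ne: "\<xi> \<noteq> a" "\<eta> \<noteq> a" "\<xi> \<noteq> \<eta>"
    and fixed: "A (inversion a r \<xi>) = \<xi>" "A (inversion a r \<eta>) = \<eta>"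
  shows "horizontal A (inversion (a, 0) r (geod \<xi> \<eta> s)) = geod \<xi> \<eta> (s + ln (dist \<eta> a / dist \<xi> a))"
proof -
  define p where "p = geod \<xi> \<eta> s"
  define q where "q = horizontal A (inversion (a, 0) r p)"
  have p: "snd p > 0" unfolding p_def by (rule geod_in_hspace[OF ne(3)])
  have pa: "p \<noteq> (a, 0)" by (rule hspace_neq[OF p])
  have q: "snd q > 0" unfolding q_def snd_horizontal by (rule snd_inversion_pos[OF r p])
  have q_ht: "snd q = r\<^sup>2 * snd p / (dist p (a, 0))\<^sup>2"
    unfolding q_def snd_horizontal by (rule snd_inversion)
  have q_end: "dist q (\<zeta>, 0) = r\<^sup>2 * dist p (\<zeta>, 0) / (dist p (a, 0) * dist \<zeta> a)"
    if "\<zeta> \<noteq> a" "A (inversion a r \<zeta>) = \<zeta>" for \<zeta>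
  proof -
    have "(\<zeta>, 0) = horizontal A (inversion (a, 0) r (\<zeta>, 0))"
      using that(2) by (simp add: inversion_boundary horizontal_def)
    then have "dist q (\<zeta>, 0) = dist (inversion (a, 0) r p) (inversion (a, 0) r (\<zeta>, 0))"
      unfolding q_def using dist_horizontal[OF A] by metis
    also have "\<dots> = r\<^sup>2 * dist p (\<zeta>, 0) / (dist p (a, 0) * dist (\<zeta>, 0::real) (a, 0))"
      using that(1) by (intro dist_inversion pa) auto
    finally show ?thesis by (simp add: dist_Pair_Pair)
  qed
  have len: "dist \<xi> \<eta> = r\<^sup>2 * dist \<xi> \<eta> / (dist \<xi> a * dist \<eta> a)"
    using dist_inversion[OF ne(1,2), of r] A fixed by metis
  have pos: "dist p (a, 0) > 0" "dist \<xi> a > 0" "dist \<eta> a > 0" "dist \<xi> \<eta> > 0" "dist p (\<eta>, 0) > 0"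
    using pa ne hspace_neq[OF p, of \<eta>] by auto
  have "dist q (\<xi>, 0) * dist q (\<eta>, 0) =
      r\<^sup>2 / (dist p (a, 0))\<^sup>2 * (dist p (\<xi>, 0) * dist p (\<eta>, 0)) * (r\<^sup>2 / (dist \<xi> a * dist \<eta> a))"
    unfolding q_end[OF ne(1) fixed(1)] q_end[OF ne(2) fixed(2)] by (simp add: power2_eq_square mult_ac)
  also have "\<dots> = r\<^sup>2 / (dist p (a, 0))\<^sup>2 * snd p * (r\<^sup>2 * dist \<xi> \<eta> / (dist \<xi> a * dist \<eta> a))"
    unfolding p_def geod_height_times_length[OF ne(3), symmetric] by simp
  also have "\<dots> = snd q * dist \<xi> \<eta>" unfolding len[symmetric] q_ht by simp
  finally have "q = geod \<xi> \<eta> (ln (dist q (\<xi>, 0) / dist q (\<eta>, 0)))"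
    by (intro geod_characterization q ne(3)) simp
  also have "dist q (\<xi>, 0) / dist q (\<eta>, 0) = dist p (\<xi>, 0) / dist p (\<eta>, 0) * (dist \<eta> a / dist \<xi> a)"
    unfolding q_end[OF ne(1) fixed(1)] q_end[OF ne(2) fixed(2)] using pos r
    by simp
  also have "dist p (\<xi>, 0) / dist p (\<eta>, 0) = exp s"
    unfolding p_def by (rule dist_geod_ratio[OF ne(3)])
  also have "ln (exp s * (dist \<eta> a / dist \<xi> a)) = s + ln (dist \<eta> a / dist \<xi> a)"
    using pos by (subst ln_mult) auto
  finally show ?thesis unfolding q_def p_def .
qed

section \<open>Groups with a lattice of translations at infinity\<close>

definition shift :: "'a::euclidean_space \<Rightarrow> 'a \<times> real \<Rightarrow> 'a \<times> real"
  where "shift w p = (fst p + w, snd p)"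

lemma snd_shift [simp]: "snd (shift w p) = snd p" and fst_shift [simp]: "fst (shift w p) = fst p + w"
  by (simp_all add: shift_def)

text \<open>The hemisphere of radius \<open>r\<close> about \<open>(a, 0)\<close> consists of the points whose height \<open>g\<close> preserves;
  \<open>g\<close> maps its top \<open>(a, r)\<close> to the top of the corresponding hemisphere of the inverse.\<close>

definition isometric_sphere :: "('a::euclidean_space \<times> real \<Rightarrow> 'a \<times> real) \<Rightarrow> 'a \<Rightarrow> real \<Rightarrow> bool"
  where "isometric_sphere g a r \<longleftrightarrow> r > 0 \<and>
    (\<forall>p\<in>hspace. snd (g p) = r\<^sup>2 * snd p / (dist p (a, 0))\<^sup>2)"

lemma isometric_sphere_radius_pos: "isometric_sphere g a r \<Longrightarrow> r > 0"
  by (simp add: isometric_sphere_def)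

lemma isometric_sphere_height:
  "isometric_sphere g a r \<Longrightarrow> snd p > 0 \<Longrightarrow> snd (g p) = r\<^sup>2 * snd p / (dist p (a, 0))\<^sup>2"
  by (simp add: isometric_sphere_def)

lemma isometric_sphere_height_above:
  "isometric_sphere g a r \<Longrightarrow> t > 0 \<Longrightarrow> snd (g (a, t)) = r\<^sup>2 / t"
  by (simp add: isometric_sphere_height dist_Pair_Pair power2_eq_square)

lemma isometric_sphere_height_le:
  assumes "isometric_sphere g a r" "snd p > 0"
  shows "snd (g p) \<le> r\<^sup>2 / snd p"
proof -
  have "(snd p)\<^sup>2 \<le> (dist p (a, 0))\<^sup>2" by (simp add: dist_prod_sq)
  then have "snd (g p) \<le> r\<^sup>2 * snd p / (snd p)\<^sup>2"
    unfolding isometric_sphere_height[OF assms] using assms hspace_neq[OF assms(2), of a]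
    by (intro divide_left_mono mult_pos_pos) (auto simp: isometric_sphere_def)
  then show ?thesis using assms by (simp add: power2_eq_square)
qed

lemma isometric_sphere_not_horizontal:
  assumes "isometric_sphere g a r" "\<And>p. snd p > 0 \<Longrightarrow> snd (g p) = snd p"
  shows False
proof -
  have r: "r > 0" using assms by (simp add: isometric_sphere_def)
  have "snd (g (a, 2 * r)) = r / 2"
    using isometric_sphere_height_above[OF assms(1), of "2 * r"] r by (simp add: power2_eq_square)
  then show False using assms(2)[of "(a, 2 * r)"] r by simp
qed

lemma isometric_sphere_radius_unique:
  assumes "isometric_sphere g a r" "isometric_sphere h b s" "\<And>p. snd p > 0 \<Longrightarrow> g p = h p"
  shows "r = s"
proof -
  have r: "r > 0" and s: "s > 0" using assms by (auto simp: isometric_sphere_def)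
  define D where "D = (dist a b)\<^sup>2"
  have e: "r\<^sup>2 / t = s\<^sup>2 * t / (D + t\<^sup>2)" if "t > 0" for t
    using isometric_sphere_height_above[OF assms(1) that] isometric_sphere_height[OF assms(2), of "(a, t)"]
      assms(3)[of "(a, t)"] that unfolding dist_prod_sq by (simp add: D_def dist_norm)
  have "D \<ge> 0" by (simp add: D_def)
  have e': "r\<^sup>2 * (D + t\<^sup>2) = s\<^sup>2 * t\<^sup>2" if "t > 0" for t
  proof -
    have "D + t\<^sup>2 > 0" using \<open>D \<ge> 0\<close> that by (simp add: add_nonneg_pos)
    then show ?thesis using e[OF that] that by (simp add: field_simps power2_eq_square)
  qed
  from e'[of 1] e'[of 2] have "r\<^sup>2 = s\<^sup>2" by (simp add: algebra_simps)
  then show ?thesis using r s by (simp add: power2_eq_iff_nonneg)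
qed

text \<open>A group that acts freely with locally finite orbits and contains the translations by the lattice
  generated by \<open>f\<close>. No other element maps a point above height \<open>c\<close> to a point above height \<open>c\<close>, and
  some element does not fix \<open>\<infinity>\<close>. The values of the elements outside of hyperbolic space are
  irrelevant, and so closure under composition and inversion is asked for on \<open>hspace\<close> only.\<close>

locale cusped_isometry_group =
  fixes G :: "('a::euclidean_space \<times> real \<Rightarrow> 'a \<times> real) set" and f :: "nat \<Rightarrow> 'a" and c :: real
  assumes isom: "g \<in> G \<Longrightarrow> hisom g"
    and comp: "g \<in> G \<Longrightarrow> h \<in> G \<Longrightarrow> \<exists>k\<in>G. \<forall>p\<in>hspace. k p = g (h p)"
    and inv: "g \<in> G \<Longrightarrow> \<exists>k\<in>G. \<forall>p\<in>hspace. k (g p) = p \<and> g (k p) = p"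
    and locally_finite: "p \<in> hspace \<Longrightarrow> finite {g p |g. g \<in> G \<and> hdist (g p) p \<le> R}"
    and free: "g \<in> G \<Longrightarrow> p \<in> hspace \<Longrightarrow> g p = p \<Longrightarrow> q \<in> hspace \<Longrightarrow> g q = q"
    and dim2: "DIM('a) \<ge> 2"
    and inj_f: "inj_on f {..<DIM('a)}"
    and indep_f: "independent (f ` {..<DIM('a)})"
    and lattice: "\<exists>h\<in>G. \<forall>p\<in>hspace. h p = shift (\<Sum>i<DIM('a). of_int (m i) *\<^sub>R f i) p"
    and c_pos: "c > 0"
    and cusp: "h \<in> G \<Longrightarrow> snd p > c \<Longrightarrow> snd (h p) > c \<Longrightarrow>
      \<exists>m. \<forall>q\<in>hspace. h q = shift (\<Sum>i<DIM('a). of_int (m i) *\<^sub>R f i) q"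
    and moves: "\<exists>g\<in>G. \<not> (\<exists>\<kappa>>0. \<forall>p\<in>hspace. snd (g p) = \<kappa> * snd p)"
begin

definition lat :: "(nat \<Rightarrow> int) \<Rightarrow> 'a"
  where "lat m = (\<Sum>i<DIM('a). of_int (m i) *\<^sub>R f i)"

definition related :: "'a \<times> real \<Rightarrow> 'a \<times> real \<Rightarrow> bool"
  where "related p q \<longleftrightarrow> (\<exists>h\<in>G. h p = q)"

lemma G_pos: "g \<in> G \<Longrightarrow> snd p > 0 \<Longrightarrow> snd (g p) > 0"
  using hisom_pos isom by blast

lemma related_refl: "snd p > 0 \<Longrightarrow> related p p"
  using lattice[of "\<lambda>_. 0"] by (auto simp: related_def shift_def)

lemma related_sym:
  assumes "snd p > 0" "related p q" shows "related q p"
proof -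
  obtain h where h: "h \<in> G" "h p = q" using assms(2) by (auto simp: related_def)
  obtain k where "k \<in> G" "\<forall>p\<in>hspace. k (h p) = p \<and> h (k p) = p" using inv[OF h(1)] by blast
  then show ?thesis using h(2) assms(1) unfolding related_def by auto
qed

lemma related_trans:
  assumes "snd p > 0" "related p q" "related q s" shows "related p s"
proof -
  obtain h k where h: "h \<in> G" "h p = q" and k: "k \<in> G" "k q = s" using assms by (auto simp: related_def)
  obtain l where "l \<in> G" "\<forall>p\<in>hspace. l p = k (h p)" using comp[OF k(1) h(1)] by blast
  then show ?thesis using h(2) k(2) assms(1) unfolding related_def by auto
qed

lemma agree_everywhere:
  assumes "g \<in> G" "h \<in> G" "p \<in> hspace" "g p = h p" "q \<in> hspace"
  shows "g q = h q"
proof -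
  obtain k where k: "k \<in> G" "\<forall>p\<in>hspace. k (h p) = p \<and> h (k p) = p" using inv[OF assms(2)] by blast
  obtain l where l: "l \<in> G" "\<forall>p\<in>hspace. l p = k (g p)" using comp[OF k(1) assms(1)] by blast
  have "l p = p" using l k assms by simp
  then have "l q = q" using free[OF l(1) assms(3) _ assms(5)] by blast
  then have "k (g q) = q" using l assms by simp
  then have "h q = h (k (g q))" by simp
  also have "\<dots> = g q" using k(2) G_pos[OF assms(1), of q] assms(5) by simp
  finally show ?thesis by simp
qed

lemma lat_element: "\<exists>h\<in>G. \<forall>p\<in>hspace. h p = shift (lat m) p"
  using lattice[of m] by (simp add: lat_def)

lemma lat_uminus: "lat (\<lambda>i. - m i) = - lat m"
  by (simp add: lat_def sum_negf)

lemma span_f: "span (f ` {..<DIM('a)}) = UNIV"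
proof -
  have "card (f ` {..<DIM('a)}) = DIM('a)" using card_image[OF inj_f] by simp
  then have "dim (span (f ` {..<DIM('a)})) = DIM('a)"
    using dim_span_eq_card_independent[OF indep_f] by simp
  then show ?thesis using dim_eq_full[of "span (f ` {..<DIM('a)})"] by (simp add: span_span)
qed

lemma coordinates:
  obtains \<phi> where "\<And>i. linear (\<phi> i)" "\<And>x. x = (\<Sum>i<DIM('a). \<phi> i x *\<^sub>R f i)"
    "\<And>i m. i < DIM('a) \<Longrightarrow> \<phi> i (lat m) = of_int (m i)"
proof -
  let ?B = "f ` {..<DIM('a)}"
  have "\<exists>\<phi>. linear \<phi> \<and> (\<forall>x\<in>?B. \<phi> x = (if x = f i then 1 else 0 :: real))" for i
    by (rule linear_independent_extend[OF indep_f])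
  then obtain \<phi> where lin: "\<And>i. linear (\<phi> i)"
      and dual: "\<And>i x. x \<in> ?B \<Longrightarrow> \<phi> i x = (if x = f i then 1 else 0 :: real)"
    by metis
  have \<phi>f: "\<phi> i (f j) = (if j = i then 1 else 0)" if "i < DIM('a)" "j < DIM('a)" for i j
    using dual[of "f j" i] that inj_onD[OF inj_f, of j i] by auto
  have "linear (\<lambda>x. \<Sum>i<DIM('a). \<phi> i x *\<^sub>R f i)"
    by (rule linearI) (simp_all add: linear_add[OF lin] linear_scale[OF lin] scaleR_add_left
        sum.distrib scaleR_sum_right)
  moreover have "(\<Sum>i<DIM('a). \<phi> i x *\<^sub>R f i) = x" if x: "x \<in> ?B" for x
  proof -
    obtain j where j: "j < DIM('a)" "x = f j" using x by auto
    have "(\<Sum>i<DIM('a). \<phi> i x *\<^sub>R f i) = (\<Sum>i<DIM('a). if i = j then f j else 0)"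
      using j \<phi>f by (intro sum.cong) auto
    then show ?thesis using j by simp
  qed
  ultimately have expand: "(\<Sum>i<DIM('a). \<phi> i x *\<^sub>R f i) = x" for x
    by (rule linear_eq_on_span[OF _ linear_ident, of _ ?B]) (simp_all add: span_f)
  have "\<phi> i (lat m) = of_int (m i)" if "i < DIM('a)" for i m
  proof -
    have "\<phi> i (lat m) = (\<Sum>j<DIM('a). of_int (m j) * \<phi> i (f j))"
      unfolding lat_def by (simp add: linear_sum[OF lin] linear_scale[OF lin])
    also have "\<dots> = (\<Sum>j<DIM('a). if j = i then of_int (m i) else 0)"
      using that \<phi>f by (intro sum.cong) auto
    finally show ?thesis using that by simp
  qed
  then show thesis using that[OF lin expand[symmetric]] by blast
qed

lemma lattice_cocompact: "\<exists>D. \<forall>x. \<exists>m. norm (x + lat m) \<le> D"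
proof -
  obtain \<phi> where \<phi>: "\<And>x. x = (\<Sum>i<DIM('a). \<phi> i x *\<^sub>R f i)" using coordinates by metis
  have "norm (x + lat (\<lambda>i. - \<lfloor>\<phi> i x\<rfloor>)) \<le> (\<Sum>i<DIM('a). norm (f i))" for x
  proof -
    have "x + lat (\<lambda>i. - \<lfloor>\<phi> i x\<rfloor>) = (\<Sum>i<DIM('a). \<phi> i x *\<^sub>R f i) - (\<Sum>i<DIM('a). of_int \<lfloor>\<phi> i x\<rfloor> *\<^sub>R f i)"
      using \<phi>[of x] unfolding lat_uminus by (simp add: lat_def)
    also have "\<dots> = (\<Sum>i<DIM('a). frac (\<phi> i x) *\<^sub>R f i)"
      by (simp add: sum_subtractf[symmetric] scaleR_diff_left[symmetric] frac_def)
    finally have "norm (x + lat (\<lambda>i. - \<lfloor>\<phi> i x\<rfloor>)) \<le> (\<Sum>i<DIM('a). norm (frac (\<phi> i x) *\<^sub>R f i))"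
      by (metis norm_sum)
    also have "\<dots> \<le> (\<Sum>i<DIM('a). norm (f i))"
      using frac_lt_1[of "\<phi> _ x"] frac_ge_0[of "\<phi> _ x"]
      by (intro sum_mono) (simp add: mult_left_le_one_le less_imp_le)
    finally show ?thesis .
  qed
  then show ?thesis by blast
qed

text \<open>An element that multiplies all heights by a constant maps some point above height \<open>c\<close> to another
  such point.\<close>

lemma translation_or_sphere:
  assumes h: "h \<in> G"
  shows "(\<exists>m. \<forall>q\<in>hspace. h q = shift (lat m) q) \<or> (\<exists>a r. isometric_sphere h a r)"
proof -
  have "\<exists>p\<in>hspace. h p = q" if "q \<in> hspace" for q
  proof -
    obtain k where "k \<in> G" "\<forall>p\<in>hspace. k (h p) = p \<and> h (k p) = p" using inv[OF h] by blast
    then show ?thesis using that G_pos[of k q] by (intro bexI[of _ "k q"]) auto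
  qed
  from isometry_height_dichotomy[OF isom[OF h] this] show ?thesis
  proof
    assume "\<exists>\<kappa>>0. \<forall>p\<in>hspace. snd (h p) = \<kappa> * snd p"
    then obtain \<kappa> where \<kappa>: "\<kappa> > 0" "\<forall>p\<in>hspace. snd (h p) = \<kappa> * snd p" by blast
    define t where "t = max c (c / \<kappa>) + 1"
    have t: "t > c" "t > c / \<kappa>" by (auto simp: t_def)
    then have "\<kappa> * t > c" using \<kappa>(1) by (simp add: divide_less_eq mult.commute)
    then have "snd (h (0, t)) > c" using \<kappa>(2) t c_pos by simp
    then have "\<exists>m. \<forall>q\<in>hspace. h q = shift (lat m) q"
      using cusp[OF h, of "(0, t)"] t unfolding lat_def by simp
    then show ?thesis ..
  qed (auto simp: isometric_sphere_def)
qed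

text \<open>Otherwise the top of the isometric sphere and its image both would lie above height \<open>c\<close>.\<close>

lemma radius_le:
  assumes h: "h \<in> G" and s: "isometric_sphere h a r"
  shows "r \<le> c"
proof (rule ccontr)
  assume "\<not> r \<le> c"
  have r: "r > 0" using s by (rule isometric_sphere_radius_pos)
  have "snd (h (a, r)) = r" using isometric_sphere_height_above[OF s r] r by (simp add: power2_eq_square)
  then have "\<exists>m. \<forall>q\<in>hspace. h q = shift (\<Sum>i<DIM('a). of_int (m i) *\<^sub>R f i) q"
    using cusp[OF h, of "(a, r)"] \<open>\<not> r \<le> c\<close> by simp
  then have "snd (h q) = snd q" if "snd q > 0" for q using that by auto
  then show False using isometric_sphere_not_horizontal[OF s] by blast
qed

text \<open>Composing with lattice translations on both sides moves the top of an isometric sphere and the image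
  of the top into a compact set without changing the radius.\<close>

lemma isometric_sphere_recentre:
  obtains D where "\<And>h a r. h \<in> G \<Longrightarrow> isometric_sphere h a r \<Longrightarrow>
    \<exists>k\<in>G. \<exists>a' b'. isometric_sphere k a' r \<and> norm a' \<le> D \<and> norm b' \<le> D \<and> k (a', r) = (b', r)"
proof -
  obtain D where D: "\<And>x. \<exists>m. norm (x + lat m) \<le> D" using lattice_cocompact by blast
  show thesis
  proof (rule that[of D])
    fix h a r assume h: "h \<in> G" and s: "isometric_sphere h a r"
    have r: "r > 0" using s by (rule isometric_sphere_radius_pos)
    have hr: "snd (h (a, r)) = r" using isometric_sphere_height_above[OF s r] r by (simp add: power2_eq_square)
    obtain m where m: "norm (a + lat m) \<le> D" using D by blast
    obtain m' where m': "norm (fst (h (a, r)) + lat m') \<le> D" using D by blast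
    obtain t where t: "t \<in> G" "\<forall>p\<in>hspace. t p = shift (lat (\<lambda>i. - m i)) p" using lat_element by blast
    obtain t' where t': "t' \<in> G" "\<forall>p\<in>hspace. t' p = shift (lat m') p" using lat_element by blast
    obtain k1 where k1: "k1 \<in> G" "\<forall>p\<in>hspace. k1 p = h (t p)" using comp[OF h t(1)] by blast
    obtain k where k: "k \<in> G" "\<forall>p\<in>hspace. k p = t' (k1 p)" using comp[OF t'(1) k1(1)] by blast
    have kp: "k p = shift (lat m') (h (shift (- lat m) p))" if "snd p > 0" for p
      using k k1 t t' that G_pos[OF h] by (simp add: lat_uminus)
    have "isometric_sphere k (a + lat m) r"
      unfolding isometric_sphere_def
    proof (intro conjI ballI r)
      fix p :: "'a \<times> real" assume "p \<in> hspace"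
      moreover have "dist (shift (- lat m) p) (a, 0) = dist p (a + lat m, 0)"
        by (cases p) (simp add: dist_Pair_Pair shift_def dist_norm algebra_simps)
      ultimately show "snd (k p) = r\<^sup>2 * snd p / (dist p (a + lat m, 0))\<^sup>2"
        using kp[of p] isometric_sphere_height[OF s, of "shift (- lat m) p"] by simp
    qed
    moreover have "k (a + lat m, r) = (fst (h (a, r)) + lat m', r)"
      using kp[of "(a + lat m, r)"] r hr by (simp add: shift_def)
    ultimately show "\<exists>k\<in>G. \<exists>a' b'. isometric_sphere k a' r \<and> norm a' \<le> D \<and> norm b' \<le> D \<and> k (a', r) = (b', r)"
      using k(1) m m' by blast
  qed
qed

text \<open>After this normalization the elements whose isometric spheres have radius at least \<open>r0\<close> move the
  point \<open>o'\<close> by a bounded amount, and there are finitely many of those.\<close>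

lemma largest_isometric_sphere:
  obtains g a r where "g \<in> G" "isometric_sphere g a r"
    "\<And>h b s. h \<in> G \<Longrightarrow> isometric_sphere h b s \<Longrightarrow> s \<le> r"
proof -
  define radii where "radii = {r. \<exists>h\<in>G. \<exists>a. isometric_sphere h a r}"
  obtain g where g: "g \<in> G" "\<not> (\<exists>\<kappa>>0. \<forall>p\<in>hspace. snd (g p) = \<kappa> * snd p)" using moves by blast
  have "\<not> (\<exists>m. \<forall>q\<in>hspace. g q = shift (lat m) q)"
  proof
    assume "\<exists>m. \<forall>q\<in>hspace. g q = shift (lat m) q"
    then have "\<forall>p\<in>hspace. snd (g p) = 1 * snd p" by auto
    then show False using g(2) zero_less_one by blast
  qed
  then obtain a0 r0 where r0: "isometric_sphere g a0 r0" using translation_or_sphere[OF g(1)] by blast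
  then have r0p: "r0 > 0" and "r0 \<in> radii" using g(1) by (auto simp: radii_def isometric_sphere_def)
  obtain D where D: "\<And>h a r. h \<in> G \<Longrightarrow> isometric_sphere h a r \<Longrightarrow>
    \<exists>k\<in>G. \<exists>a' b'. isometric_sphere k a' r \<and> norm a' \<le> D \<and> norm b' \<le> D \<and> k (a', r) = (b', r)"
    using isometric_sphere_recentre by blast
  define E where "E = arcosh ((D\<^sup>2 + c\<^sup>2 + 1) / (2 * r0))"
  define o' where "o' = (0 :: 'a, 1 :: real)"
  have o': "o' \<in> hspace" by (simp add: o'_def)
  have E: "hdist (a, r) o' \<le> E" if "norm a \<le> D" "r0 \<le> r" "r \<le> c" for a r
  proof -
    have r: "r > 0" using that r0p by simp
    have "hcosh (a, r) o' = ((norm a)\<^sup>2 + r\<^sup>2 + 1) / (2 * r)"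
      using hcosh_eq[of "(a, r)" o'] r by (simp add: o'_def)
    also have "\<dots> \<le> (D\<^sup>2 + c\<^sup>2 + 1) / (2 * r0)"
      using that r r0p by (intro frac_le add_mono power_mono) auto
    finally have le: "hcosh (a, r) o' \<le> (D\<^sup>2 + c\<^sup>2 + 1) / (2 * r0)" .
    moreover have "1 \<le> hcosh (a, r) o'" using hcosh_ge_1[of "(a, r)" o'] r o' by simp
    ultimately show ?thesis unfolding hdist_eq E_def
      by (metis arcosh_less_iff_real order.trans not_less)
  qed
  define big where "big = {r \<in> radii. r0 \<le> r}"
  have "\<forall>r\<in>big. \<exists>k\<in>G. \<exists>a b. isometric_sphere k a r \<and> norm a \<le> D \<and> norm b \<le> D \<and> k (a, r) = (b, r)"
    using D by (fastforce simp: big_def radii_def)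
  then obtain k where k: "\<And>r. r \<in> big \<Longrightarrow> k r \<in> G"
      "\<And>r. r \<in> big \<Longrightarrow> \<exists>a b. isometric_sphere (k r) a r \<and> norm a \<le> D \<and> norm b \<le> D \<and> k r (a, r) = (b, r)"
    by metis
  have "(\<lambda>r. k r o') ` big \<subseteq> {g o' |g. g \<in> G \<and> hdist (g o') o' \<le> 2 * E}"
  proof (rule image_subsetI)
    fix r assume r: "r \<in> big"
    obtain a b where ab: "isometric_sphere (k r) a r" "norm a \<le> D" "norm b \<le> D" "k r (a, r) = (b, r)"
      using k(2)[OF r] by blast
    have rr: "r0 \<le> r" "r \<le> c" "r > 0" using r r0p radius_le by (auto simp: big_def radii_def)
    have "hdist (k r o') o' \<le> hdist (k r o') (b, r) + hdist (b, r) o'"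
      using rr o' G_pos[OF k(1)[OF r]] by (intro hdist_triangle) auto
    also have "hdist (k r o') (b, r) = hdist o' (a, r)"
      using hisom_hdist[OF isom[OF k(1)[OF r]] o', of "(a, r)"] ab rr by simp
    also have "\<dots> + hdist (b, r) o' \<le> 2 * E"
      using E[OF ab(2) rr(1,2)] E[OF ab(3) rr(1,2)] by (simp add: hdist_commute[of o'])
    finally show "k r o' \<in> {g o' |g. g \<in> G \<and> hdist (g o') o' \<le> 2 * E}" using k(1)[OF r] by blast
  qed
  then have "finite ((\<lambda>r. k r o') ` big)" using locally_finite[OF o'] finite_subset by blast
  moreover have "inj_on (\<lambda>r. k r o') big"
  proof (rule inj_onI)
    fix r s assume rs: "r \<in> big" "s \<in> big" "k r o' = k s o'"
    obtain a b where "isometric_sphere (k r) a r" "isometric_sphere (k s) b s" using k(2) rs by blast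
    then show "r = s"
      using agree_everywhere[OF k(1)[OF rs(1)] k(1)[OF rs(2)] o' rs(3)]
      by (intro isometric_sphere_radius_unique[of "k r" a r "k s" b s]) auto
  qed
  ultimately have fin: "finite big" using finite_imageD by blast
  have "r0 \<in> big" using \<open>r0 \<in> radii\<close> by (simp add: big_def)
  then have "Max big \<in> big" and max: "\<And>s. s \<in> big \<Longrightarrow> s \<le> Max big" using fin by (auto intro: Max_in)
  then obtain h a where "h \<in> G" "isometric_sphere h a (Max big)" by (auto simp: big_def radii_def)
  moreover have "s \<le> Max big" if "h \<in> G" "isometric_sphere h b s" for h b s
  proof (cases "r0 \<le> s")
    case True
    then show ?thesis using that by (intro max) (auto simp: big_def radii_def)
  next
    case False
    then show ?thesis using max[OF \<open>r0 \<in> big\<close>] by simp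
  qed
  ultimately show thesis using that by blast
qed

end

section \<open>Simplicity of an axis\<close>

context cusped_isometry_group
begin

text \<open>The geodesic projects to a closed geodesic of length \<open>L\<close> without self-intersections.\<close>

definition simple_axis :: "'a \<Rightarrow> 'a \<Rightarrow> real \<Rightarrow> bool"
  where "simple_axis \<xi> \<eta> L \<longleftrightarrow> \<xi> \<noteq> \<eta> \<and> L > 0 \<and>
    (\<forall>s. related (geod \<xi> \<eta> s) (geod \<xi> \<eta> (s + L))) \<and>
    (\<forall>s u. related (geod \<xi> \<eta> s) (geod \<xi> \<eta> u) \<longrightarrow> (\<exists>k::int. u = s + of_int k * L))"

lemma related_periodic:
  assumes ne: "\<xi> \<noteq> \<eta>" and per: "\<And>s. related (geod \<xi> \<eta> s) (geod \<xi> \<eta> (s + L))"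
  shows "related (geod \<xi> \<eta> s) (geod \<xi> \<eta> (s + of_int k * L))"
proof (induction k rule: int_induct[where k = 0])
  case base
  then show ?case using related_refl[OF geod_in_hspace[OF ne, of s]] by simp
next
  case (step1 i)
  have "s + of_int (i + 1) * L = (s + of_int i * L) + L" by (simp add: algebra_simps)
  then show ?case
    using related_trans[OF geod_in_hspace[OF ne] step1(2) per] by metis
next
  case (step2 i)
  have "s + of_int i * L = (s + of_int (i - 1) * L) + L" by (simp add: algebra_simps)
  then have "related (geod \<xi> \<eta> (s + of_int (i - 1) * L)) (geod \<xi> \<eta> (s + of_int i * L))"
    using per by metis
  then show ?case
    using related_trans[OF geod_in_hspace[OF ne] step2(2)] related_sym[OF geod_in_hspace[OF ne]] by blast
qed

text \<open>Why a long axis is simple. The point \<open>P\<close> is the top of a largest isometric sphere, so no point of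
  its orbit is higher than \<open>r\<close>, and the axis of \<open>\<gamma>\<close> passes close to \<open>P\<close> at the parameter \<open>s0\<close>.
  Modulo \<open>\<gamma>\<close> it suffices to compare points of the segment between the parameters \<open>s0\<close> and \<open>s0 + L\<close>,
  which starts near \<open>P\<close> and ends near \<open>\<gamma> P\<close>.

  Two related points above height \<open>r\<close> differ by a lattice translation. They have the same
  height and lie on the same semicircle, so the translation vector is a multiple of \<open>\<eta> - \<xi>\<close> by a factor
  of absolute value less than \<open>1\<close>; as \<open>\<phi>\<close> is integral on the lattice and lies strictly between \<open>0\<close> and \<open>1\<close>
  at \<open>\<eta> - \<xi>\<close>, the vector is \<open>0\<close>.

  A point of the segment that is not much higher than \<open>r\<close> is close to \<open>P\<close> or to \<open>\<gamma> P\<close>, because a long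
  semicircle is almost vertical near its ends. If one of two related points is at
  height at most \<open>r\<close>, it is close to the orbit of \<open>P\<close>, hence so is the other one; as the orbit of \<open>P\<close>
  stays below height \<open>r\<close>, the other point is not much higher than \<open>r\<close> either, and is close to \<open>P\<close> or \<open>\<gamma> P\<close>
  itself. Up to powers of \<open>\<gamma>\<close>, the element that relates the two points then moves \<open>P\<close> by so little that it is
  the identity.\<close>

theorem simple_axisI:
  fixes \<phi> :: "'a \<Rightarrow> real"
  assumes ne: "\<xi> \<noteq> \<eta>" and len: "L > 0"
    and \<gamma>: "\<gamma> \<in> G" and \<gamma>_axis: "\<And>s. \<gamma> (geod \<xi> \<eta> s) = geod \<xi> \<eta> (s + L)"
    and r: "r > 0"
    and high: "\<And>h p. h \<in> G \<Longrightarrow> snd p > r \<Longrightarrow> snd (h p) > r \<Longrightarrow> \<exists>m. \<forall>q\<in>hspace. h q = shift (lat m) q"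
    and P: "snd P = r" "snd (\<gamma> P) = r" "\<And>h. h \<in> G \<Longrightarrow> snd (h P) \<le> r"
    and \<delta>: "\<delta> > 0" and inj_radius: "\<And>h. h \<in> G \<Longrightarrow> hdist (h P) P < 5 * \<delta> \<Longrightarrow> h P = P"
    and s0: "hdist (geod \<xi> \<eta> s0) P \<le> \<delta> / 2"
    and long: "(2 * r * exp (3 / 2 * \<delta>) / dist \<xi> \<eta>)\<^sup>2 + 1 \<le> exp (\<delta> / 2)"
    and \<phi>: "linear \<phi>" "\<And>m. \<phi> (lat m) \<in> \<int>" "0 < \<phi> (\<eta> - \<xi>)" "\<phi> (\<eta> - \<xi>) < 1"
  shows "simple_axis \<xi> \<eta> L"
proof -
  define x where "x s = geod \<xi> \<eta> s" for s
  define M where "M = dist \<xi> \<eta>"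
  have M: "M > 0" using ne by (simp add: M_def)
  have xpos: "snd (x s) > 0" for s unfolding x_def by (rule geod_in_hspace[OF ne])
  have xH [simp]: "x s \<in> hspace" for s using xpos by simp
  have PH [simp]: "P \<in> hspace" using P r by simp
  have \<gamma>PH [simp]: "\<gamma> P \<in> hspace" using P r by simp
  have x_ht: "snd (x s) = M / (2 * cosh s)" for s by (simp add: x_def snd_geod M_def)
  have x_dist: "hdist (x s) (x u) = \<bar>s - u\<bar>" for s u unfolding x_def by (rule hdist_geod[OF ne])
  have \<gamma>x: "\<gamma> (x s) = x (s + L)" for s unfolding x_def by (rule \<gamma>_axis)
  have per: "related (x s) (x (s + L))" for s using \<gamma> \<gamma>x unfolding related_def by blast
  have period: "related (x s) (x (s + of_int k * L))" for s k
    using related_periodic[OF ne per[unfolded x_def]] unfolding x_def .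
  note rel_trans = related_trans[OF xpos] and rel_sym = related_sym[OF xpos]

  \<comment> \<open>On the same side of the top, differences of parameters are differences of logarithms of heights,
    up to the error \<open>\<delta>\<close>: half of it comes from the height of the end point, the other half from
    replacing \<open>2 * cosh s\<close> by \<open>exp \<bar>s\<bar>\<close>.\<close>
  have near_end: "\<bar>u\<bar> - \<bar>s\<bar> \<le> \<theta> + \<delta>"
    if u: "snd (x u) \<ge> r * exp (- (\<delta> / 2))" and s: "snd (x s) \<le> r * exp \<theta>"
      and \<theta>: "\<theta> \<le> 3 / 2 * \<delta>" for s u \<theta>
  proof -
    have "r * exp (- (\<delta> / 2)) * cosh u \<le> snd (x u) * cosh u" using u by (intro mult_right_mono) auto
    also have "\<dots> = snd (x s) * cosh s" by (simp add: x_ht)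
    also have s': "\<dots> \<le> r * exp \<theta> * cosh s" using s by (intro mult_right_mono) auto
    finally have "exp (- (\<delta> / 2)) * cosh u \<le> exp \<theta> * cosh s" using r by simp
    then have "exp (\<delta> / 2) * (exp (- (\<delta> / 2)) * cosh u) \<le> exp (\<delta> / 2) * (exp \<theta> * cosh s)"
      by (intro mult_left_mono) auto
    then have cosh_u: "cosh u \<le> exp (\<delta> / 2) * exp \<theta> * cosh s"
      by (simp add: mult.assoc[symmetric] exp_add[symmetric] del: mult.assoc)
    have exp_u: "exp \<bar>u\<bar> \<le> 2 * cosh u" by (auto simp: cosh_def abs_if)
    have cosh_s: "2 * cosh s = exp \<bar>s\<bar> * (1 + (exp (- \<bar>s\<bar>))\<^sup>2)"
      by (auto simp: cosh_def abs_if exp_minus field_simps power2_eq_square)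
    have "M = 2 * (snd (x s) * cosh s)" by (simp add: x_ht)
    also have "\<dots> \<le> 2 * (r * exp \<theta> * exp \<bar>s\<bar>)"
    proof -
      have "exp s \<le> exp \<bar>s\<bar>" "exp (- s) \<le> exp \<bar>s\<bar>" by auto
      then have "exp s + exp (- s) \<le> 2 * exp \<bar>s\<bar>" by linarith
      then have "cosh s \<le> exp \<bar>s\<bar>" by (simp add: cosh_def)
      then show ?thesis using s' r by (meson mult_left_mono order.trans mult_pos_pos exp_gt_zero less_imp_le zero_le_numeral)
    qed
    also have "\<dots> \<le> 2 * (r * exp (3 / 2 * \<delta>) * exp \<bar>s\<bar>)"
      using \<theta> r by simp
    finally have "exp (- \<bar>s\<bar>) \<le> 2 * r * exp (3 / 2 * \<delta>) / M"
      using M by (simp add: exp_minus field_simps)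
    then have "(exp (- \<bar>s\<bar>))\<^sup>2 \<le> (2 * r * exp (3 / 2 * \<delta>) / M)\<^sup>2" by (intro power_mono) auto
    then have "2 * cosh s \<le> exp \<bar>s\<bar> * exp (\<delta> / 2)"
      unfolding cosh_s using long M_def by (intro mult_left_mono) auto
    then have "exp (\<delta> / 2) * exp \<theta> * (2 * cosh s) \<le> exp (\<delta> / 2) * exp \<theta> * (exp \<bar>s\<bar> * exp (\<delta> / 2))"
      by (intro mult_left_mono) auto
    then have "exp \<bar>u\<bar> \<le> exp (\<delta> / 2) * exp \<theta> * (exp \<bar>s\<bar> * exp (\<delta> / 2))"
      using exp_u cosh_u by linarith
    also have "\<dots> = exp (\<bar>s\<bar> + \<theta> + \<delta>)" by (simp flip: exp_add)
    finally show ?thesis by simp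
  qed

  have near_high: "snd (x u) \<ge> r * exp (- (\<delta> / 2))" if "snd Q = r" "hdist (x u) Q \<le> \<delta> / 2" for u Q
  proof -
    have Q: "Q \<in> hspace" using that r by simp
    have "r \<le> snd (x u) * exp (hdist Q (x u))"
      using snd_le_exp_hdist[OF Q xH, of u] that by simp
    also have "\<dots> \<le> snd (x u) * exp (\<delta> / 2)"
      using that xpos[of u] by (simp add: hdist_commute)
    finally show ?thesis by (simp add: exp_minus field_simps)
  qed

  have low: "\<exists>s'. (s' = s \<or> s' = s - L) \<and> hdist (x s') P \<le> \<theta> + 3 / 2 * \<delta>"
    if seg: "s0 \<le> s" "s \<le> s0 + L" and ht: "snd (x s) \<le> r * exp \<theta>" and \<theta>: "\<theta> \<le> 3 / 2 * \<delta>" for s \<theta>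
  proof (cases "s \<le> 0")
    case True
    have "\<bar>s0\<bar> - \<bar>s\<bar> \<le> \<theta> + \<delta>"
      using near_end[OF near_high[OF P(1) s0[folded x_def]] ht \<theta>] .
    then have "hdist (x s) (x s0) \<le> \<theta> + \<delta>" using True seg x_dist by simp
    then have "hdist (x s) P \<le> \<theta> + 3 / 2 * \<delta>"
      using hdist_triangle[OF xH PH xH, of s s0] s0[folded x_def] by linarith
    then show ?thesis by blast
  next
    case False
    have e: "hdist (x (s0 + L)) (\<gamma> P) \<le> \<delta> / 2"
      using s0 hisom_hdist[OF isom[OF \<gamma>] xH PH, of s0] unfolding \<gamma>x by (simp add: x_def)
    have "\<bar>s0 + L\<bar> - \<bar>s\<bar> \<le> \<theta> + \<delta>"
      using near_end[OF near_high[OF P(2) e] ht \<theta>] .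
    then have "hdist (x s) (x (s0 + L)) \<le> \<theta> + \<delta>" using False seg x_dist by simp
    then have "hdist (x s) (\<gamma> P) \<le> \<theta> + 3 / 2 * \<delta>"
      using hdist_triangle[OF xH \<gamma>PH xH, of s "s0 + L"] e by linarith
    moreover have "hdist (x s) (\<gamma> P) = hdist (x (s - L)) P"
      using hisom_hdist[OF isom[OF \<gamma>] xH PH, of "s - L"] unfolding \<gamma>x by simp
    ultimately show ?thesis by auto
  qed
  have shift_back: "related (x s) (x s')" if "s' = s \<or> s' = s - L" for s s'
    using that period[of s "-1"] related_refl[OF xpos] by auto

  have case_low: "\<exists>k::int. u = s + of_int k * L"
    if s: "s0 \<le> s" "s \<le> s0 + L" and u: "s0 \<le> u" "u \<le> s0 + L"
      and rel: "related (x s) (x u)" and ht: "snd (x u) \<le> r" for s u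
  proof -
    obtain u' where u': "u' = u \<or> u' = u - L" "hdist (x u') P \<le> 3 / 2 * \<delta>"
      using low[OF u, of 0] ht \<delta> by auto
    have "related (x u') (x s)"
      using rel_sym rel_trans[OF rel shift_back[OF u'(1)]] by blast
    then obtain k where k: "k \<in> G" "k (x u') = x s" by (auto simp: related_def)
    have kP: "k P \<in> hspace" using G_pos[OF k(1)] PH by simp
    have "snd (x s) \<le> snd (k P) * exp (hdist (x s) (k P))" by (rule snd_le_exp_hdist[OF xH kP])
    also have "hdist (x s) (k P) = hdist (x u') P"
      using hisom_hdist[OF isom[OF k(1)] xH PH] k(2) by metis
    also have "snd (k P) * exp (hdist (x u') P) \<le> r * exp (3 / 2 * \<delta>)"
      using P(3)[OF k(1)] u'(2) r by (intro mult_mono) auto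
    finally obtain s' where s': "s' = s \<or> s' = s - L" "hdist (x s') P \<le> 3 * \<delta>"
      using low[OF s, of "3 / 2 * \<delta>"] by auto
    have "related (x s') (x u')"
      using rel_trans rel_sym shift_back[OF s'(1)] shift_back[OF u'(1)] rel by blast
    then obtain h where h: "h \<in> G" "h (x s') = x u'" by (auto simp: related_def)
    have hP: "h P \<in> hspace" using G_pos[OF h(1)] PH by simp
    have "hdist (h P) P \<le> hdist (h P) (x u') + hdist (x u') P"
      by (intro hdist_triangle hP PH xH)
    also have "hdist (h P) (x u') = hdist (x s') P"
      using hisom_hdist[OF isom[OF h(1)] PH xH, of s'] h(2) by (simp add: hdist_commute)
    finally have "hdist (h P) P < 5 * \<delta>" using s'(2) u'(2) \<delta> by linarith
    then have "h (x s') = x s'" using free[OF h(1) PH inj_radius[OF h(1)] xH] by blast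
    then have "s' = u'" using h(2) geod_eqD[OF ne] unfolding x_def by metis
    then have "u = s + of_int 0 * L \<or> u = s + of_int 1 * L \<or> u = s + of_int (-1) * L"
      using s'(1) u'(1) by auto
    then show ?thesis by blast
  qed

  have case_high: "u = s" if rel: "related (x s) (x u)" and ht: "snd (x s) > r" "snd (x u) > r" for s u
  proof -
    obtain h where h: "h \<in> G" "h (x s) = x u" using rel by (auto simp: related_def)
    then obtain m where m: "x u = shift (lat m) (x s)"
      using high[of h "x s"] ht xH by metis
    then have "snd (x u) = snd (x s)" by simp
    then have "cosh u = cosh s" using M by (simp add: x_ht)
    have "fst (x u) - fst (x s) = lat m" using m by simp
    then have "lat m = ((tanh u - tanh s) / 2) *\<^sub>R (\<eta> - \<xi>)" unfolding x_def fst_geod_diff by simp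
    then have \<phi>m: "\<phi> (lat m) = (tanh u - tanh s) / 2 * \<phi> (\<eta> - \<xi>)"
      by (simp add: linear_scale[OF \<phi>(1)])
    have "\<bar>tanh u - tanh s\<bar> < 2"
      using tanh_real_lt_1[of u] tanh_real_gt_neg1[of u] tanh_real_lt_1[of s] tanh_real_gt_neg1[of s]
      unfolding abs_less_iff by simp
    then have "\<bar>\<phi> (lat m)\<bar> < 1"
      unfolding \<phi>m abs_mult using \<phi>(3,4) mult_strict_mono[of "\<bar>(tanh u - tanh s) / 2\<bar>" 1 "\<bar>\<phi> (\<eta> - \<xi>)\<bar>" 1] by simp
    then have "\<phi> (lat m) = 0" using \<phi>(2)[of m] by (auto elim!: Ints_cases)
    then have "tanh u = tanh s" using \<phi>m \<phi>(3) by simp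
    then show ?thesis by simp
  qed

  have segment: "\<exists>k::int. u = s + of_int k * L"
    if s: "s0 \<le> s" "s \<le> s0 + L" and u: "s0 \<le> u" "u \<le> s0 + L" and rel: "related (x s) (x u)" for s u
  proof -
    consider "snd (x u) \<le> r" | "snd (x s) \<le> r" | "snd (x s) > r" "snd (x u) > r" by linarith
    then show ?thesis
    proof cases
      case 1
      then show ?thesis by (rule case_low[OF s u rel])
    next
      case 2
      then obtain k :: int where "s = u + of_int k * L" using case_low[OF u s rel_sym[OF rel]] by blast
      then have "u = s + of_int (- k) * L" by simp
      then show ?thesis by blast
    next
      case 3
      then have "u = s + of_int 0 * L" using case_high[OF rel] by simp
      then show ?thesis by blast
    qed
  qed
  have reduce: "\<exists>k::int. s0 \<le> s + of_int k * L \<and> s + of_int k * L \<le> s0 + L" for s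
  proof (intro exI conjI)
    have fl: "of_int \<lfloor>(s - s0) / L\<rfloor> \<le> (s - s0) / L" "(s - s0) / L \<le> of_int \<lfloor>(s - s0) / L\<rfloor> + 1" by linarith+
    then show "s0 \<le> s + of_int (- \<lfloor>(s - s0) / L\<rfloor>) * L" "s + of_int (- \<lfloor>(s - s0) / L\<rfloor>) * L \<le> s0 + L"
      using fl[unfolded pos_le_divide_eq[OF len] pos_divide_le_eq[OF len]] by (simp_all add: algebra_simps)
  qed
  have "\<exists>k::int. u = s + of_int k * L" if rel: "related (x s) (x u)" for s u
  proof -
    obtain i j :: int where i: "s0 \<le> s + of_int i * L" "s + of_int i * L \<le> s0 + L"
      and j: "s0 \<le> u + of_int j * L" "u + of_int j * L \<le> s0 + L" using reduce by metis
    have "related (x (s + of_int i * L)) (x (u + of_int j * L))"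
      using rel_trans rel_sym period rel by meson
    then obtain k :: int where "u + of_int j * L = s + of_int i * L + of_int k * L"
      using segment[OF i j] by blast
    then have "u = s + of_int (i + k - j) * L" by (simp add: algebra_simps)
    then show ?thesis by blast
  qed
  then show ?thesis using ne len per unfolding simple_axis_def x_def by blast
qed

end

section \<open>Long simple axes\<close>

lemma orbit_gap:
  assumes p: "p \<in> hspace" and G_pos: "\<And>h. h \<in> G \<Longrightarrow> snd (h p) > 0"
    and locally_finite: "finite {h p |h. h \<in> G \<and> hdist (h p) p \<le> 1}"
  obtains \<epsilon> where "\<epsilon> > 0" "\<And>h. h \<in> G \<Longrightarrow> hdist (h p) p < \<epsilon> \<Longrightarrow> h p = p"
proof -
  define S where "S = {h p |h. h \<in> G \<and> hdist (h p) p \<le> 1} - {p}"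
  define \<epsilon> where "\<epsilon> = Min (insert 1 ((\<lambda>q. hdist q p) ` S))"
  have fin: "finite S" unfolding S_def using locally_finite by simp
  have "hdist q p > 0" if q: "q \<in> S" for q
  proof -
    obtain h where "h \<in> G" "q = h p" "q \<noteq> p" using q by (auto simp: S_def)
    moreover from this have "q \<in> hspace" using G_pos[of h] by simp
    ultimately show ?thesis
      using hdist_eq_0_iff[of q p] hdist_nonneg[of q p] p by (metis le_less)
  qed
  then have "\<epsilon> > 0" unfolding \<epsilon>_def using fin by auto
  moreover have "h p = p" if h: "h \<in> G" and d: "hdist (h p) p < \<epsilon>" for h
  proof (rule ccontr)
    have "\<epsilon> \<le> 1" unfolding \<epsilon>_def using fin by simp
    assume "h p \<noteq> p"
    then have "h p \<in> S" using h d \<open>\<epsilon> \<le> 1\<close> by (auto simp: S_def)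
    then have "\<epsilon> \<le> hdist (h p) p" unfolding \<epsilon>_def using fin by (intro Min_le) auto
    then show False using d by simp
  qed
  ultimately show thesis using that by blast
qed

context cusped_isometry_group
begin

text \<open>Heights in an orbit: a lattice translation preserves them, and any other element maps the part above
  height \<open>r\<close> below it, if \<open>r\<close> is at least the radius of each isometric sphere.\<close>

lemma height_bound:
  assumes max: "\<And>h b s. h \<in> G \<Longrightarrow> isometric_sphere h b s \<Longrightarrow> s \<le> r"
    and h: "h \<in> G" and p: "snd p > 0"
  shows "snd (h p) = snd p \<and> (\<exists>m. \<forall>q\<in>hspace. h q = shift (lat m) q) \<or> snd (h p) \<le> r\<^sup>2 / snd p"
proof -
  have "snd (h p) \<le> r\<^sup>2 / snd p" if s: "isometric_sphere h b s" for b s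
  proof -
    have "s\<^sup>2 \<le> r\<^sup>2" using max[OF h s] isometric_sphere_radius_pos[OF s] by (intro power_mono) auto
    then have "s\<^sup>2 / snd p \<le> r\<^sup>2 / snd p" using p by (intro divide_right_mono) auto
    then show ?thesis using isometric_sphere_height_le[OF s p] by linarith
  qed
  then show ?thesis using translation_or_sphere[OF h] p by auto
qed

text \<open>If the displacement \<open>b - a\<close> were a lattice vector, a lattice translate of \<open>g\<close> would fix
  the top \<open>(a, r)\<close> of its isometric sphere.\<close>

lemma displacement_not_lattice:
  assumes g: "g \<in> G" and s: "isometric_sphere g a r" and top: "g (a, r) = (b, r)"
  shows "b - a \<noteq> lat m"
proof
  assume eq: "b - a = lat m"
  have r: "r > 0" using s by (rule isometric_sphere_radius_pos)
  obtain t where t: "t \<in> G" "\<forall>p\<in>hspace. t p = shift (lat (\<lambda>i. - m i)) p" using lat_element by blast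
  obtain k where k: "k \<in> G" "\<forall>p\<in>hspace. k p = t (g p)" using comp[OF t(1) g] by blast
  have P: "(a, r) \<in> hspace" using r by simp
  have "k (a, r) = shift (- (b - a)) (b, r)" using k(2) t(2) P top eq by (simp add: lat_uminus)
  also have "\<dots> = (a, r)" by (simp add: shift_def)
  finally have "k q = q" if "snd q > 0" for q using free[OF k(1) P] that by simp
  moreover have "snd (k q) = snd (g q)" if "snd q > 0" for q
    using k(2) t(2) that G_pos[OF g, of q] by simp
  ultimately have "snd (g q) = snd q" if "snd q > 0" for q using that by metis
  then show False using isometric_sphere_not_horizontal[OF s] by blast
qed

text \<open>Long displacements whose direction is not that of a shorter lattice vector. Some coordinate \<open>j\<close> of
  \<open>\<beta>\<close> with respect to the lattice basis is not an integer. Lattice vectors are added to \<open>\<beta>\<close> that bring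
  this coordinate into the open unit interval and make another one large, which
  takes two dimensions.\<close>

lemma displacement_sequence:
  assumes \<beta>: "\<And>m. \<beta> \<noteq> lat m"
  obtains \<psi> m where "linear \<psi>" "\<And>m. \<psi> (lat m) \<in> \<int>"
    "filterlim (\<lambda>N. norm (\<beta> + lat (m N))) at_top sequentially"
    "\<exists>y. 0 < y \<and> y < 1 \<and> (\<forall>N::nat. \<psi> (\<beta> + lat (m N)) = (y::real))"
proof -
  obtain \<phi> where lin: "\<And>i. linear (\<phi> i)" and expand: "\<And>x. x = (\<Sum>i<DIM('a). \<phi> i x *\<^sub>R f i)"
    and \<phi>: "\<And>i m. i < DIM('a) \<Longrightarrow> \<phi> i (lat m) = of_int (m i)"
    using coordinates by metis
  obtain j where j: "j < DIM('a)" "\<phi> j \<beta> \<notin> \<int>"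
  proof (rule ccontr)
    assume "\<not> thesis"
    then have "\<phi> j \<beta> = of_int \<lfloor>\<phi> j \<beta>\<rfloor>" if "j < DIM('a)" for j
      using that \<open>\<And>j. j < DIM('a) \<Longrightarrow> \<phi> j \<beta> \<notin> \<int> \<Longrightarrow> thesis\<close> by (metis Ints_cases floor_of_int)
    then have "\<beta> = lat (\<lambda>i. \<lfloor>\<phi> i \<beta>\<rfloor>)" unfolding lat_def by (subst expand[of \<beta>]) simp
    then show False using \<beta> by blast
  qed
  obtain i where i: "i < DIM('a)" "i \<noteq> j"
  proof
    show "(if j = 0 then 1 else 0) < DIM('a)" "(if j = 0 then 1 else 0) \<noteq> j" using dim2 by auto
  qed
  define m where "m N = (\<lambda>l. if l = i then int N else if l = j then - \<lfloor>\<phi> j \<beta>\<rfloor> else 0)" for N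
  have \<phi>i: "\<phi> i (\<beta> + lat (m N)) = real N + \<phi> i \<beta>" for N
    using \<phi>[OF i(1)] by (simp add: linear_add[OF lin] m_def)
  have \<phi>j: "\<phi> j (\<beta> + lat (m N)) = frac (\<phi> j \<beta>)" for N
    using \<phi>[OF j(1)] i(2) by (simp add: linear_add[OF lin] m_def frac_def)
  obtain B where B: "B > 0" "\<And>x. norm (\<phi> i x) \<le> B * norm x" using linear_bounded_pos[OF lin] by metis
  have "filterlim (\<lambda>N. norm (\<beta> + lat (m N))) at_top sequentially"
  proof (rule filterlim_at_top_mono)
    show "\<forall>\<^sub>F N in sequentially. (1 / B) * (\<phi> i \<beta> + real N) \<le> norm (\<beta> + lat (m N))"
    proof (rule always_eventually, rule allI)
      fix N
      have "real N + \<phi> i \<beta> \<le> B * norm (\<beta> + lat (m N))"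
        using B(2)[of "\<beta> + lat (m N)"] unfolding \<phi>i real_norm_def by linarith
      then show "(1 / B) * (\<phi> i \<beta> + real N) \<le> norm (\<beta> + lat (m N))"
        using B(1) by (simp add: field_simps)
    qed
    show "filterlim (\<lambda>N. (1 / B) * (\<phi> i \<beta> + real N)) at_top sequentially"
      using B(1) by (intro filterlim_tendsto_pos_mult_at_top[OF tendsto_const]
          filterlim_tendsto_add_at_top[OF tendsto_const] filterlim_real_sequentially) simp
  qed
  moreover have "0 < frac (\<phi> j \<beta>)" "frac (\<phi> j \<beta>) < 1" using j(2) frac_lt_1 by (auto simp: frac_gt_0_iff)
  moreover have "\<phi> j (lat m) \<in> \<int>" for m using \<phi>[OF j(1)] by simp
  ultimately show thesis using that[OF lin] \<phi>j by blast
qed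

text \<open>The axes belong to the compositions of \<open>g\<close>, an element with a largest isometric sphere, with
  the translations by the vectors \<open>v N\<close>. When the isometric spheres of \<open>g\<close> and of the inverse have
  centres \<open>a\<close> and \<open>b\<close>, those of the composition have centres \<open>a\<close> and \<open>b + v N\<close>. The ends of its axis are
  at distance at most \<open>\<epsilon> N\<close> from these centres, and \<open>\<epsilon> N\<close> tends to \<open>0\<close>. So the axis passes ever
  closer to the top \<open>P\<close> of the isometric sphere of \<open>g\<close>, the vector between its ends gets ever closer to the
  displacement \<open>b - a + v N\<close>, and for large \<open>N\<close> the conditions for simplicity are met. The
  bound on heights in orbits serves to tell the resulting closed geodesics apart.\<close>

theorem long_simple_axes:
  obtains r where "\<And>h p. h \<in> G \<Longrightarrow> snd p > 0 \<Longrightarrow> snd (h p) \<le> max (snd p) (r\<^sup>2 / snd p)"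
    "\<And>R. \<exists>\<xi> \<eta> L. simple_axis \<xi> \<eta> L \<and> dist \<xi> \<eta> \<ge> R"
proof -
  obtain g a r where g: "g \<in> G" and s: "isometric_sphere g a r"
    and max: "\<And>h b s. h \<in> G \<Longrightarrow> isometric_sphere h b s \<Longrightarrow> s \<le> r" using largest_isometric_sphere by blast
  have r: "r > 0" using s by (rule isometric_sphere_radius_pos)
  have "\<And>p. p \<in> hspace \<Longrightarrow> snd (g p) = r\<^sup>2 * snd p / (dist p (a, 0))\<^sup>2"
    using s unfolding isometric_sphere_def by blast
  from isometric_sphere_normal_form[OF isom[OF g] r this]
  obtain A where "\<forall>x y. dist (A x) (A y) = dist x y"
    "\<forall>p\<in>hspace. g p = horizontal A (inversion (a, 0) r p)" by blast
  then have A: "dist (A x) (A y) = dist x y"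
    and gA: "snd p > 0 \<Longrightarrow> g p = horizontal A (inversion (a, 0) r p)" for x y p
    by auto
  define P where "P = (a, r)"
  have PH: "P \<in> hspace" using r by (simp add: P_def)
  have "inversion (a, 0) r P = P" using r by (simp add: P_def inversion_def dist_Pair_Pair)
  then have gP: "g P = (A a, r)" using gA[of P] r by (simp add: P_def horizontal_def)
  have bound: "snd (h p) = snd p \<and> (\<exists>m. \<forall>q\<in>hspace. h q = shift (lat m) q) \<or> snd (h p) \<le> r\<^sup>2 / snd p"
    if "h \<in> G" "snd p > 0" for h p
    using height_bound[of r h p] max that by blast
  have high: "\<exists>m. \<forall>q\<in>hspace. h q = shift (lat m) q"
    if h: "h \<in> G" and ht: "snd p > r" "snd (h p) > r" for h p
  proof -
    have "r * r < r * snd p" using ht r by simp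
    then have "r\<^sup>2 / snd p < r" using ht r by (simp add: divide_less_eq power2_eq_square)
    then show ?thesis using bound[OF h, of p] ht r by auto
  qed
  have hP: "snd (h P) \<le> r" if "h \<in> G" for h
    using bound[OF that, of P] r by (auto simp: P_def power2_eq_square)
  define \<beta> where "\<beta> = A a - a"
  have "\<beta> \<noteq> lat m" for m
    unfolding \<beta>_def using displacement_not_lattice[OF g s] gP by (simp add: P_def)
  then obtain \<phi> m y where \<phi>: "linear \<phi>" "\<And>m. \<phi> (lat m) \<in> \<int>"
    and far: "filterlim (\<lambda>N. norm (\<beta> + lat (m N))) at_top sequentially"
    and y: "0 < y" "y < 1" "\<And>N::nat. \<phi> (\<beta> + lat (m N)) = (y::real)"
    using displacement_sequence[of \<beta>] by metis
  obtain N0 where N0: "\<And>N. N \<ge> N0 \<Longrightarrow> 2 * r < norm (\<beta> + lat (m N))"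
    using far[unfolded filterlim_at_top_dense] unfolding eventually_sequentially by blast
  \<comment> \<open>Starting the sequence at \<open>N0\<close> makes the two isometric spheres disjoint for all \<open>N\<close>.\<close>
  define v where "v N = lat (m (N + N0))" for N
  define D where "D N = norm (\<beta> + v N)" for N
  have D: "D N > 2 * r" for N using N0[of "N + N0"] by (simp add: D_def v_def)
  have D_lim: "filterlim D at_top sequentially"
    unfolding D_def v_def using filterlim_compose[OF far filterlim_add_const_nat_at_top] .
  define \<epsilon> where "\<epsilon> N = r\<^sup>2 / (D N - r)" for N
  have \<epsilon>: "\<epsilon> N \<le> r" for N
  proof -
    have "r * r \<le> r * (D N - r)" using D[of N] r by (intro mult_left_mono) auto
    then show ?thesis unfolding \<epsilon>_def using D[of N] r by (simp add: divide_le_eq power2_eq_square)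
  qed
  have \<epsilon>_lim: "\<epsilon> \<longlonglongrightarrow> 0"
    unfolding \<epsilon>_def
    by (rule tendsto_divide_0[OF tendsto_const filterlim_at_top_imp_at_infinity])
      (use filterlim_tendsto_add_at_top[OF tendsto_const D_lim, of "- r"] in simp)
  define A' where "A' N = (\<lambda>x. A x + v N)" for N
  have A': "dist (A' N x) (A' N y) = dist x y" for N x y by (simp add: A'_def A)
  have DA': "dist a (A' N a) = D N" for N
    by (simp add: A'_def D_def \<beta>_def dist_norm norm_minus_commute algebra_simps)
  have "\<exists>\<xi> \<eta>. \<xi> \<noteq> a \<and> \<eta> \<noteq> a \<and> A' N (inversion a r \<xi>) = \<xi> \<and> A' N (inversion a r \<eta>) = \<eta> \<and>
    dist \<xi> a \<le> \<epsilon> N \<and> dist \<eta> (A' N a) \<le> \<epsilon> N" for N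
    using isometric_sphere_fixed_points[OF A' r, of a N] D[of N] unfolding DA' \<epsilon>_def by metis
  then obtain \<xi> \<eta> where ne: "\<And>N. \<xi> N \<noteq> a" "\<And>N. \<eta> N \<noteq> a"
    and fixed: "\<And>N. A' N (inversion a r (\<xi> N)) = \<xi> N" "\<And>N. A' N (inversion a r (\<eta> N)) = \<eta> N"
    and ends: "\<And>N. dist (\<xi> N) a \<le> \<epsilon> N" "\<And>N. dist (\<eta> N) (A' N a) \<le> \<epsilon> N"
    by metis
  define M where "M N = dist (\<xi> N) (\<eta> N)" for N
  have M_ge: "M N \<ge> D N - 2 * r" for N
    using dist_triangle[of a "A' N a" "\<xi> N"] dist_triangle[of "\<xi> N" "A' N a" "\<eta> N"] ends[of N] \<epsilon>[of N] DA'[of N]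
    by (simp add: M_def dist_commute)
  have M_pos: "M N > 0" for N using M_ge[of N] D[of N] by simp
  then have \<xi>\<eta>: "\<xi> N \<noteq> \<eta> N" for N by (metis M_def dist_self less_irrefl)
  have M_lim: "filterlim M at_top sequentially"
  proof (rule filterlim_at_top_mono)
    show "filterlim (\<lambda>N. - (2 * r) + D N) at_top sequentially"
      by (rule filterlim_tendsto_add_at_top[OF tendsto_const D_lim])
  qed (use M_ge in \<open>auto intro: always_eventually\<close>)
  have y_lim: "(\<lambda>N. z / M N) \<longlonglongrightarrow> 0" for z
    by (rule tendsto_divide_0[OF tendsto_const filterlim_at_top_imp_at_infinity[OF M_lim]])
  define s0 where "s0 N = ln (r / M N)" for N
  define p where "p N = geod (\<xi> N) (\<eta> N) (s0 N)" for N
  have p: "snd (p N) = r / (1 + (r / M N)\<^sup>2)" "dist (fst (p N)) (\<xi> N) = r * (r / M N) / (1 + (r / M N)\<^sup>2)" for N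
    unfolding p_def s0_def M_def by (rule geod_near_end[OF \<xi>\<eta> r])+
  have one: "1 + 0\<^sup>2 \<noteq> (0::real)" by simp
  have "(\<lambda>N. fst (p N)) \<longlonglongrightarrow> a"
  proof (rule LIM_zero_cancel, rule Lim_null_comparison)
    show "(\<lambda>N. r * (r / M N) / (1 + (r / M N)\<^sup>2) + \<epsilon> N) \<longlonglongrightarrow> 0"
      using tendsto_add[OF tendsto_divide[OF tendsto_mult[OF tendsto_const[of r] y_lim[of r]]
        tendsto_add[OF tendsto_const[of 1] tendsto_power[OF y_lim[of r], of 2]] one] \<epsilon>_lim] by simp
    have "dist (fst (p N)) a \<le> r * (r / M N) / (1 + (r / M N)\<^sup>2) + \<epsilon> N" for N
      using dist_triangle[of "fst (p N)" a "\<xi> N"] ends(1)[of N] unfolding p(2) by linarith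
    then show "\<forall>\<^sub>F N in sequentially. norm (fst (p N) - a) \<le> r * (r / M N) / (1 + (r / M N)\<^sup>2) + \<epsilon> N"
      by (simp add: dist_norm)
  qed
  moreover have "(\<lambda>N. snd (p N)) \<longlonglongrightarrow> r"
    unfolding p using tendsto_divide[OF tendsto_const[of r]
      tendsto_add[OF tendsto_const[of 1] tendsto_power[OF y_lim[of r], of 2]] one] by simp
  ultimately have "(\<lambda>N. (fst (p N), snd (p N))) \<longlonglongrightarrow> P" unfolding P_def by (rule tendsto_Pair)
  then have "p \<longlonglongrightarrow> P" by simp
  moreover have "p N \<in> hspace" for N unfolding p_def using geod_in_hspace[OF \<xi>\<eta>] by simp
  ultimately have p_lim: "(\<lambda>N. hdist (p N) P) \<longlonglongrightarrow> 0" using PH by (intro tendsto_hdist_0)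
  obtain \<delta>' where \<delta>': "\<delta>' > 0" "\<And>h. h \<in> G \<Longrightarrow> hdist (h P) P < \<delta>' \<Longrightarrow> h P = P" using orbit_gap[OF PH _ locally_finite[OF PH]] G_pos PH by (metis in_hspace)
  define \<delta> where "\<delta> = \<delta>' / 5"
  have \<delta>: "\<delta> > 0" "\<And>h. h \<in> G \<Longrightarrow> hdist (h P) P < 5 * \<delta> \<Longrightarrow> h P = P" using \<delta>' by (auto simp: \<delta>_def)
  have "(\<lambda>N. (2 * r * exp (3 / 2 * \<delta>) / M N)\<^sup>2 + 1) \<longlonglongrightarrow> 0\<^sup>2 + 1"
    by (intro tendsto_intros y_lim)
  then have long_lim: "(\<lambda>N. (2 * r * exp (3 / 2 * \<delta>) / M N)\<^sup>2 + 1) \<longlonglongrightarrow> 1" by simp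
  define e where "e N = (\<eta> N - A' N a) - (\<xi> N - a)" for N
  have "e \<longlonglongrightarrow> 0"
  proof (rule tendsto_norm_zero_cancel, rule tendsto_sandwich[OF _ _ tendsto_const])
    show "(\<lambda>N. 2 * \<epsilon> N) \<longlonglongrightarrow> 0" using tendsto_mult[OF tendsto_const[of 2] \<epsilon>_lim] by simp
    show "\<forall>\<^sub>F N in sequentially. norm (e N) \<le> 2 * \<epsilon> N"
    proof (intro always_eventually allI)
      fix N
      have "norm (e N) \<le> dist (\<eta> N) (A' N a) + dist (\<xi> N) a"
        unfolding e_def dist_norm by (rule norm_triangle_ineq4)
      then show "norm (e N) \<le> 2 * \<epsilon> N" using ends[of N] by linarith
    qed
  qed auto
  then have "(\<lambda>N. \<phi> (e N)) \<longlonglongrightarrow> 0"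
    using bounded_linear.tendsto_zero linear_conv_bounded_linear \<phi>(1) by blast
  then have "(\<lambda>N. y + \<phi> (e N)) \<longlonglongrightarrow> y + 0" by (intro tendsto_add tendsto_const)
  moreover have "\<phi> (\<eta> N - \<xi> N) = y + \<phi> (e N)" for N
  proof -
    have "\<eta> N - \<xi> N = (\<beta> + v N) + e N" by (simp add: e_def A'_def \<beta>_def)
    then show ?thesis using y(3)[of "N + N0"] by (simp add: linear_add[OF \<phi>(1)] v_def)
  qed
  ultimately have \<phi>_lim: "(\<lambda>N. \<phi> (\<eta> N - \<xi> N)) \<longlonglongrightarrow> y" by simp
  have simple: "\<exists>\<xi> \<eta> L. simple_axis \<xi> \<eta> L \<and> dist \<xi> \<eta> \<ge> R" for R
  proof -
    have "\<forall>\<^sub>F N in sequentially. R \<le> M N" using M_lim unfolding filterlim_at_top by blast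
    moreover have "\<forall>\<^sub>F N in sequentially. hdist (p N) P < \<delta> / 2"
      using order_tendstoD(2)[OF p_lim, of "\<delta> / 2"] \<delta>(1) by simp
    moreover have "\<forall>\<^sub>F N in sequentially. (2 * r * exp (3 / 2 * \<delta>) / M N)\<^sup>2 + 1 < exp (\<delta> / 2)"
      using order_tendstoD(2)[OF long_lim] \<delta>(1) by simp
    moreover have "\<forall>\<^sub>F N in sequentially. 0 < \<phi> (\<eta> N - \<xi> N)" using order_tendstoD(1)[OF \<phi>_lim y(1)] .
    moreover have "\<forall>\<^sub>F N in sequentially. \<phi> (\<eta> N - \<xi> N) < 1" using order_tendstoD(2)[OF \<phi>_lim y(2)] .
    ultimately have "\<forall>\<^sub>F N in sequentially. R \<le> M N \<and> hdist (p N) P < \<delta> / 2 \<and>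
      (2 * r * exp (3 / 2 * \<delta>) / M N)\<^sup>2 + 1 < exp (\<delta> / 2) \<and> 0 < \<phi> (\<eta> N - \<xi> N) \<and> \<phi> (\<eta> N - \<xi> N) < 1"
      by (simp add: eventually_conj_iff)
    then obtain N where N: "R \<le> M N" "hdist (p N) P < \<delta> / 2"
      "(2 * r * exp (3 / 2 * \<delta>) / M N)\<^sup>2 + 1 < exp (\<delta> / 2)" "0 < \<phi> (\<eta> N - \<xi> N)" "\<phi> (\<eta> N - \<xi> N) < 1"
      using eventually_happens'[OF sequentially_bot] by blast
    define L where "L = ln (dist (\<eta> N) a / dist (\<xi> N) a)"
    have "dist (\<xi> N) a < dist (\<eta> N) a"
      using dist_triangle[of a "A' N a" "\<eta> N"] ends[of N] \<epsilon>[of N] DA'[of N] D[of N] by (simp add: dist_commute)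
    then have L: "L > 0" using ne unfolding L_def by (intro ln_gt_zero) (simp add: less_divide_eq)
    obtain t where t: "t \<in> G" "\<forall>p\<in>hspace. t p = shift (v N) p" using lat_element unfolding v_def by blast
    obtain \<gamma> where \<gamma>: "\<gamma> \<in> G" "\<forall>p\<in>hspace. \<gamma> p = t (g p)" using comp[OF t(1) g] by blast
    have \<gamma>A: "\<gamma> q = horizontal (A' N) (inversion (a, 0) r q)" if "snd q > 0" for q
      using \<gamma>(2) t(2) gA[OF that] G_pos[OF g that] that
      by (simp add: shift_def horizontal_def A'_def)
    have axis: "\<gamma> (geod (\<xi> N) (\<eta> N) s) = geod (\<xi> N) (\<eta> N) (s + L)" for s
      unfolding \<gamma>A[OF geod_in_hspace[OF \<xi>\<eta>]] L_def
      by (rule fixed_ends_translate_geodesic[OF A' r ne \<xi>\<eta> fixed])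
    have "simple_axis (\<xi> N) (\<eta> N) L"
    proof (rule simple_axisI[OF \<xi>\<eta> L \<gamma>(1) axis r high])
      show "snd P = r" by (simp add: P_def)
      show "snd (\<gamma> P) = r" using \<gamma>(2) t(2) PH gP r by simp
      show "\<And>h. h \<in> G \<Longrightarrow> snd (h P) \<le> r" by (rule hP)
      show "\<delta> > 0" "\<And>h. h \<in> G \<Longrightarrow> hdist (h P) P < 5 * \<delta> \<Longrightarrow> h P = P" using \<delta> by blast+
      show "hdist (geod (\<xi> N) (\<eta> N) (s0 N)) P \<le> \<delta> / 2" using N(2) by (simp add: p_def)
      show "(2 * r * exp (3 / 2 * \<delta>) / dist (\<xi> N) (\<eta> N))\<^sup>2 + 1 \<le> exp (\<delta> / 2)"
        using N(3) unfolding M_def by linarith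
      show "linear \<phi>" "\<And>m. \<phi> (lat m) \<in> \<int>" by (rule \<phi>)+
      show "0 < \<phi> (\<eta> N - \<xi> N)" "\<phi> (\<eta> N - \<xi> N) < 1" by (rule N)+
    qed
    then show ?thesis using N(1) unfolding M_def by blast
  qed
  have "snd (h p) \<le> max (snd p) (r\<^sup>2 / snd p)" if "h \<in> G" "snd p > 0" for h p
    using bound[OF that] by auto
  then show thesis using that simple by blast
qed

end

section \<open>Discrete torsion-free groups of hyperbolic isometries\<close>

lemma hdist_continuous:
  fixes z :: "'a::euclidean_space \<times> real"
  assumes z: "z \<in> hspace" and "\<delta> > 0"
  obtains e where "e > 0" "\<And>q. dist q z < e \<Longrightarrow> q \<in> hspace \<and> hdist q z < \<delta>"
proof -
  have "((\<lambda>q. hcosh q z) \<longlongrightarrow> hcosh z z) (nhds z)"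
    unfolding hcosh_def using z by (intro tendsto_intros filterlim_ident) auto
  moreover have "hcosh z z < cosh \<delta>" using \<open>\<delta> > 0\<close> cosh_real_nonneg_less_iff[of 0 \<delta>] by simp
  ultimately have "\<forall>\<^sub>F q in nhds z. hcosh q z < cosh \<delta>" by (rule order_tendstoD(2))
  moreover have "\<forall>\<^sub>F q in nhds z. snd q > 0"
    using z by (intro order_tendstoD(1)[of _ "snd z"] tendsto_intros filterlim_ident) auto
  ultimately have "\<forall>\<^sub>F q in nhds z. hcosh q z < cosh \<delta> \<and> snd q > 0" by eventually_elim simp
  then obtain e where e: "e > 0" "\<And>q. dist q z < e \<Longrightarrow> hcosh q z < cosh \<delta> \<and> snd q > 0"
    unfolding eventually_nhds_metric by blast
  have "q \<in> hspace \<and> hdist q z < \<delta>" if "dist q z < e" for q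
  proof -
    have q: "q \<in> hspace" using e(2)[OF that] by simp
    moreover have "cosh (hdist q z) < cosh \<delta>" using e(2)[OF that] cosh_hdist[OF q z] by simp
    ultimately show ?thesis
      using cosh_real_nonneg_less_iff[of "hdist q z" \<delta>] hdist_nonneg[OF q z] \<open>\<delta> > 0\<close> by simp
  qed
  then show thesis using that e(1) by blast
qed

lemma dist_small_of_hdist_small:
  fixes z :: "'a::euclidean_space \<times> real"
  assumes z: "z \<in> hspace" and "\<epsilon> > 0"
  obtains \<delta> where "\<delta> > 0" "\<And>q. q \<in> hspace \<Longrightarrow> hdist q z < \<delta> \<Longrightarrow> dist q z < \<epsilon>"
proof -
  define F where "F d = 2 * (snd z)\<^sup>2 * exp d * (cosh d - 1)" for d :: real
  have "(F \<longlongrightarrow> F 0) (nhds 0)" unfolding F_def by (intro tendsto_intros filterlim_ident)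
  moreover have "F 0 < \<epsilon>\<^sup>2" using \<open>\<epsilon> > 0\<close> by (simp add: F_def)
  ultimately have "\<forall>\<^sub>F d in nhds 0. F d < \<epsilon>\<^sup>2" by (rule order_tendstoD(2))
  then obtain e where e: "e > 0" "\<And>d. dist d 0 < e \<Longrightarrow> F d < \<epsilon>\<^sup>2"
    unfolding eventually_nhds_metric by blast
  have "dist q z < \<epsilon>" if q: "q \<in> hspace" "hdist q z < e" for q
  proof -
    have d0: "hdist q z \<ge> 0" by (rule hdist_nonneg[OF q(1) z])
    have pos: "snd q > 0" "snd z > 0" using q z by auto
    have "(dist q z)\<^sup>2 = 2 * snd z * snd q * (hcosh q z - 1)" using pos by (simp add: hcosh_def)
    also have "\<dots> \<le> 2 * snd z * (snd z * exp (hdist q z)) * (hcosh q z - 1)"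
      using snd_le_exp_hdist[OF q(1) z] pos hcosh_ge_1[OF q(1) z]
      by (intro mult_right_mono mult_left_mono) auto
    also have "\<dots> = F (hdist q z)"
      by (simp add: F_def cosh_hdist[OF q(1) z] power2_eq_square)
    also have "\<dots> < \<epsilon>\<^sup>2" using e(2)[of "hdist q z"] d0 q(2) by simp
    finally show ?thesis using \<open>\<epsilon> > 0\<close> by (simp add: power_less_imp_less_base)
  qed
  then show thesis using that e(1) by blast
qed

lemma carrier_isom_group: "carrier isom_group =
    {f \<in> Bij hspace. \<forall>p\<in>hspace. \<forall>q\<in>hspace. hdist (f p) (f q) = hdist p q}"
  and mult_isom_group: "mult isom_group = mult (BijGroup hspace)"
  and one_isom_group: "\<one>\<^bsub>isom_group\<^esub> = (\<lambda>p\<in>hspace. p)"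
  by (simp_all add: isom_group_def BijGroup_def)

lemma group_isom_group: "group (isom_group :: ('a::euclidean_space \<times> real \<Rightarrow> 'a \<times> real) monoid)"
proof -
  let ?H = "{f \<in> Bij hspace. \<forall>p\<in>hspace. \<forall>q\<in>hspace. hdist (f p) (f q) = hdist p (q :: 'a \<times> real)}"
  interpret group "BijGroup (hspace :: ('a \<times> real) set)" by (rule group_BijGroup)
  have "subgroup ?H (BijGroup hspace)"
  proof (rule subgroupI)
    show "?H \<subseteq> carrier (BijGroup hspace)" by (auto simp: BijGroup_def)
    show "?H \<noteq> {}" using id_Bij[of hspace] by auto
    fix f assume f: "f \<in> ?H"
    then have B: "f \<in> Bij hspace" by simp
    have i: "inv_into hspace f p \<in> hspace" "f (inv_into hspace f p) = p" if "p \<in> hspace" for p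
      using B that Bij_inv_into_mem[OF B that] by (auto simp: Bij_def bij_betw_def f_inv_into_f)
    have "hdist (inv_into hspace f p) (inv_into hspace f q) = hdist p q" if "p \<in> hspace" "q \<in> hspace" for p q
    proof -
      have "hdist (f (inv_into hspace f p)) (f (inv_into hspace f q)) =
          hdist (inv_into hspace f p) (inv_into hspace f q)"
        using f i(1)[OF that(1)] i(1)[OF that(2)] by blast
      then show ?thesis unfolding i(2)[OF that(1)] i(2)[OF that(2)] by simp
    qed
    then show "inv\<^bsub>BijGroup hspace\<^esub> f \<in> ?H"
      using restrict_inv_into_Bij[OF B] by (simp add: inv_BijGroup[OF B])
  next
    fix f g assume fg: "f \<in> ?H" "g \<in> ?H"
    then have B: "f \<in> Bij hspace" "g \<in> Bij hspace" by auto
    have "g p \<in> hspace" if "p \<in> hspace" for p using Bij_imp_funcset[OF B(2)] that by blast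
    then have "compose hspace f g \<in> ?H"
      using fg compose_Bij[OF B] by (simp add: compose_eq)
    then show "f \<otimes>\<^bsub>BijGroup hspace\<^esub> g \<in> ?H" using B by (simp add: BijGroup_def)
  qed
  from subgroup.subgroup_is_group[OF this group_BijGroup] show ?thesis
    by (simp add: isom_group_def)
qed

locale hyperbolic_group =
  fixes \<Gamma> :: "('a::euclidean_space \<times> real \<Rightarrow> 'a \<times> real) set"
  assumes manifold: "hyperbolic_manifold \<Gamma>"
begin

lemma subgroup: "subgroup \<Gamma> isom_group"
  using manifold by (simp add: hyperbolic_manifold_def)

lemma Bij: "g \<in> \<Gamma> \<Longrightarrow> g \<in> Bij hspace"
  and isometry: "g \<in> \<Gamma> \<Longrightarrow> p \<in> hspace \<Longrightarrow> q \<in> hspace \<Longrightarrow> hdist (g p) (g q) = hdist p q"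
  using subgroup.subset[OF subgroup] unfolding carrier_isom_group by auto

lemma extensional: "g \<in> \<Gamma> \<Longrightarrow> g \<in> extensional hspace"
  using Bij_imp_extensional Bij by blast

lemma maps: "g \<in> \<Gamma> \<Longrightarrow> p \<in> hspace \<Longrightarrow> g p \<in> hspace"
  using Bij_imp_funcset Bij by blast

lemma hisom: "g \<in> \<Gamma> \<Longrightarrow> hisom g"
  using maps isometry unfolding hisom_def by blast

lemma compose_in:
  assumes "g \<in> \<Gamma>" "h \<in> \<Gamma>" shows "compose hspace g h \<in> \<Gamma>"
proof -
  have "g \<otimes>\<^bsub>isom_group\<^esub> h \<in> \<Gamma>" by (rule subgroup.m_closed[OF subgroup assms])
  then show ?thesis using Bij assms by (simp add: mult_isom_group BijGroup_def)
qed

lemma one_in: "(\<lambda>p\<in>hspace. p) \<in> \<Gamma>"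
  using subgroup.one_closed[OF subgroup] by (simp add: one_isom_group)

lemma inverse:
  assumes g: "g \<in> \<Gamma>"
  obtains k where "k \<in> \<Gamma>" "\<And>p. p \<in> hspace \<Longrightarrow> k (g p) = p" "\<And>p. p \<in> hspace \<Longrightarrow> g (k p) = p"
proof
  let ?k = "inv\<^bsub>isom_group\<^esub> g"
  show k: "?k \<in> \<Gamma>" by (rule subgroup.m_inv_closed[OF subgroup g])
  have gc: "g \<in> carrier isom_group" using g subgroup.subset[OF subgroup] by blast
  have "?k \<otimes>\<^bsub>isom_group\<^esub> g = \<one>\<^bsub>isom_group\<^esub>" "g \<otimes>\<^bsub>isom_group\<^esub> ?k = \<one>\<^bsub>isom_group\<^esub>"
    using group.l_inv[OF group_isom_group gc] group.r_inv[OF group_isom_group gc] .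
  then have "compose hspace ?k g = (\<lambda>p\<in>hspace. p)" "compose hspace g ?k = (\<lambda>p\<in>hspace. p)"
    using Bij[OF k] Bij[OF g] by (simp_all add: mult_isom_group one_isom_group BijGroup_def)
  then show "?k (g p) = p" "g (?k p) = p" if "p \<in> hspace" for p
    using that by (metis compose_eq restrict_apply')+
qed

text \<open>A neighbourhood of the identity in the topology of pointwise convergence constrains only
  finitely many values.\<close>

lemma discrete_neighbourhood:
  obtains F \<epsilon> where "finite F" "F \<subseteq> hspace" "\<epsilon> > 0"
    "\<And>g. g \<in> \<Gamma> \<Longrightarrow> (\<And>i. i \<in> F \<Longrightarrow> dist (g i) i < \<epsilon>) \<Longrightarrow> g = (\<lambda>p\<in>hspace. p)"
proof -
  let ?one = "\<lambda>p\<in>(hspace :: ('a \<times> real) set). p"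
  let ?T = "product_topology (\<lambda>_. top_of_set hspace) (hspace :: ('a \<times> real) set)"
  have "openin (subtopology ?T \<Gamma>) {?one}"
    using manifold one_in by (simp add: hyperbolic_manifold_def discrete_isoms_def)
  then obtain S where S: "openin ?T S" "S \<inter> \<Gamma> = {?one}"
    unfolding openin_subtopology by (metis Int_commute)
  then have "?one \<in> S" by blast
  with S(1)[unfolded openin_product_topology_alt]
  have "\<exists>U. finite {i \<in> hspace. U i \<noteq> topspace (top_of_set hspace)} \<and>
      (\<forall>i\<in>hspace. openin (top_of_set hspace) (U i)) \<and> ?one \<in> Pi\<^sub>E hspace U \<and> Pi\<^sub>E hspace U \<subseteq> S"
    by (rule bspec)
  then obtain U where U: "finite {i \<in> hspace. U i \<noteq> topspace (top_of_set hspace)}"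
      "\<forall>i\<in>hspace. openin (top_of_set hspace) (U i)" "?one \<in> Pi\<^sub>E hspace U" "Pi\<^sub>E hspace U \<subseteq> S"
    by (elim exE conjE)
  define F where "F = {i \<in> hspace. U i \<noteq> hspace}"
  have F: "finite F" "F \<subseteq> hspace" using U(1) by (auto simp: F_def)
  have "\<exists>e. e > 0 \<and> (\<forall>q\<in>hspace. dist q i < e \<longrightarrow> q \<in> U i)" if "i \<in> F" for i
  proof -
    have i: "i \<in> hspace" using that F by blast
    then have "i \<in> U i" using PiE_mem[OF U(3) i] by simp
    then show ?thesis using bspec[OF U(2) i] unfolding openin_euclidean_subtopology_iff by (metis dist_commute)
  qed
  then have "\<exists>e. \<forall>i\<in>F. e i > 0 \<and> (\<forall>q\<in>hspace. dist q i < e i \<longrightarrow> q \<in> U i)"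
    by (intro bchoice ballI)
  then obtain e where e': "\<forall>i\<in>F. e i > 0 \<and> (\<forall>q\<in>hspace. dist q i < e i \<longrightarrow> q \<in> U i)"
    by (rule exE)
  then have e: "e i > 0" "q \<in> hspace \<Longrightarrow> dist q i < e i \<Longrightarrow> q \<in> U i" if "i \<in> F" for i q
    using that by blast+
  define \<epsilon> where "\<epsilon> = Min (insert 1 (e ` F))"
  have "\<epsilon> > 0" unfolding \<epsilon>_def using F e(1) by auto
  moreover have "g = ?one" if g: "g \<in> \<Gamma>" and close: "\<And>i. i \<in> F \<Longrightarrow> dist (g i) i < \<epsilon>" for g
  proof -
    have "g i \<in> U i" if i: "i \<in> hspace" for i
    proof (cases "i \<in> F")
      case True
      have "\<epsilon> \<le> e i" unfolding \<epsilon>_def using True F by (intro Min_le) auto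
      then show ?thesis using close[OF True] e(2)[OF True maps[OF g i]] by simp
    next
      case False
      then show ?thesis using maps[OF g i] i by (simp add: F_def)
    qed
    then have "g \<in> Pi\<^sub>E hspace U" using extensional[OF g] by (auto simp: PiE_def)
    then show ?thesis using U(4) S(2) g by blast
  qed
  ultimately show thesis using that F by blast
qed

text \<open>An element is determined by its approximate values at the finitely many points of \<open>F\<close>;
  elements moving \<open>p\<close> by a bounded amount take these values in compact sets.\<close>

theorem finite_bounded_displacement:
  assumes p: "p \<in> hspace"
  shows "finite {g \<in> \<Gamma>. hdist (g p) p \<le> R}"
proof -
  obtain F \<epsilon> where F: "finite F" "F \<subseteq> hspace" "\<epsilon> > 0"
    and one: "\<And>g. g \<in> \<Gamma> \<Longrightarrow> (\<And>i. i \<in> F \<Longrightarrow> dist (g i) i < \<epsilon>) \<Longrightarrow> g = (\<lambda>p\<in>hspace. p)"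
    using discrete_neighbourhood by blast
  have "\<exists>\<delta>>0. \<forall>q\<in>hspace. hdist q i < \<delta> \<longrightarrow> dist q i < \<epsilon>" if "i \<in> F" for i
    using dist_small_of_hdist_small[of i \<epsilon>] F that by (metis subsetD)
  then obtain \<delta> where \<delta>: "\<And>i. i \<in> F \<Longrightarrow> \<delta> i > 0"
      "\<And>i q. i \<in> F \<Longrightarrow> q \<in> hspace \<Longrightarrow> hdist q i < \<delta> i \<Longrightarrow> dist q i < \<epsilon>" by metis
  define S where "S = {g \<in> \<Gamma>. hdist (g p) p \<le> R}"
  have "\<exists>C. finite C \<and> C \<subseteq> hspace \<and> (\<forall>g\<in>S. \<exists>z\<in>C. hdist (g i) z < \<delta> i / 2)" if i: "i \<in> F" for i
  proof -
    obtain K where K: "compact K" "K \<subseteq> hspace" "{q \<in> hspace. hdist p q \<le> hdist i p + R} \<subseteq> K"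
      using hball_subset_compact[OF p] by blast
    have "\<exists>e>0. \<forall>q. dist q z < e \<longrightarrow> hdist q z < \<delta> i / 2" if "z \<in> K" for z
      using hdist_continuous[of z "\<delta> i / 2"] that K(2) \<delta>(1)[OF i] by (metis half_gt_zero subsetD)
    then obtain e where e: "\<And>z. z \<in> K \<Longrightarrow> e z > 0" "\<And>z q. z \<in> K \<Longrightarrow> dist q z < e z \<Longrightarrow> hdist q z < \<delta> i / 2"
      by metis
    have "K \<subseteq> (\<Union>z\<in>K. ball z (e z))" using e(1) by force
    then obtain C where C: "C \<subseteq> K" "finite C" "K \<subseteq> (\<Union>z\<in>C. ball z (e z))"
      using compactE_image[OF K(1), of K "\<lambda>z. ball z (e z)"] by auto
    have "\<exists>z\<in>C. hdist (g i) z < \<delta> i / 2" if g: "g \<in> S" for g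
    proof -
      have iH: "i \<in> hspace" using i F by blast
      have gi: "g i \<in> hspace" "g p \<in> hspace" using maps g iH p by (auto simp: S_def)
      have "hdist p (g i) \<le> hdist p (g p) + hdist (g p) (g i)"
        by (rule hdist_triangle[OF p gi])
      also have "\<dots> \<le> hdist i p + R"
        using g isometry[of g p i] p iH by (simp add: S_def hdist_commute)
      finally have "g i \<in> K" using K(3) gi by blast
      then obtain z where "z \<in> C" "dist (g i) z < e z" using C(3) by (auto simp: dist_commute)
      then show ?thesis using e(2)[of z "g i"] C(1) by blast
    qed
    then show ?thesis using C(1,2) K(2) by (meson order.trans)
  qed
  then have "\<exists>C. \<forall>i\<in>F. finite (C i) \<and> C i \<subseteq> hspace \<and> (\<forall>g\<in>S. \<exists>z\<in>C i. hdist (g i) z < \<delta> i / 2)"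
    by (intro bchoice) blast
  then obtain C where C': "\<forall>i\<in>F. finite (C i) \<and> C i \<subseteq> hspace \<and> (\<forall>g\<in>S. \<exists>z\<in>C i. hdist (g i) z < \<delta> i / 2)"
    by (rule exE)
  then have C: "finite (C i)" "C i \<subseteq> hspace" "g \<in> S \<Longrightarrow> \<exists>z\<in>C i. hdist (g i) z < \<delta> i / 2"
    if "i \<in> F" for i g
    using that by blast+
  define c where "c g = (\<lambda>i\<in>F. SOME z. z \<in> C i \<and> hdist (g i) z < \<delta> i / 2)" for g
  have c: "c g i \<in> C i" "hdist (g i) (c g i) < \<delta> i / 2" if "i \<in> F" "g \<in> S" for g i
  proof -
    have "\<exists>z. z \<in> C i \<and> hdist (g i) z < \<delta> i / 2" using C(3)[OF that] by blast
    from someI_ex[OF this] show "c g i \<in> C i" "hdist (g i) (c g i) < \<delta> i / 2"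
      using that by (simp_all add: c_def)
  qed
  have "c ` S \<subseteq> Pi\<^sub>E F C" using c(1) by (auto simp: c_def)
  then have "finite (c ` S)" using finite_PiE[OF F(1)] C(1) finite_subset by metis
  moreover have "inj_on c S"
  proof (rule inj_onI)
    fix g h assume g: "g \<in> S" and h: "h \<in> S" and eq: "c g = c h"
    have gh: "g \<in> \<Gamma>" "h \<in> \<Gamma>" using g h by (auto simp: S_def)
    obtain k where k: "k \<in> \<Gamma>" "\<And>p. p \<in> hspace \<Longrightarrow> k (h p) = p" "\<And>p. p \<in> hspace \<Longrightarrow> h (k p) = p"
      using inverse[OF gh(2)] by metis
    have "compose hspace k g = (\<lambda>p\<in>hspace. p)"
    proof (rule one[OF compose_in[OF k(1) gh(1)]])
      fix i assume i: "i \<in> F"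
      have iH: "i \<in> hspace" "g i \<in> hspace" "h i \<in> hspace" "c g i \<in> hspace"
        using i F(2) maps[OF gh(1), of i] maps[OF gh(2), of i] C(2)[OF i] c(1)[OF i g] by blast+
      have "hdist (k (g i)) i = hdist (k (g i)) (k (h i))" using k(2) iH by simp
      also have "\<dots> = hdist (g i) (h i)" using isometry[OF k(1)] iH by blast
      also have "\<dots> \<le> hdist (g i) (c g i) + hdist (c g i) (h i)" using iH by (intro hdist_triangle)
      also have "\<dots> < \<delta> i" using c(2)[OF i g] c(2)[OF i h] by (simp add: eq hdist_commute)
      finally show "dist (compose hspace k g i) i < \<epsilon>"
        using \<delta>(2)[OF i, of "k (g i)"] maps[OF k(1)] iH by (simp add: compose_eq)
    qed
    then have "k (g p) = p" if "p \<in> hspace" for p using that by (metis compose_eq restrict_apply')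
    then have "g p = h p" if "p \<in> hspace" for p using that k(3) maps gh by metis
    then show "g = h" using extensional gh by (intro extensionalityI[of g hspace]) auto
  qed
  ultimately show ?thesis using finite_imageD unfolding S_def by blast
qed

text \<open>The powers of \<open>g\<close> all fix \<open>p\<close>, so there are only finitely many of them.\<close>

theorem fixed_point_free:
  assumes g: "g \<in> \<Gamma>" and p: "p \<in> hspace" "g p = p"
  shows "g = (\<lambda>p\<in>hspace. p)"
proof (rule ccontr)
  assume ne: "g \<noteq> (\<lambda>p\<in>hspace. p)"
  have gc: "g \<in> carrier isom_group" using g subgroup.subset[OF subgroup] by blast
  have pow: "g [^]\<^bsub>isom_group\<^esub> n \<in> \<Gamma> \<and> (g [^]\<^bsub>isom_group\<^esub> n) p = p" for n :: nat
  proof (induction n)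
    case 0
    show ?case
      using one_in p(1) monoid.nat_pow_0[OF group.is_monoid[OF group_isom_group], of g]
      unfolding one_isom_group by (metis restrict_apply')
  next
    case (Suc n)
    have "g [^]\<^bsub>isom_group\<^esub> Suc n = compose hspace (g [^]\<^bsub>isom_group\<^esub> n) g"
      using monoid.nat_pow_Suc[OF group.is_monoid[OF group_isom_group], of g n] Bij Suc g
      by (simp add: mult_isom_group BijGroup_def)
    then show ?case using Suc g p compose_in by (simp add: compose_eq)
  qed
  have "finite {h \<in> \<Gamma>. hdist (h p) p \<le> 0}" by (rule finite_bounded_displacement[OF p(1)])
  moreover have "range (\<lambda>n::nat. g [^]\<^bsub>isom_group\<^esub> n) \<subseteq> {h \<in> \<Gamma>. hdist (h p) p \<le> 0}"
    using pow by auto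
  ultimately have "\<not> inj (\<lambda>n::nat. g [^]\<^bsub>isom_group\<^esub> n)"
    using finite_subset range_inj_infinite by blast
  then obtain m n :: nat where mn: "m < n" "g [^]\<^bsub>isom_group\<^esub> n = g [^]\<^bsub>isom_group\<^esub> m"
    unfolding inj_def by (metis linorder_neqE_nat)
  then have "g [^]\<^bsub>isom_group\<^esub> (n - m) = \<one>\<^bsub>isom_group\<^esub>"
    by (intro group.pow_eq_div2[OF group_isom_group gc])
  then show False
    using manifold g ne mn(1)
    unfolding hyperbolic_manifold_def torsion_free_isoms_def one_isom_group by simp
qed

lemma in_orb_self: "p \<in> hspace \<Longrightarrow> p \<in> orb \<Gamma> p"
  unfolding orb_def using one_in by (intro image_eqI[of _ _ "\<lambda>p\<in>hspace. p"]) auto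

lemma orb_subset:
  assumes "h \<in> \<Gamma>" "p \<in> hspace" shows "orb \<Gamma> (h p) \<subseteq> orb \<Gamma> p"
proof
  fix q assume "q \<in> orb \<Gamma> (h p)"
  then obtain g where "g \<in> \<Gamma>" "q = g (h p)" by (auto simp: orb_def)
  then have "compose hspace g h \<in> \<Gamma>" "q = compose hspace g h p"
    using compose_in assms by (auto simp: compose_eq)
  then show "q \<in> orb \<Gamma> p" by (auto simp: orb_def)
qed

lemma orb_eq_iff:
  assumes "p \<in> hspace" "q \<in> hspace"
  shows "orb \<Gamma> p = orb \<Gamma> q \<longleftrightarrow> (\<exists>h\<in>\<Gamma>. h p = q)"
proof
  assume "orb \<Gamma> p = orb \<Gamma> q"
  then have "q \<in> orb \<Gamma> p" using in_orb_self[OF assms(2)] by simp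
  then show "\<exists>h\<in>\<Gamma>. h p = q" unfolding orb_def by blast
next
  assume "\<exists>h\<in>\<Gamma>. h p = q"
  then obtain h where h: "h \<in> \<Gamma>" "h p = q" by blast
  obtain k where k: "k \<in> \<Gamma>" "\<And>p. p \<in> hspace \<Longrightarrow> k (h p) = p" using inverse[OF h(1)] by metis
  have "k q = p" using k(2)[OF assms(1)] h(2) by simp
  then show "orb \<Gamma> p = orb \<Gamma> q"
    using orb_subset[OF h(1) assms(1)] orb_subset[OF k(1) assms(2)] h(2) by auto
qed

end

section \<open>Moving a horocusp to infinity\<close>

text \<open>An isometric involution that moves the centre of the horoball to \<open>\<infinity>\<close>: the identity if it is there
  already, and otherwise an inversion at the point of tangency.\<close>

lemma horoball_chart:
  fixes B :: "('a::euclidean_space \<times> real) set"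
  assumes "horoball B"
  obtains \<phi> c where "c > 0" "hisom \<phi>" "\<And>p. p \<in> hspace \<Longrightarrow> \<phi> (\<phi> p) = p" "B \<subseteq> hspace"
    "\<And>p. p \<in> hspace \<Longrightarrow> p \<in> B \<longleftrightarrow> snd (\<phi> p) > c"
    "\<And>p. p \<in> hspace \<Longrightarrow> p \<in> horosphere B \<longleftrightarrow> snd (\<phi> p) = c"
  using assms unfolding horoball_def
proof (elim disjE exE conjE)
  fix c :: real assume c: "c > 0" and B: "B = {p. snd p > c}"
  have "B = {p. c < (0, 1) \<bullet> p}" by (simp add: B inner_prod_def)
  then have "frontier B = {p. (0, 1) \<bullet> p = c}"
    using frontier_halfspace_gt[of "(0 :: 'a, 1 :: real)" c] by (simp add: zero_prod_def)
  then have "horosphere B = {p. snd p = c} \<inter> hspace"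
    unfolding horosphere_def by (simp add: inner_prod_def)
  then show thesis
    by (intro that[of c "\<lambda>p. p"]) (use c B in \<open>simp_all add: hisom_def subset_iff\<close>)
next
  fix a :: 'a and r :: real assume r: "r > 0" and B: "B = ball (a, r) r"
  let ?i = "inversion (a, 0) 1 :: 'a \<times> real \<Rightarrow> 'a \<times> real"
  have d: "(dist (a, r) p)\<^sup>2 = (dist p (a, 0))\<^sup>2 - 2 * r * snd p + r\<^sup>2" for p
    unfolding dist_commute[of "(a, r)"] dist_prod_sq by (simp add: algebra_simps power2_eq_square)
  have ht: "snd (?i p) = snd p / (dist p (a, 0))\<^sup>2" for p by (simp add: snd_inversion)
  have "p \<in> B \<longleftrightarrow> snd (?i p) > 1 / (2 * r)" "p \<in> sphere (a, r) r \<longleftrightarrow> snd (?i p) = 1 / (2 * r)"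
    if p: "p \<in> hspace" for p
  proof -
    have pos: "(dist p (a, 0))\<^sup>2 > 0" using hspace_neq[of p a] p by simp
    have "p \<in> B \<longleftrightarrow> (dist (a, r) p)\<^sup>2 < r\<^sup>2"
      unfolding B using r power2_less_imp_less[of "dist (a, r) p" r] power_strict_mono[of "dist (a, r) p" r 2]
      by auto
    also have "\<dots> \<longleftrightarrow> snd (?i p) > 1 / (2 * r)"
      unfolding d ht using r pos by (simp add: field_simps)
    finally show "p \<in> B \<longleftrightarrow> snd (?i p) > 1 / (2 * r)" .
    have "p \<in> sphere (a, r) r \<longleftrightarrow> (dist (a, r) p)\<^sup>2 = r\<^sup>2" using r by (simp add: power2_eq_iff_nonneg)
    also have "\<dots> \<longleftrightarrow> snd (?i p) = 1 / (2 * r)"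
      unfolding d ht using r pos by (auto simp: field_simps)
    finally show "p \<in> sphere (a, r) r \<longleftrightarrow> snd (?i p) = 1 / (2 * r)" .
  qed
  moreover have "horosphere B = sphere (a, r) r \<inter> hspace"
    unfolding horosphere_def B using r by (simp add: frontier_ball)
  moreover have "B \<subseteq> hspace"
  proof
    fix p assume "p \<in> B"
    then have "\<bar>r - snd p\<bar> < r" using dist_snd_le[of "(a, r)" p] by (simp add: B dist_real_def)
    then show "p \<in> hspace" by simp
  qed
  moreover have "?i (?i p) = p" if "p \<in> hspace" for p
    using that by (intro inversion_involutive hspace_neq) auto
  ultimately show thesis
    using that[of "1 / (2 * r)" ?i] r hisom_inversion[of 1 a] by simp
qed

definition vertical_ray :: "real \<Rightarrow> 'a::euclidean_space \<times> real"
  where "vertical_ray t = (0, exp t)"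

lemma snd_vertical_ray [simp]: "snd (vertical_ray t) = exp t" by (simp add: vertical_ray_def)

lemma hdist_vertical_ray: "hdist (vertical_ray s) (vertical_ray t) = \<bar>s - t\<bar>"
proof (rule hdist_cosh_eq)
  have "hcosh (vertical_ray s) (vertical_ray t :: 'a \<times> real) = ((exp s)\<^sup>2 + (exp t)\<^sup>2) / (2 * exp s * exp t)"
    using hcosh_eq[of "vertical_ray s" "vertical_ray t :: 'a \<times> real"] by (simp add: vertical_ray_def)
  also have "\<dots> = cosh (s - t)"
    by (simp add: cosh_def exp_diff field_simps power2_eq_square)
  finally show "hcosh (vertical_ray s) (vertical_ray t :: 'a \<times> real) = cosh (s - t)" .
qed simp_all

text \<open>Such an isometry fixes the ideal point \<open>\<infinity>\<close> of the vertical ray. It is a similarity of the Euclidean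
  metric, so along the ray it moves points by at most a multiple of their height, which is
  a bounded hyperbolic distance.\<close>

lemma height_scaling_fixes_infinity:
  fixes g :: "'a::euclidean_space \<times> real \<Rightarrow> 'a \<times> real"
  assumes g: "hisom g" and \<kappa>: "\<kappa> > 0" "\<And>p. p \<in> hspace \<Longrightarrow> snd (g p) = \<kappa> * snd p"
  obtains C where "\<And>t. t \<ge> 0 \<Longrightarrow> hdist (g (vertical_ray t)) (vertical_ray t) \<le> C"
proof -
  define D where "D = \<kappa> + dist (g (vertical_ray 0)) (vertical_ray 0) + 1"
  define Q where "Q = 1 + D\<^sup>2 / (2 * \<kappa>)"
  have "hdist (g (vertical_ray t)) (vertical_ray t) \<le> arcosh Q" if t: "t \<ge> 0" for t
  proof -
    let ?v = "vertical_ray t :: 'a \<times> real" and ?o = "vertical_ray 0 :: 'a \<times> real"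
    have gv: "g ?v \<in> hspace" using g by (simp add: hisom_def)
    have e1: "exp t \<ge> 1" using t by simp
    have vo: "dist ?v ?o \<le> exp t"
      using e1 by (simp add: vertical_ray_def dist_Pair_Pair dist_real_def)
    have "(dist (g ?v) (g ?o))\<^sup>2 = (\<kappa> * dist ?v ?o)\<^sup>2"
      using hisom_dist[OF g, of ?v ?o] \<kappa> by (simp add: vertical_ray_def power2_eq_square)
    then have "dist (g ?v) (g ?o) = \<kappa> * dist ?v ?o"
      using \<kappa>(1) by (simp add: power2_eq_iff_nonneg)
    then have 1: "dist (g ?v) (g ?o) \<le> \<kappa> * exp t" using vo \<kappa>(1) by simp
    have 2: "dist (g ?o) ?o \<le> dist (g ?o) ?o * exp t" using e1 by (simp add: mult_le_cancel_left1)
    have "dist (g ?v) ?v \<le> dist (g ?v) (g ?o) + dist (g ?o) ?o + dist ?o ?v"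
      using dist_triangle[of "g ?v" ?v "g ?o"] dist_triangle[of "g ?o" ?v ?o] by linarith
    also have "\<dots> \<le> D * exp t" using 1 2 vo unfolding D_def by (simp add: dist_commute algebra_simps)
    finally have "(dist (g ?v) ?v)\<^sup>2 \<le> (D * exp t)\<^sup>2" by (intro power_mono) auto
    then have "(dist (g ?v) ?v)\<^sup>2 / (2 * \<kappa> * (exp t)\<^sup>2) \<le> (D * exp t)\<^sup>2 / (2 * \<kappa> * (exp t)\<^sup>2)"
      using \<kappa>(1) by (intro divide_right_mono) auto
    then have "hcosh (g ?v) ?v \<le> Q"
      using \<kappa>(2)[of ?v] \<kappa>(1) by (simp add: hcosh_def Q_def vertical_ray_def power2_eq_square)
    then show ?thesis
      unfolding hdist_eq using hcosh_ge_1[OF gv, of ?v] by (metis arcosh_less_iff_real not_less order.trans in_hspace snd_vertical_ray exp_gt_zero)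
  qed
  then show thesis using that by blast
qed

text \<open>A horocusp together with an involution that moves its horoball to the region above height \<open>c\<close>.\<close>

locale horocusp_chart = hyperbolic_group \<Gamma> for \<Gamma> :: "('a::euclidean_space \<times> real \<Rightarrow> 'a \<times> real) set" +
  fixes B :: "('a \<times> real) set" and \<phi> :: "'a \<times> real \<Rightarrow> 'a \<times> real" and c :: real
  assumes cusp: "horocusp \<Gamma> B" and c: "c > 0" and \<phi>: "hisom \<phi>"
    and \<phi>\<phi>: "p \<in> hspace \<Longrightarrow> \<phi> (\<phi> p) = p" and B_sub: "B \<subseteq> hspace"
    and B_iff: "p \<in> hspace \<Longrightarrow> p \<in> B \<longleftrightarrow> snd (\<phi> p) > c"
    and horosphere_iff: "p \<in> hspace \<Longrightarrow> p \<in> horosphere B \<longleftrightarrow> snd (\<phi> p) = c"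
begin

definition conjugate :: "('a \<times> real \<Rightarrow> 'a \<times> real) \<Rightarrow> 'a \<times> real \<Rightarrow> 'a \<times> real"
  where "conjugate g p = \<phi> (g (\<phi> p))"

definition stab :: "('a \<times> real \<Rightarrow> 'a \<times> real) set"
  where "stab = horoball_stabilizer \<Gamma> B"

lemma \<phi>_in [simp]: "p \<in> hspace \<Longrightarrow> \<phi> p \<in> hspace"
  using hisom_pos[OF \<phi>] by simp

lemma conjugate_hisom: "g \<in> \<Gamma> \<Longrightarrow> hisom (conjugate g)"
proof -
  assume g: "g \<in> \<Gamma>"
  have "conjugate g = \<phi> \<circ> (g \<circ> \<phi>)" by (auto simp: conjugate_def)
  then show "hisom (conjugate g)" using hisom_comp[OF \<phi> hisom_comp[OF hisom[OF g] \<phi>]] by simp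
qed

lemma conjugate_in: "g \<in> \<Gamma> \<Longrightarrow> p \<in> hspace \<Longrightarrow> conjugate g p \<in> hspace"
  unfolding conjugate_def by (rule \<phi>_in[OF maps[OF _ \<phi>_in]])

lemma conjugate_compose:
  assumes "g \<in> \<Gamma>" "h \<in> \<Gamma>" "p \<in> hspace"
  shows "conjugate (compose hspace g h) p = conjugate g (conjugate h p)"
  unfolding conjugate_def compose_eq[OF \<phi>_in[OF assms(3)]]
    \<phi>\<phi>[OF maps[OF assms(2) \<phi>_in[OF assms(3)]]] ..

lemma conjugate_fixed:
  assumes "g \<in> \<Gamma>" "p \<in> hspace" "conjugate g p = p"
  shows "g = (\<lambda>p\<in>hspace. p)"
proof -
  have "g (\<phi> p) = \<phi> p" using assms \<phi>\<phi>[OF maps[OF assms(1) \<phi>_in[OF assms(2)]]] by (simp add: conjugate_def)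
  then show ?thesis using fixed_point_free[OF assms(1) \<phi>_in[OF assms(2)]] by blast
qed

lemma conjugate_one: "p \<in> hspace \<Longrightarrow> conjugate (\<lambda>p\<in>hspace. p) p = p"
  unfolding conjugate_def restrict_apply'[OF \<phi>_in] by (rule \<phi>\<phi>)

lemma stab_sub: "stab \<subseteq> \<Gamma>" and stab_image: "g \<in> stab \<Longrightarrow> g ` B = B"
  by (auto simp: stab_def horoball_stabilizer_def)

lemma one_in_stab: "(\<lambda>p\<in>hspace. p) \<in> stab"
proof -
  have "(\<lambda>p\<in>hspace. p) ` B = B" using B_sub by (force simp del: in_hspace)
  then show ?thesis using one_in by (simp add: stab_def horoball_stabilizer_def del: in_hspace)
qed

lemma compose_in_stab:
  assumes "g \<in> stab" "h \<in> stab" shows "compose hspace g h \<in> stab"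
proof -
  have "compose hspace g h ` B = g ` h ` B"
    using B_sub by (auto simp: compose_def image_image intro!: image_cong simp del: in_hspace)
  then have "compose hspace g h ` B = B" using stab_image assms by simp
  then show ?thesis using compose_in stab_sub assms by (auto simp: stab_def horoball_stabilizer_def)
qed

lemma agree_at_point:
  assumes "g \<in> \<Gamma>" "h \<in> \<Gamma>" "p \<in> hspace" "g p = h p"
  shows "g = h"
proof -
  obtain k where k: "k \<in> \<Gamma>" "\<And>p. p \<in> hspace \<Longrightarrow> k (h p) = p" "\<And>p. p \<in> hspace \<Longrightarrow> h (k p) = p"
    using inverse[OF assms(2)] by metis
  have "compose hspace k g p = p" using assms k(2) by (simp add: compose_eq)
  then have "compose hspace k g = (\<lambda>p\<in>hspace. p)"
    using fixed_point_free compose_in k(1) assms by blast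
  then have "k (g q) = q" if "q \<in> hspace" for q using that by (metis compose_eq restrict_apply')
  then have "g q = h q" if "q \<in> hspace" for q using that k(3) maps assms(1) by metis
  then show ?thesis using extensional assms by (intro extensionalityI[of g hspace]) auto
qed

text \<open>Points of the embedded cusp neighbourhood are related by \<open>\<Gamma>\<close> only if they are related by the
  stabilizer, and the relating element is unique since the action is free.\<close>

lemma in_stabI:
  assumes h: "h \<in> \<Gamma>" and p: "p \<in> B" "h p \<in> B"
  shows "h \<in> stab"
proof -
  have pH: "p \<in> hspace" using p B_sub by blast
  have "orb \<Gamma> p = orb \<Gamma> (h p)" using orb_eq_iff[OF pH maps[OF h pH]] h by blast
  then have "orb stab p = orb stab (h p)" using cusp p unfolding horocusp_def stab_def by blast
  moreover have "h p \<in> orb stab (h p)"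
    unfolding orb_def using one_in_stab maps[OF h pH] by (intro image_eqI[of _ _ "\<lambda>p\<in>hspace. p"]) auto
  ultimately have "h p \<in> orb stab p" by simp
  then obtain k where k: "k \<in> stab" "h p = k p" unfolding orb_def by blast
  then have "k = h" using agree_at_point[OF _ h pH] stab_sub by force
  then show ?thesis using k by simp
qed

text \<open>The conjugated element maps the region above height \<open>c\<close> onto itself. So it cannot have an isometric
  sphere, which would send high points to low ones, and if it multiplies heights by a
  constant, this constant is \<open>1\<close>.\<close>

lemma stab_height:
  assumes g: "g \<in> stab" and p: "p \<in> hspace"
  shows "snd (conjugate g p) = snd p"
proof -
  have g\<Gamma>: "g \<in> \<Gamma>" using g stab_sub by blast
  have iff: "snd (conjugate g p) > c \<longleftrightarrow> snd p > c" if p: "p \<in> hspace" for p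
  proof -
    have gp: "g (\<phi> p) \<in> hspace" by (rule maps[OF g\<Gamma> \<phi>_in[OF p]])
    have inj: "inj_on g hspace" using Bij[OF g\<Gamma>] by (simp add: Bij_def bij_betw_def)
    have "snd p > c \<longleftrightarrow> \<phi> p \<in> B" using B_iff[OF \<phi>_in[OF p]] unfolding \<phi>\<phi>[OF p] by simp
    also have "\<dots> \<longleftrightarrow> g (\<phi> p) \<in> g ` B"
      by (rule inj_on_image_mem_iff[OF inj \<phi>_in[OF p] B_sub, symmetric])
    also have "\<dots> \<longleftrightarrow> snd (conjugate g p) > c" unfolding stab_image[OF g] conjugate_def by (rule B_iff[OF gp])
    finally show ?thesis by simp
  qed
  have surj: "\<exists>p\<in>hspace. conjugate g p = q" if q: "q \<in> hspace" for q
  proof -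
    obtain k where k: "k \<in> \<Gamma>" "\<And>p. p \<in> hspace \<Longrightarrow> g (k p) = p" using inverse[OF g\<Gamma>] by metis
    have "conjugate k q \<in> hspace" by (rule conjugate_in[OF k(1) q])
    moreover have "conjugate g (conjugate k q) = q"
      unfolding conjugate_def \<phi>\<phi>[OF maps[OF k(1) \<phi>_in[OF q]]] k(2)[OF \<phi>_in[OF q]] by (rule \<phi>\<phi>[OF q])
    ultimately show ?thesis by blast
  qed
  have "(\<exists>\<kappa>>0. \<forall>p\<in>hspace. snd (conjugate g p) = \<kappa> * snd p) \<or>
      (\<exists>a r. r > 0 \<and> (\<forall>p\<in>hspace. snd (conjugate g p) = r\<^sup>2 * snd p / (dist p (a, 0))\<^sup>2))"
    by (rule isometry_height_dichotomy[OF conjugate_hisom[OF g\<Gamma>] surj])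
  then show ?thesis
  proof (elim disjE exE conjE)
    fix \<kappa> assume \<kappa>: "\<kappa> > 0" "\<forall>p\<in>hspace. snd (conjugate g p) = \<kappa> * snd p"
    have i: "\<kappa> * t > c \<longleftrightarrow> t > c" if "t > 0" for t
      using iff[of "(0, t)"] \<kappa>(2) that by simp
    have "\<not> \<kappa> < 1" using i[of "c / \<kappa>"] \<kappa>(1) c by (auto simp: less_divide_eq)
    moreover have "\<not> \<kappa> > 1" using i[of c] c by auto
    ultimately show ?thesis using \<kappa>(2) p by simp
  next
    fix a r assume r: "r > 0" "\<forall>p\<in>hspace. snd (conjugate g p) = r\<^sup>2 * snd p / (dist p (a, 0))\<^sup>2"
    then have s: "isometric_sphere (conjugate g) a r" by (simp add: isometric_sphere_def)
    define t where "t = max c (r\<^sup>2 / c) + 1"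
    have t: "t > c" "t > r\<^sup>2 / c" "t > 0" using c by (auto simp: t_def)
    have "r\<^sup>2 / t < c" using t c by (simp add: divide_less_eq mult.commute)
    then show ?thesis using iff[of "(a, t)"] t isometric_sphere_height_above[OF s t(3)] by simp
  qed
qed

end

section \<open>The lattice of a cusp\<close>

context horocusp_chart
begin

lemma inverse_in_stab:
  assumes g: "g \<in> stab"
  obtains k where "k \<in> stab" "\<And>p. p \<in> hspace \<Longrightarrow> k (g p) = p" "\<And>p. p \<in> hspace \<Longrightarrow> g (k p) = p"
proof -
  have "g \<in> \<Gamma>" using g stab_sub by blast
  then obtain k where k: "k \<in> \<Gamma>" "\<And>p. p \<in> hspace \<Longrightarrow> k (g p) = p" "\<And>p. p \<in> hspace \<Longrightarrow> g (k p) = p"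
    using inverse by metis
  have "k ` B = k ` g ` B" by (simp only: stab_image[OF g])
  also have "\<dots> = (\<lambda>p. p) ` B" unfolding image_image using k(2) B_sub by (intro image_cong) auto
  finally have "k \<in> stab" using k(1) by (simp add: stab_def horoball_stabilizer_def)
  then show thesis using that k by blast
qed

lemma horosphere_sub: "p \<in> horosphere B \<Longrightarrow> p \<in> hspace"
  by (simp add: horosphere_def)

lemma stab_horosphere:
  assumes g: "g \<in> stab" and p: "p \<in> horosphere B"
  shows "g p \<in> horosphere B"
proof -
  have pH: "p \<in> hspace" by (rule horosphere_sub[OF p])
  have "g p \<in> hspace" using maps[OF _ pH] g stab_sub by blast
  moreover have "snd (\<phi> (g p)) = c"
    using stab_height[OF g \<phi>_in[OF pH]] horosphere_iff[OF pH] p unfolding conjugate_def \<phi>\<phi>[OF pH] by simp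
  ultimately show ?thesis using horosphere_iff by blast
qed

abbreviation R :: "('a \<times> real \<Rightarrow> 'a \<times> real) \<Rightarrow> 'a \<times> real \<Rightarrow> 'a \<times> real"
  where "R g \<equiv> restrict g (horosphere B)"

lemma R_Bij:
  assumes g: "g \<in> stab" shows "R g \<in> Bij (horosphere B)"
proof -
  obtain k where k: "k \<in> stab" "\<And>p. p \<in> hspace \<Longrightarrow> k (g p) = p" "\<And>p. p \<in> hspace \<Longrightarrow> g (k p) = p"
    using inverse_in_stab[OF g] by metis
  have "bij_betw (R g) (horosphere B) (horosphere B)"
  proof (rule bij_betwI[of _ _ _ "k"])
    show "R g \<in> horosphere B \<rightarrow> horosphere B" "k \<in> horosphere B \<rightarrow> horosphere B"
      using stab_horosphere[OF g] stab_horosphere[OF k(1)] by auto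
    show "k (R g p) = p" if "p \<in> horosphere B" for p
      using k(2)[OF horosphere_sub[OF that]] that by simp
    show "R g (k p) = p" if "p \<in> horosphere B" for p
      using k(3)[OF horosphere_sub[OF that]] stab_horosphere[OF k(1) that] by simp
  qed
  then show ?thesis by (simp add: Bij_def)
qed

lemma R_mult:
  assumes g: "g \<in> stab" and h: "h \<in> stab"
  shows "R g \<otimes>\<^bsub>cusp_group \<Gamma> B\<^esub> R h = R (compose hspace g h)"
proof -
  have "R g \<otimes>\<^bsub>cusp_group \<Gamma> B\<^esub> R h = compose (horosphere B) (R g) (R h)"
    using R_Bij[OF g] R_Bij[OF h] by (simp add: cusp_group_def BijGroup_def)
  also have "\<dots> = R (compose hspace g h)"
  proof (rule extensionalityI[of _ "horosphere B"])
    fix p assume p: "p \<in> horosphere B"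
    show "compose (horosphere B) (R g) (R h) p = R (compose hspace g h) p"
      unfolding restrict_apply'[OF p] compose_eq[OF p] compose_eq[OF horosphere_sub[OF p]]
        restrict_apply'[OF stab_horosphere[OF h p]] ..
  qed auto
  finally show ?thesis .
qed

text \<open>The restriction to the horosphere loses nothing, because the action is free.\<close>

lemma R_inj:
  assumes "g \<in> stab" "h \<in> stab" "R g = R h" shows "g = h"
proof -
  have p: "\<phi> (0, c) \<in> hspace" by (rule \<phi>_in) (simp add: c)
  have "snd (\<phi> (\<phi> (0, c))) = c" by (subst \<phi>\<phi>) (simp_all add: c)
  then have "\<phi> (0, c) \<in> horosphere B" using horosphere_iff[OF p] by blast
  then have "g (\<phi> (0, c)) = h (\<phi> (0, c))" using fun_cong[OF assms(3), of "\<phi> (0, c)"] by simp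
  then show ?thesis using agree_at_point[OF _ _ p] assms stab_sub by blast
qed

lemma conjugate_displacement:
  assumes "g \<in> \<Gamma>" "p \<in> hspace"
  shows "hdist (conjugate g p) p = hdist (g (\<phi> p)) (\<phi> p)"
  using hisom_hdist[OF \<phi> maps[OF assms(1) \<phi>_in[OF assms(2)]] \<phi>_in[OF assms(2)]]
  unfolding conjugate_def \<phi>\<phi>[OF assms(2)] .

lemma conjugates_locally_finite:
  assumes p: "p \<in> hspace"
  shows "finite {g p |g. g \<in> conjugate ` \<Gamma> \<and> hdist (g p) p \<le> D}"
proof (rule finite_subset)
  show "{g p |g. g \<in> conjugate ` \<Gamma> \<and> hdist (g p) p \<le> D} \<subseteq>
      (\<lambda>g. conjugate g p) ` {g \<in> \<Gamma>. hdist (g (\<phi> p)) (\<phi> p) \<le> D}"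
    using conjugate_displacement[OF _ p] by auto
  show "finite ((\<lambda>g. conjugate g p) ` {g \<in> \<Gamma>. hdist (g (\<phi> p)) (\<phi> p) \<le> D})"
    by (rule finite_imageI[OF finite_bounded_displacement[OF \<phi>_in[OF p]]])
qed

lemma conjugate_gap:
  assumes p: "p \<in> hspace"
  obtains \<epsilon> where "\<epsilon> > 0"
    "\<And>g. g \<in> \<Gamma> \<Longrightarrow> g \<noteq> (\<lambda>p\<in>hspace. p) \<Longrightarrow> hdist (conjugate g p) p \<ge> \<epsilon>"
proof -
  have "snd (h p) > 0" if "h \<in> conjugate ` \<Gamma>" for h using conjugate_in[OF _ p] that by auto
  then obtain \<epsilon> where \<epsilon>: "\<epsilon> > 0" "\<And>h. h \<in> conjugate ` \<Gamma> \<Longrightarrow> hdist (h p) p < \<epsilon> \<Longrightarrow> h p = p"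
    using orbit_gap[OF p _ conjugates_locally_finite[OF p]] by metis
  have "hdist (conjugate g p) p \<ge> \<epsilon>" if "g \<in> \<Gamma>" "g \<noteq> (\<lambda>p\<in>hspace. p)" for g
    using \<epsilon>(2)[of "conjugate g"] conjugate_fixed[OF that(1) p] that by fastforce
  then show thesis using that \<epsilon>(1) by blast
qed

text \<open>An element of the stabilizer preserves heights and acts by one and the same Euclidean isometry on all
  horospheres centred at \<open>\<infinity>\<close>. An isomorphism between \<open>\<int>\<^sup>d\<close> and the cusp group thus becomes an
  action of \<open>\<int>\<^sup>d\<close> on \<open>\<real>\<^sup>d\<close>, and its orbits are separated since those of \<open>\<Gamma>\<close> are.\<close>

theorem cusp_lattice:
  assumes iso: "cusp_group \<Gamma> B \<cong> product_group {..<DIM('a)} (\<lambda>_. integer_group)"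
  obtains f where "inj_on f {..<DIM('a)}" "independent (f ` {..<DIM('a)})"
    "\<And>m. \<exists>h\<in>stab. \<forall>p\<in>hspace. conjugate h p = shift (\<Sum>i<DIM('a). of_int (m i) *\<^sub>R f i) p"
    "\<And>h. h \<in> stab \<Longrightarrow> \<exists>m. \<forall>p\<in>hspace. conjugate h p = shift (\<Sum>i<DIM('a). of_int (m i) *\<^sub>R f i) p"
proof -
  let ?Z = "product_group {..<DIM('a)} (\<lambda>_. integer_group)"
  let ?C = "cusp_group \<Gamma> B"
  have carrier_C: "carrier ?C = R ` stab" by (simp add: cusp_group_def stab_def)
  have carrier_Z: "carrier ?Z = extensional {..<DIM('a)}"
    by (auto simp: integer_group_def PiE_def)
  obtain \<Phi> where "\<Phi> \<in> iso ?C ?Z" using iso unfolding is_iso_def by blast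
  then have hom: "\<And>x y. x \<in> carrier ?C \<Longrightarrow> y \<in> carrier ?C \<Longrightarrow> \<Phi> (x \<otimes>\<^bsub>?C\<^esub> y) = \<Phi> x \<otimes>\<^bsub>?Z\<^esub> \<Phi> y"
    and bij: "bij_betw \<Phi> (R ` stab) (extensional {..<DIM('a)})"
    unfolding iso_def hom_def carrier_C[symmetric] carrier_Z[symmetric] by auto
  have \<Phi>_inj: "g = h" if "g \<in> stab" "h \<in> stab" "\<Phi> (R g) = \<Phi> (R h)" for g h
    using bij that R_inj unfolding bij_betw_def inj_on_def by blast
  have \<Phi>_mult: "\<Phi> (R (compose hspace g h)) = (\<lambda>i\<in>{..<DIM('a)}. \<Phi> (R g) i + \<Phi> (R h) i)"
    if "g \<in> stab" "h \<in> stab" for g h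
    using hom[of "R g" "R h"] R_mult[OF that] that by (simp add: carrier_C integer_group_def)
  have "\<exists>g\<in>stab. \<Phi> (R g) = restrict m {..<DIM('a)}" for m
  proof -
    have "restrict m {..<DIM('a)} \<in> \<Phi> ` R ` stab" using bij by (simp add: bij_betw_def)
    then show ?thesis by auto
  qed
  then obtain E where E: "\<And>m. E m \<in> stab" "\<And>m. \<Phi> (R (E m)) = restrict m {..<DIM('a)}" by metis
  have E\<Gamma>: "E m \<in> \<Gamma>" for m using E(1) stab_sub by blast
  have E_add: "E (\<lambda>i. m i + m' i) = compose hspace (E m) (E m')" for m m'
    by (rule \<Phi>_inj[OF E(1) compose_in_stab[OF E(1) E(1)]])
      (auto simp: \<Phi>_mult[OF E(1) E(1)] E(2))
  have E_surj: "\<exists>m. h = E m" if h: "h \<in> stab" for h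
  proof -
    have "\<Phi> (R h) \<in> extensional {..<DIM('a)}" using bij h unfolding bij_betw_def by blast
    then have "\<Phi> (R (E (\<Phi> (R h)))) = \<Phi> (R h)" unfolding E(2) by (rule extensional_restrict)
    then have "h = E (\<Phi> (R h))" using \<Phi>_inj[OF h E(1)] by simp
    then show ?thesis by blast
  qed
  define T where "T m x = fst (conjugate (E m) (x, 1))" for m x
  have E_T: "(\<forall>x y. dist (T m x) (T m y) = dist x y) \<and> (\<forall>p\<in>hspace. conjugate (E m) p = horizontal (T m) p)" for m
  proof -
    obtain A where A: "\<forall>x y. dist (A x) (A y) = dist x y" "\<forall>p\<in>hspace. conjugate (E m) p = horizontal A p"
      using height_preserving_isometry[OF conjugate_hisom[OF E\<Gamma>] stab_height[OF E(1)]] by blast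
    then have "T m = A" by (auto simp: T_def)
    then show ?thesis using A by blast
  qed
  have "\<exists>f. inj_on f {..<DIM('a)} \<and> independent (f ` {..<DIM('a)}) \<and>
    (\<forall>m x. T m x = x + (\<Sum>i<DIM('a). of_int (m i) *\<^sub>R f i))"
  proof (rule free_abelian_isometries_are_translations)
    show "dist (T m x) (T m y) = dist x y" for m x y using E_T by blast
    show "T (\<lambda>i. m i + m' i) x = T m (T m' x)" for m m' x
    proof -
      have x: "(x, 1) \<in> hspace" by simp
      have "conjugate (E (\<lambda>i. m i + m' i)) (x, 1) = conjugate (E m) (conjugate (E m') (x, 1))"
        unfolding E_add by (rule conjugate_compose[OF E\<Gamma> E\<Gamma> x])
      then show ?thesis using E_T by (simp add: horizontal_def)
    qed
    show "T m = T m'" if "\<And>i. i < DIM('a) \<Longrightarrow> m i = m' i" for m m'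
    proof -
      have "restrict m {..<DIM('a)} = restrict m' {..<DIM('a)}" using that by auto
      then have "E m = E m'" using \<Phi>_inj[OF E(1) E(1)] E(2) by metis
      then show ?thesis by (intro ext) (simp only: T_def)
    qed
    show "\<exists>\<epsilon>>0. \<forall>m. (\<exists>i<DIM('a). m i \<noteq> 0) \<longrightarrow> \<epsilon> \<le> dist (T m x) x" for x
    proof -
      have x: "(x, 1) \<in> hspace" by simp
      obtain e where e: "e > 0" "\<And>g. g \<in> \<Gamma> \<Longrightarrow> g \<noteq> (\<lambda>p\<in>hspace. p) \<Longrightarrow> hdist (conjugate g (x, 1)) (x, 1) \<ge> e"
        using conjugate_gap[OF x] by metis
      obtain \<epsilon> where \<epsilon>: "\<epsilon> > 0" "\<And>q. dist q (x, 1) < \<epsilon> \<Longrightarrow> q \<in> hspace \<and> hdist q (x, 1) < e"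
        using hdist_continuous[OF x e(1)] by metis
      have "\<epsilon> \<le> dist (T m x) x" if m: "\<exists>i<DIM('a). m i \<noteq> 0" for m
      proof -
        \<comment> \<open>The identity is idempotent, and \<open>0\<close> is the only idempotent of \<open>\<int>\<^sup>d\<close>.\<close>
        have "E m \<noteq> (\<lambda>p\<in>hspace. p)"
        proof
          assume one: "E m = (\<lambda>p\<in>hspace. p)"
          have cc: "compose hspace (E m) (E m) = E m"
            unfolding one by (rule extensionalityI[of _ hspace]) (auto simp: compose_def)
          have double: "(\<lambda>i\<in>{..<DIM('a)}. restrict m {..<DIM('a)} i + restrict m {..<DIM('a)} i) = restrict m {..<DIM('a)}"
            by (rule \<Phi>_mult[OF E(1) E(1), of m m, unfolded cc E(2), symmetric])
          have "m i + m i = m i" if "i < DIM('a)" for i using fun_cong[OF double, of i] that by simp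
          then show False using m by auto
        qed
        then have "\<not> hdist (conjugate (E m) (x, 1)) (x, 1) < e" using e(2)[OF E\<Gamma>, of m] by simp
        then have "\<not> dist (conjugate (E m) (x, 1)) (x, 1) < \<epsilon>" using \<epsilon>(2) by blast
        moreover have "conjugate (E m) (x, 1) = (T m x, 1)" using E_T x by (simp add: horizontal_def)
        ultimately show ?thesis by (simp add: dist_Pair_Pair)
      qed
      then show ?thesis using \<epsilon>(1) by blast
    qed
  qed
  then obtain f where f: "inj_on f {..<DIM('a)}" "independent (f ` {..<DIM('a)})"
    "\<And>m x. T m x = x + (\<Sum>i<DIM('a). of_int (m i) *\<^sub>R f i)" by blast
  have E_shift: "\<forall>p\<in>hspace. conjugate (E m) p = shift (\<Sum>i<DIM('a). of_int (m i) *\<^sub>R f i) p" for m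
    using E_T by (simp add: horizontal_def shift_def f(3))
  show thesis
    by (rule that[OF f(1,2)]) (use E(1) E_shift E_surj in blast)+
qed

text \<open>If every element of the conjugated group multiplied heights by a constant, the group would
  fix an ideal point.\<close>

lemma nonelementary_moves_infinity:
  assumes "\<not> elementary \<Gamma>"
  shows "\<exists>g\<in>\<Gamma>. \<not> (\<exists>\<kappa>>0. \<forall>p\<in>hspace. snd (conjugate g p) = \<kappa> * snd p)"
proof (rule ccontr)
  assume "\<not> ?thesis"
  then have scale: "\<And>g. g \<in> \<Gamma> \<Longrightarrow> \<exists>\<kappa>>0. \<forall>p\<in>hspace. snd (conjugate g p) = \<kappa> * snd p" by blast
  define \<rho> where "\<rho> t = \<phi> (vertical_ray t)" for t
  have vH: "vertical_ray t \<in> hspace" for t by simp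
  have \<rho>H: "\<rho> t \<in> hspace" for t unfolding \<rho>_def by (rule \<phi>_in[OF vH])
  have ray: "geodesic_ray \<rho>"
    unfolding geodesic_ray_def \<rho>_def using \<phi>_in[OF vH] hisom_hdist[OF \<phi> vH vH] by (simp add: hdist_vertical_ray)
  have "ideal_point (g \<circ> \<rho>) = ideal_point \<rho>" if g: "g \<in> \<Gamma>" for g
  proof -
    obtain \<kappa> where \<kappa>: "\<kappa> > 0" "\<And>p. p \<in> hspace \<Longrightarrow> snd (conjugate g p) = \<kappa> * snd p" using scale[OF g] by blast
    obtain C where C: "\<And>t. t \<ge> 0 \<Longrightarrow> hdist (conjugate g (vertical_ray t)) (vertical_ray t) \<le> C"
      using height_scaling_fixes_infinity[OF conjugate_hisom[OF g] \<kappa>] by metis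
    have near: "hdist (g (\<rho> t)) (\<rho> t) \<le> C" if "t \<ge> 0" for t
      using C[OF that] conjugate_displacement[OF g vH] by (simp add: \<rho>_def)
    have g\<rho>: "g (\<rho> t) \<in> hspace" for t by (rule maps[OF g \<rho>H])
    have "(\<exists>D. \<forall>t\<ge>0. hdist (g (\<rho> t)) (\<sigma> t) \<le> D) \<longleftrightarrow> (\<exists>D. \<forall>t\<ge>0. hdist (\<rho> t) (\<sigma> t) \<le> D)"
      if \<sigma>: "geodesic_ray \<sigma>" for \<sigma>
    proof -
      have \<sigma>H: "\<sigma> t \<in> hspace" if "t \<ge> 0" for t using \<sigma> that by (simp add: geodesic_ray_def)
      have 1: "hdist (\<rho> t) (\<sigma> t) \<le> C + D" if "hdist (g (\<rho> t)) (\<sigma> t) \<le> D" "t \<ge> 0" for t D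
        using hdist_triangle[OF \<rho>H \<sigma>H g\<rho>, of t t t] near[of t] that by (simp add: hdist_commute)
      have 2: "hdist (g (\<rho> t)) (\<sigma> t) \<le> C + D" if "hdist (\<rho> t) (\<sigma> t) \<le> D" "t \<ge> 0" for t D
        using hdist_triangle[OF g\<rho> \<sigma>H \<rho>H, of t t t] near[of t] that by simp
      show ?thesis
      proof
        assume "\<exists>D. \<forall>t\<ge>0. hdist (g (\<rho> t)) (\<sigma> t) \<le> D"
        then show "\<exists>D. \<forall>t\<ge>0. hdist (\<rho> t) (\<sigma> t) \<le> D" using 1 by blast
      next
        assume "\<exists>D. \<forall>t\<ge>0. hdist (\<rho> t) (\<sigma> t) \<le> D"
        then show "\<exists>D. \<forall>t\<ge>0. hdist (g (\<rho> t)) (\<sigma> t) \<le> D" using 2 by blast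
      qed
    qed
    then show ?thesis by (auto simp: ideal_point_def)
  qed
  then have "(\<lambda>g. ideal_point (g \<circ> \<rho>)) ` \<Gamma> \<subseteq> {ideal_point \<rho>}" by blast
  then have "finite ((\<lambda>g. ideal_point (g \<circ> \<rho>)) ` \<Gamma>)" using finite_subset by blast
  then show False using assms ray unfolding elementary_def by blast
qed

theorem conjugate_cusped_isometry_group:
  assumes "DIM('a) \<ge> 2" "\<not> elementary \<Gamma>"
    and "cusp_group \<Gamma> B \<cong> product_group {..<DIM('a)} (\<lambda>_. integer_group)"
  obtains f where "cusped_isometry_group (conjugate ` \<Gamma>) f c"
proof (rule cusp_lattice[OF assms(3)])
  fix f assume f: "inj_on f {..<DIM('a)}" "independent (f ` {..<DIM('a)})"
    "\<And>m. \<exists>h\<in>stab. \<forall>p\<in>hspace. conjugate h p = shift (\<Sum>i<DIM('a). of_int (m i) *\<^sub>R f i) p"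
    "\<And>h. h \<in> stab \<Longrightarrow> \<exists>m. \<forall>p\<in>hspace. conjugate h p = shift (\<Sum>i<DIM('a). of_int (m i) *\<^sub>R f i) p"
  have "cusped_isometry_group (conjugate ` \<Gamma>) f c"
  proof
    show "hisom g" if "g \<in> conjugate ` \<Gamma>" for g using that conjugate_hisom by blast
    show "\<exists>k\<in>conjugate ` \<Gamma>. \<forall>p\<in>hspace. k p = g (h p)" if g: "g \<in> conjugate ` \<Gamma>" and h: "h \<in> conjugate ` \<Gamma>" for g h
    proof -
      obtain g' h' where gh: "g' \<in> \<Gamma>" "g = conjugate g'" "h' \<in> \<Gamma>" "h = conjugate h'" using g h by auto
      show ?thesis
        unfolding gh(2,4) using conjugate_compose[OF gh(1,3)] compose_in[OF gh(1,3)]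
        by (intro bexI[of _ "conjugate (compose hspace g' h')"]) auto
    qed
    show "\<exists>k\<in>conjugate ` \<Gamma>. \<forall>p\<in>hspace. k (g p) = p \<and> g (k p) = p" if g: "g \<in> conjugate ` \<Gamma>" for g
    proof -
      obtain g' where g: "g' \<in> \<Gamma>" "g = conjugate g'" using g by auto
      obtain k where k: "k \<in> \<Gamma>" "\<And>p. p \<in> hspace \<Longrightarrow> k (g' p) = p" "\<And>p. p \<in> hspace \<Longrightarrow> g' (k p) = p"
        using inverse[OF g(1)] by metis
      have "conjugate k (g p) = p \<and> g (conjugate k p) = p" if p: "p \<in> hspace" for p
        unfolding g(2) conjugate_def \<phi>\<phi>[OF maps[OF g(1) \<phi>_in[OF p]]] \<phi>\<phi>[OF maps[OF k(1) \<phi>_in[OF p]]]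
          k(2)[OF \<phi>_in[OF p]] k(3)[OF \<phi>_in[OF p]] by (simp only: \<phi>\<phi>[OF p])
      then show ?thesis using k(1) by blast
    qed
    show "finite {g p |g. g \<in> conjugate ` \<Gamma> \<and> hdist (g p) p \<le> R}" if "p \<in> hspace" for p R
      by (rule conjugates_locally_finite[OF that])
    show "g q = q" if "g \<in> conjugate ` \<Gamma>" "p \<in> hspace" "g p = p" "q \<in> hspace" for g p q
      using that conjugate_fixed conjugate_one by blast
    show "\<exists>h\<in>conjugate ` \<Gamma>. \<forall>p\<in>hspace. h p = shift (\<Sum>i<DIM('a). of_int (m i) *\<^sub>R f i) p" for m
      using f(3)[of m] stab_sub by blast
    show "\<exists>m. \<forall>q\<in>hspace. h q = shift (\<Sum>i<DIM('a). of_int (m i) *\<^sub>R f i) q"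
      if h: "h \<in> conjugate ` \<Gamma>" and ht: "c < snd p" "c < snd (h p)" for h p
    proof -
      obtain g where g: "g \<in> \<Gamma>" "h = conjugate g" using h by auto
      have p: "p \<in> hspace" using ht c by simp
      have gp: "g (\<phi> p) \<in> hspace" by (rule maps[OF g(1) \<phi>_in[OF p]])
      have "\<phi> p \<in> B" using B_iff[OF \<phi>_in[OF p]] ht(1) unfolding \<phi>\<phi>[OF p] by simp
      moreover have "g (\<phi> p) \<in> B" using B_iff[OF gp] ht(2) g(2) by (simp add: conjugate_def)
      ultimately show ?thesis using f(4)[OF in_stabI[OF g(1)]] g(2) by blast
    qed
    show "\<exists>g\<in>conjugate ` \<Gamma>. \<not> (\<exists>\<kappa>>0. \<forall>p\<in>hspace. snd (g p) = \<kappa> * snd p)"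
      using nonelementary_moves_infinity[OF assms(2)] by blast
  qed (use assms(1) f(1,2) c in auto)
  then show thesis by (rule that)
qed

end

section \<open>Simple closed geodesics in the quotient\<close>

context hyperbolic_group
begin

text \<open>Nontrivial elements move \<open>x\<close> by at least \<open>4 * e\<close>, so no other representatives of the orbits of two
  points near \<open>x\<close> are closer together.\<close>

lemma quot_dist_near:
  assumes x: "x \<in> hspace" and gap: "\<And>g. g \<in> \<Gamma> \<Longrightarrow> hdist (g x) x < 4 * e \<Longrightarrow> g x = x"
    and pq: "p \<in> hspace" "q \<in> hspace" "hdist p x < e" "hdist q x < e"
  shows "quot_dist (orb \<Gamma> p) (orb \<Gamma> q) = hdist p q"
  unfolding quot_dist_def
proof (rule cInf_eq_minimum)
  show "hdist p q \<in> {hdist p' q' |p' q'. p' \<in> orb \<Gamma> p \<and> q' \<in> orb \<Gamma> q}"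
    using in_orb_self pq by blast
  fix d assume "d \<in> {hdist p' q' |p' q'. p' \<in> orb \<Gamma> p \<and> q' \<in> orb \<Gamma> q}"
  then obtain g h where g: "g \<in> \<Gamma>" and h: "h \<in> \<Gamma>" and d: "d = hdist (g p) (h q)" by (auto simp: orb_def)
  obtain k where k: "k \<in> \<Gamma>" "\<And>p. p \<in> hspace \<Longrightarrow> k (g p) = p" using inverse[OF g] by metis
  define l where "l = compose hspace k h"
  have l: "l \<in> \<Gamma>" unfolding l_def by (rule compose_in[OF k(1) h])
  have lq: "l q \<in> hspace" and lx: "l x \<in> hspace" using maps[OF l] pq x by blast+
  have "d = hdist (k (g p)) (k (h q))"
    unfolding d by (rule isometry[OF k(1) maps[OF g pq(1)] maps[OF h pq(2)], symmetric])
  then have d: "d = hdist p (l q)" using k(2)[OF pq(1)] compose_eq[OF pq(2), of k h] by (simp add: l_def)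
  show "hdist p q \<le> d"
  proof (cases "l x = x")
    case True
    then have "l q = q" using fixed_point_free[OF l x] pq(2) by simp
    then show ?thesis by (simp add: d)
  next
    case False
    then have "4 * e \<le> hdist (l x) x" using gap[OF l] by force
    also have "\<dots> \<le> hdist (l x) (l q) + hdist (l q) x" by (rule hdist_triangle[OF lx x lq])
    also have "\<dots> \<le> hdist (l x) (l q) + (hdist (l q) p + hdist p x)"
      using hdist_triangle[OF lq x pq(1)] by simp
    also have "hdist (l x) (l q) = hdist x q" by (rule isometry[OF l x pq(2)])
    finally have "2 * e \<le> d" using pq(3,4) by (simp add: d hdist_commute)
    moreover have "hdist p q \<le> hdist p x + hdist x q" by (rule hdist_triangle[OF pq(1,2) x])
    ultimately show ?thesis using pq(3,4) by (simp add: hdist_commute)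
  qed
qed

lemma simple_closed_geodesicI:
  assumes x: "\<And>s. x s \<in> hspace" "\<And>s u. hdist (x s) (x u) = \<bar>s - u\<bar>" and L: "L > 0"
    and period: "\<And>s u. orb \<Gamma> (x s) = orb \<Gamma> (x u) \<longleftrightarrow> (\<exists>k::int. u = s + of_int k * L)"
  shows "range (\<lambda>s. orb \<Gamma> (x s)) \<in> simple_closed_geodesics \<Gamma>"
proof -
  let ?c = "\<lambda>s. orb \<Gamma> (x s)"
  have "closed_geodesic \<Gamma> L ?c"
    unfolding closed_geodesic_def
  proof (intro conjI allI L)
    show "?c t \<in> quot_space \<Gamma>" for t unfolding quot_space_def using x(1) by (rule imageI)
    have "t + L = t + of_int (1::int) * L" for t by simp
    then have "?c t = ?c (t + L)" for t using period by blast
    then show "?c (t + L) = ?c t" for t by simp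
    fix t
    have pos: "snd (h (x t)) > 0" if "h \<in> \<Gamma>" for h using maps[OF that x(1)] by simp
    have "finite {g \<in> \<Gamma>. hdist (g (x t)) (x t) \<le> 1}" by (rule finite_bounded_displacement[OF x(1)])
    then have "finite ((\<lambda>g. g (x t)) ` {g \<in> \<Gamma>. hdist (g (x t)) (x t) \<le> 1})" by (rule finite_imageI)
    moreover have "(\<lambda>g. g (x t)) ` {g \<in> \<Gamma>. hdist (g (x t)) (x t) \<le> 1} = {g (x t) |g. g \<in> \<Gamma> \<and> hdist (g (x t)) (x t) \<le> 1}"
      by auto
    ultimately have fin: "finite {g (x t) |g. g \<in> \<Gamma> \<and> hdist (g (x t)) (x t) \<le> 1}" by simp
    obtain \<epsilon> where \<epsilon>: "\<epsilon> > 0" "\<And>g. g \<in> \<Gamma> \<Longrightarrow> hdist (g (x t)) (x t) < \<epsilon> \<Longrightarrow> g (x t) = x t"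
    proof (rule orbit_gap[where G = \<Gamma> and p = "x t"])
      show "x t \<in> hspace" by (rule x(1))
      show "\<And>h. h \<in> \<Gamma> \<Longrightarrow> snd (h (x t)) > 0" by (rule pos)
      show "finite {h (x t) |h. h \<in> \<Gamma> \<and> hdist (h (x t)) (x t) \<le> 1}" by (rule fin)
    qed blast
    define e where "e = \<epsilon> / 4"
    have "quot_dist (?c s) (?c u) = \<bar>s - u\<bar>" if "s \<in> {t - e<..<t + e}" "u \<in> {t - e<..<t + e}" for s u
    proof -
      have "hdist (x s) (x t) < e" "hdist (x u) (x t) < e" using that by (auto simp: x(2))
      then have "quot_dist (?c s) (?c u) = hdist (x s) (x u)"
        using \<epsilon>(2) by (intro quot_dist_near[of "x t" e] x(1)) (auto simp: e_def)
      then show ?thesis by (simp add: x(2))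
    qed
    moreover have "e > 0" using \<epsilon>(1) by (simp add: e_def)
    ultimately show "\<exists>e>0. \<forall>s\<in>{t - e<..<t + e}. \<forall>u\<in>{t - e<..<t + e}. quot_dist (?c s) (?c u) = \<bar>s - u\<bar>"
      by blast
  qed
  moreover have "inj_on ?c {0..<L}"
  proof (rule inj_onI)
    fix s u assume su: "s \<in> {0..<L}" "u \<in> {0..<L}" "?c s = ?c u"
    then obtain k :: int where k: "u = s + of_int k * L" using period by blast
    have "0 \<le> s" "s < L" "0 \<le> u" "u < L" using su by auto
    then have "of_int k * L < 1 * L" "(-1) * L < of_int k * L" using k by linarith+
    then have "of_int k < (1::real)" "(-1::real) < of_int k" using L by (simp_all only: mult_less_cancel_right_pos)
    then have "k = 0" by linarith
    then show "s = u" using k by simp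
  qed
  ultimately show ?thesis unfolding simple_closed_geodesics_def by blast
qed

end

context horocusp_chart
begin

text \<open>The orbits of the points of one closed geodesic have bounded heights, by compactness of a
  period. The top of an axis has half the distance of its ends as its height, so finitely
  many of the simple closed geodesics cannot account for arbitrarily long axes.\<close>

theorem infinite_simple_closed_geodesics:
  assumes "DIM('a) \<ge> 2" "\<not> elementary \<Gamma>"
    and "cusp_group \<Gamma> B \<cong> product_group {..<DIM('a)} (\<lambda>_. integer_group)"
  shows "infinite (simple_closed_geodesics \<Gamma>)"
proof
  assume fin: "finite (simple_closed_geodesics \<Gamma>)"
  obtain f where "cusped_isometry_group (conjugate ` \<Gamma>) f c"
    using conjugate_cusped_isometry_group[OF assms] .
  then interpret C: cusped_isometry_group "conjugate ` \<Gamma>" f c .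
  obtain r where bound: "\<And>h p. h \<in> conjugate ` \<Gamma> \<Longrightarrow> snd p > 0 \<Longrightarrow> snd (h p) \<le> max (snd p) (r\<^sup>2 / snd p)"
    and long: "\<And>R. \<exists>\<xi> \<eta> L. C.simple_axis \<xi> \<eta> L \<and> dist \<xi> \<eta> \<ge> R"
    using C.long_simple_axes by metis
  define curve where "curve \<xi> \<eta> = range (\<lambda>s. orb \<Gamma> (\<phi> (geod \<xi> \<eta> s)))" for \<xi> \<eta>
  define axes where "axes = {(\<xi>, \<eta>). \<exists>L. C.simple_axis \<xi> \<eta> L}"
  have related: "C.related x y \<longleftrightarrow> orb \<Gamma> (\<phi> x) = orb \<Gamma> (\<phi> y)" if xy: "x \<in> hspace" "y \<in> hspace" for x y
  proof -
    have "conjugate g x = y \<longleftrightarrow> g (\<phi> x) = \<phi> y" if g: "g \<in> \<Gamma>" for g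
      using \<phi>\<phi>[OF maps[OF g \<phi>_in[OF xy(1)]]] \<phi>\<phi>[OF xy(2)] unfolding conjugate_def by metis
    then show ?thesis
      unfolding C.related_def orb_eq_iff[OF \<phi>_in[OF xy(1)] \<phi>_in[OF xy(2)]] by blast
  qed
  have curve: "curve \<xi> \<eta> \<in> simple_closed_geodesics \<Gamma>" if "(\<xi>, \<eta>) \<in> axes" for \<xi> \<eta>
  proof -
    obtain L where ax: "C.simple_axis \<xi> \<eta> L" using \<open>(\<xi>, \<eta>) \<in> axes\<close> by (auto simp: axes_def)
    then have ne: "\<xi> \<noteq> \<eta>" and L: "L > 0"
      and per: "\<And>s. C.related (geod \<xi> \<eta> s) (geod \<xi> \<eta> (s + L))"
      and simple: "\<And>s u. C.related (geod \<xi> \<eta> s) (geod \<xi> \<eta> u) \<Longrightarrow> \<exists>k::int. u = s + of_int k * L"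
      unfolding C.simple_axis_def by blast+
    have H: "geod \<xi> \<eta> s \<in> hspace" for s using geod_in_hspace[OF ne] by simp
    show ?thesis unfolding curve_def
    proof (rule simple_closed_geodesicI[OF \<phi>_in[OF H] _ L])
      show "hdist (\<phi> (geod \<xi> \<eta> s)) (\<phi> (geod \<xi> \<eta> u)) = \<bar>s - u\<bar>" for s u
        using hisom_hdist[OF \<phi> H H] hdist_geod[OF ne] by simp
      show "orb \<Gamma> (\<phi> (geod \<xi> \<eta> s)) = orb \<Gamma> (\<phi> (geod \<xi> \<eta> u)) \<longleftrightarrow> (\<exists>k::int. u = s + of_int k * L)" for s u
        unfolding related[OF H H, symmetric] using simple C.related_periodic[OF ne per] by blast
    qed
  qed
  have bounded: "\<exists>K. \<forall>q\<in>\<Union>(curve \<xi> \<eta>). snd (\<phi> q) \<le> K" if "(\<xi>, \<eta>) \<in> axes" for \<xi> \<eta>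
  proof -
    obtain L where ax: "C.simple_axis \<xi> \<eta> L" using \<open>(\<xi>, \<eta>) \<in> axes\<close> by (auto simp: axes_def)
    then have ne: "\<xi> \<noteq> \<eta>" and L: "L > 0"
      and per: "\<And>s. C.related (geod \<xi> \<eta> s) (geod \<xi> \<eta> (s + L))"
      unfolding C.simple_axis_def by blast+
    have H: "geod \<xi> \<eta> s \<in> hspace" for s using geod_in_hspace[OF ne] by simp
    define D where "D = dist \<xi> \<eta>"
    have D: "D > 0" using ne by (simp add: D_def)
    have "snd (\<phi> q) \<le> max (D / 2) (r\<^sup>2 / (D / (2 * cosh L)))" if "q \<in> \<Union>(curve \<xi> \<eta>)" for q
    proof -
      obtain s where "q \<in> orb \<Gamma> (\<phi> (geod \<xi> \<eta> s))" using \<open>q \<in> \<Union>(curve \<xi> \<eta>)\<close> by (auto simp: curve_def)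
      then obtain g where g: "g \<in> \<Gamma>" "q = g (\<phi> (geod \<xi> \<eta> s))" by (auto simp: orb_def)
      define u where "u = s + of_int (- \<lfloor>s / L\<rfloor>) * L"
      have "of_int \<lfloor>s / L\<rfloor> \<le> s / L" "s / L \<le> of_int \<lfloor>s / L\<rfloor> + 1" by linarith+
      then have u: "0 \<le> u" "u \<le> L"
        using L unfolding pos_le_divide_eq[OF L] pos_divide_le_eq[OF L] by (simp_all add: u_def algebra_simps)
      have "C.related (geod \<xi> \<eta> s) (geod \<xi> \<eta> u)"
        unfolding u_def by (rule C.related_periodic[OF ne per])
      then have "C.related (geod \<xi> \<eta> u) (geod \<xi> \<eta> s)" by (rule C.related_sym[OF geod_in_hspace[OF ne]])
      moreover have "C.related (geod \<xi> \<eta> s) (\<phi> q)"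
        unfolding C.related_def using g by (auto simp: conjugate_def)
      ultimately have "C.related (geod \<xi> \<eta> u) (\<phi> q)" using C.related_trans[OF geod_in_hspace[OF ne]] by blast
      then obtain h where h: "h \<in> conjugate ` \<Gamma>" "h (geod \<xi> \<eta> u) = \<phi> q" by (auto simp: C.related_def)
      have ht: "snd (geod \<xi> \<eta> u) = D / (2 * cosh u)" by (simp add: snd_geod D_def)
      have "cosh u \<ge> 1" by (rule cosh_real_ge_1)
      then have up: "snd (geod \<xi> \<eta> u) \<le> D / 2" unfolding ht using D by (intro frac_le) auto
      have "cosh u \<le> cosh L" using u by (simp add: cosh_real_nonneg_le_iff)
      then have "D / (2 * cosh L) \<le> snd (geod \<xi> \<eta> u)" unfolding ht using D by (intro divide_left_mono mult_pos_pos) auto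
      then have "r\<^sup>2 / snd (geod \<xi> \<eta> u) \<le> r\<^sup>2 / (D / (2 * cosh L))"
        using D geod_in_hspace[OF ne] by (intro divide_left_mono mult_pos_pos) auto
      then show ?thesis using bound[OF h(1) geod_in_hspace[OF ne], of u] up h(2) by auto
    qed
    then show ?thesis by blast
  qed
  define curves where "curves = (\<lambda>(\<xi>, \<eta>). curve \<xi> \<eta>) ` axes"
  have fin_curves: "finite curves"
    unfolding curves_def using curve by (intro finite_subset[OF _ fin]) auto
  have "\<forall>X\<in>curves. \<exists>K. \<forall>q\<in>\<Union>X. snd (\<phi> q) \<le> K"
    unfolding curves_def using bounded by auto
  from bchoice[OF this] obtain k where k: "\<forall>X\<in>curves. \<forall>q\<in>\<Union>X. snd (\<phi> q) \<le> k X" by (rule exE)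
  define K where "K = Max (k ` curves)"
  have K: "snd (\<phi> q) \<le> K" if "X \<in> curves" "q \<in> \<Union>X" for X q
  proof -
    have "k X \<le> K" unfolding K_def using fin_curves that(1) by (intro Max_ge) auto
    moreover have "snd (\<phi> q) \<le> k X" using k that by blast
    ultimately show ?thesis by linarith
  qed
  obtain \<xi> \<eta> L where ax: "C.simple_axis \<xi> \<eta> L" "dist \<xi> \<eta> \<ge> 2 * (K + 1)" using long by blast
  then have ne: "\<xi> \<noteq> \<eta>" by (simp add: C.simple_axis_def)
  have H: "geod \<xi> \<eta> 0 \<in> hspace" using geod_in_hspace[OF ne] by simp
  have "\<phi> (geod \<xi> \<eta> 0) \<in> \<Union>(curve \<xi> \<eta>)" unfolding curve_def using in_orb_self[OF \<phi>_in[OF H]] by blast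
  moreover have "curve \<xi> \<eta> \<in> curves"
    unfolding curves_def using ax(1) by (intro image_eqI[of _ _ "(\<xi>, \<eta>)"]) (auto simp: axes_def)
  ultimately have "snd (\<phi> (\<phi> (geod \<xi> \<eta> 0))) \<le> K" using K by blast
  then have "dist \<xi> \<eta> / 2 \<le> K" unfolding \<phi>\<phi>[OF H] snd_geod by simp
  then show False using ax(2) by simp
qed

end

theorem theorem1p1:
  fixes \<Gamma> :: "('a::euclidean_space \<times> real \<Rightarrow> 'a \<times> real) set" and n :: nat
  assumes "n = DIM('a \<times> real)" and "n \<ge> 3"
    and "hyperbolic_manifold \<Gamma>" and "cusped \<Gamma>" and "\<not> elementary \<Gamma>"
    and "\<exists>B. horocusp \<Gamma> B \<and>
      cusp_group \<Gamma> B \<cong> product_group {..<n - 1} (\<lambda>_. integer_group)"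
  shows "infinite (simple_closed_geodesics \<Gamma>)"
proof -
  have n: "n - 1 = DIM('a)" using assms(1) by simp
  have dim: "DIM('a) \<ge> 2" using n assms(2) by simp
  obtain B where B: "horocusp \<Gamma> B" "cusp_group \<Gamma> B \<cong> product_group {..<DIM('a)} (\<lambda>_. integer_group)"
    using assms(6) unfolding n by blast
  have "horoball B" using B(1) by (simp add: horocusp_def)
  then show ?thesis
  proof (rule horoball_chart)
    fix \<phi> c
    assume "c > 0" "hisom \<phi>" "\<And>p. p \<in> hspace \<Longrightarrow> \<phi> (\<phi> p) = p" "B \<subseteq> hspace"
      "\<And>p. p \<in> hspace \<Longrightarrow> p \<in> B \<longleftrightarrow> snd (\<phi> p) > c"
      "\<And>p. p \<in> hspace \<Longrightarrow> p \<in> horosphere B \<longleftrightarrow> snd (\<phi> p) = c"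
    then interpret horocusp_chart \<Gamma> B \<phi> c
      using assms(3) B(1) by unfold_locales blast+
    show ?thesis by (rule infinite_simple_closed_geodesics[OF dim assms(5) B(2)])
  qed
qed

end
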